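(* Let $\nu\in\mathbb{R}$ and let $g\in L^1(\mathbb{R})\cap\mathcal{S}_0(\mathbb{R})$ be a totally positive function other than the one-sided exponential $e^{-t}1_{\mathbb{R}^+}(t)$. Assume that $\beta>0$ is rational. If $\beta<1$, then $\mathcal{G}_\nu(g,Z_\beta)$ is a Gabor frame for $L^2_\nu(0,1)$.
   Context: A measurable function $g:\mathbb{R}\to\mathbb{R}$ is totally positive if for every $N\in\mathbb{N}$ and all real $x_1<\dots<x_N$, $y_1<\dots<y_N$ one has $\det\left(g(x_j-y_k)\right)_{j,k=1}^N\ge0$. Windows $g$ are normalized by $\|g\|_{L^2(\mathbb{R})}=1$. $L^2_\nu(0,1)$ is the Hilbert space of measurable $f:\mathbb{R}\to\mathbb{C}$ with $f(t+k)=e^{2\pi ik\nu}f(t)$ for all $k\in\mathbb{Z}$ and $\int_0^1|f|^2<\infty$, with the inner product of $L^2(0,1)$. $M_\xi f(t)=e^{2\pi i\xi t}f(t)$, $V_gf(x,\xi)=\int_{\mathbb{R}}f(t)\overline{g(t-x)}e^{-2\pi i\xi t}dt$, $h_0(t)=2^{1/4}e^{-\pi t^2}$, $\mathcal{S}_0(\mathbb{R})=\{g\in L^2(\mathbb{R}):V_{h_0}g\in L^1(\mathbb{R}^2)\}$. $\Sigma_\nu f(t)=\sum_{k\in\mathbb{Z}}e^{2\pi ik\nu}f(t-k)$. $Z_\beta=\{(0,\beta n):n\in\mathbb{Z}\}$; $\mathcal{G}_\nu(g,Z_\beta)=\{\Sigma_\nu(M_{\beta n}g):n\in\mathbb{Z}\}$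 is a Gabor frame for $L^2_\nu(0,1)$ if there are $A,B>0$ with $A\|f\|^2\le\sum_{n}|\langle f,\Sigma_\nu(M_{\beta n}g)\rangle_{L^2_\nu(0,1)}|^2\le B\|f\|^2$ for all $f\in L^2_\nu(0,1)$. *)

theory Defs
  imports "HOL-Analysis.Analysis" "Jordan_Normal_Form.Determinant"
begin

text \<open>Measurability and integrals on the real line and the plane refer to Lebesgue measure
  \<^const>\<open>lebesgue\<close>. The names \<^const>\<open>Matrix.mat\<close> and \<^const>\<open>Determinant.det\<close> are qualified
  because \<open>HOL-Analysis\<close> has its own \<open>mat\<close> and \<open>det\<close>, whose dimension is a type.\<close>

definition totally_positive :: "(real \<Rightarrow> real) \<Rightarrow> bool" where
  "totally_positive g \<longleftrightarrow>
     g \<in> borel_measurable lebesgue \<and>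
     (\<forall>(N::nat) (x::nat \<Rightarrow> real) (y::nat \<Rightarrow> real).
        strict_mono_on {..<N} x \<longrightarrow> strict_mono_on {..<N} y \<longrightarrow>
        Determinant.det (Matrix.mat N N (\<lambda>(j, k). g (x j - y k))) \<ge> 0)"

definition L2 :: "(real \<Rightarrow> complex) set" where
  "L2 = {f \<in> borel_measurable lebesgue. integrable lebesgue (\<lambda>t. (cmod (f t))\<^sup>2)}"

definition L2_norm :: "(real \<Rightarrow> complex) \<Rightarrow> real" where
  "L2_norm f = sqrt (LINT t|lebesgue. (cmod (f t))\<^sup>2)"

definition modulation :: "real \<Rightarrow> (real \<Rightarrow> complex) \<Rightarrow> real \<Rightarrow> complex" where
  "modulation \<xi> f t = cis (2 * pi * \<xi> * t) * f t"

definition stft :: "(real \<Rightarrow> complex) \<Rightarrow> (real \<Rightarrow> complex) \<Rightarrow> real \<times> real \<Rightarrow> complex" where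
  "stft g f = (\<lambda>(x, \<xi>). LINT t|lebesgue. f t * cnj (g (t - x)) * cis (- 2 * pi * \<xi> * t))"

definition gaussian :: "real \<Rightarrow> complex" where
  "gaussian t = complex_of_real (2 powr (1/4) * exp (- pi * t\<^sup>2))"

definition S0 :: "(real \<Rightarrow> complex) set" where
  "S0 = {g \<in> L2. integrable (lebesgue :: (real \<times> real) measure) (stft gaussian g)}"

definition L2_quasi :: "real \<Rightarrow> (real \<Rightarrow> complex) set" where
  "L2_quasi \<nu> = {f \<in> borel_measurable lebesgue.
     (\<forall>(k::int) t. f (t + of_int k) = cis (2 * pi * of_int k * \<nu>) * f t) \<and>
     set_integrable lebesgue {0<..<1} (\<lambda>t. (cmod (f t))\<^sup>2)}"

definition inner01 :: "(real \<Rightarrow> complex) \<Rightarrow> (real \<Rightarrow> complex) \<Rightarrow> complex" where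
  "inner01 f h = (LINT t:{0<..<1}|lebesgue. f t * cnj (h t))"

definition norm01 :: "(real \<Rightarrow> complex) \<Rightarrow> real" where
  "norm01 f = sqrt (LINT t:{0<..<1}|lebesgue. (cmod (f t))\<^sup>2)"

text \<open>The value is 0 at those \<open>t\<close> where the series does not converge absolutely.\<close>

definition quasi_periodize :: "real \<Rightarrow> (real \<Rightarrow> complex) \<Rightarrow> real \<Rightarrow> complex" where
  "quasi_periodize \<nu> f t =
     (\<Sum>\<^sub>\<infinity>k\<in>(UNIV :: int set). cis (2 * pi * of_int k * \<nu>) * f (t - of_int k))"

definition gabor_system :: "real \<Rightarrow> (real \<Rightarrow> complex) \<Rightarrow> real \<Rightarrow> int \<Rightarrow> real \<Rightarrow> complex" where
  "gabor_system \<nu> g \<beta> n = quasi_periodize \<nu> (modulation (\<beta> * of_int n) g)"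

text \<open>Membership of the family in the Hilbert space and summability are stated explicitly,
  because integrals and infinite sums are total functions with value 0 where undefined.\<close>

definition is_gabor_frame :: "real \<Rightarrow> (real \<Rightarrow> complex) \<Rightarrow> real \<Rightarrow> bool" where
  "is_gabor_frame \<nu> g \<beta> \<longleftrightarrow>
     (\<forall>n. gabor_system \<nu> g \<beta> n \<in> L2_quasi \<nu>) \<and>
     (\<exists>A>0. \<exists>B>0. \<forall>f\<in>L2_quasi \<nu>.
        (\<lambda>n. (cmod (inner01 f (gabor_system \<nu> g \<beta> n)))\<^sup>2) summable_on UNIV \<and>
        A * (norm01 f)\<^sup>2 \<le> (\<Sum>\<^sub>\<infinity>n. (cmod (inner01 f (gabor_system \<nu> g \<beta> n)))\<^sup>2) \<and>
        (\<Sum>\<^sub>\<infinity>n. (cmod (inner01 f (gabor_system \<nu> g \<beta> n)))\<^sup>2) \<le> B * (norm01 f)\<^sup>2)"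

end

theory Submission
  imports Defs "HOL-Complex_Analysis.Complex_Analysis"
    "HOL-Computational_Algebra.Fundamental_Theorem_Algebra" "HOL-Library.Nat_Bijection"
begin

text \<open>
  Put \<open>\<beta> = p/q\<close> and \<open>\<gamma> = q/p > 1\<close>. For \<open>f \<in> L\<^sup>2\<^sub>\<nu>\<close> the frame coefficients are, up to a factor, the Fourier coefficients
  on \<open>(0, \<gamma>)\<close> of \<open>H f t = \<Sum>\<^sub>k f (t + k\<gamma>) g (t + k\<gamma>)\<close>. On the coset \<open>s + \<int>/p\<close> the function \<open>H f\<close> is a linear image of
  the quasi-periodic sequence \<open>c n = f (s + n/p)\<close>, so by Parseval the frame inequality says that these finite linear
  maps are injective, uniformly in \<open>s\<close>. Uniformity follows by compactness, as limits of translates of \<open>g\<close> are again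
  totally positive.

  For injectivity, a kernel element gives a bounded recurrent sequence \<open>d\<close> such that the comb
  \<open>t \<mapsto> \<Sum>\<^sub>k d k g (t - k\<gamma>)\<close> vanishes on a coset of \<open>\<int>\<close>. The comb of \<open>u k = (-1)\<^sup>k\<close> does not vanish identically and has
  constant sign on alternating blocks of length \<open>\<gamma> > 1\<close>, each of which meets that coset. Hence for every \<open>\<tau>\<close>
  the comb of \<open>u + \<tau> d\<close> alternates there with one sign change per coefficient. Since totally positive kernels diminish
  variation, \<open>u + \<tau> d\<close> cannot lose sign changes for any \<open>\<tau>\<close>, which forces \<open>d\<close> to be a multiple of \<open>u\<close> and then to vanish.
\<close>

section \<open>Totally positive kernels and variation diminution\<close>

text \<open>Variation diminution for an infinite comb holds only up to an additive constant, so a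
  contradiction needs an excess of sign changes that recurs: in every period, or infinitely often
  along a recurrent sequence. Recurrence replaces periodicity because for irrational
  \<open>\<nu>\<close> the sequence \<open>d\<close> need not be periodic. The delicate point is
  strictness, since total positivity gives only weak inequalities. That the alternating comb does
  not vanish rests on the unboundedness of the support of \<open>g\<close>: for bounded support the
  sampling polynomials would have only negative roots, which is too rigid as the mesh tends to 0.
  Its constant sign on blocks has two sources. A return to an earlier sign would give too many sign
  changes after a perturbation. Two zeros in one block would make two rows of the comb proportional,
  hence geometric on a half-line or on all integers, and such a row has no vanishing alternating
  sum. The limits of translates are needed at every point, not almost everywhere, because rows
  sample single points; log-concavity leaves only finitely many discontinuities to care
  about.\<close>

definition tp_kernel :: "(nat \<Rightarrow> nat \<Rightarrow> real) \<Rightarrow> nat \<Rightarrow> nat \<Rightarrow> bool" where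
  "tp_kernel K n m \<longleftrightarrow> (\<forall>N r c. strict_mono_on {..<N} r \<longrightarrow> strict_mono_on {..<N} c \<longrightarrow>
     r ` {..<N} \<subseteq> {..<n} \<longrightarrow> c ` {..<N} \<subseteq> {..<m} \<longrightarrow>
     Determinant.det (Matrix.mat N N (\<lambda>(i, j). K (r i) (c j))) \<ge> 0)"

lemma tp_kernelD:
  assumes "tp_kernel K n m" "strict_mono_on {..<N} r" "strict_mono_on {..<N} c"
    "\<And>i. i < N \<Longrightarrow> r i < n" "\<And>i. i < N \<Longrightarrow> c i < m"
  shows "Determinant.det (Matrix.mat N N (\<lambda>(i, j). K (r i) (c j))) \<ge> 0"
  using assms unfolding tp_kernel_def by (simp add: image_subset_iff)

lemma tp_kernel_skip_column:
  assumes "tp_kernel K n (Suc m)" "n' \<le> n"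
  shows "tp_kernel (\<lambda>i j. K i (if j < l then j else Suc j)) n' m"
  unfolding tp_kernel_def
proof (intro allI impI)
  fix N and r c :: "nat \<Rightarrow> nat"
  assume *: "strict_mono_on {..<N} r" "strict_mono_on {..<N} c"
    "r ` {..<N} \<subseteq> {..<n'}" "c ` {..<N} \<subseteq> {..<m}"
  have "strict_mono_on {..<N} (\<lambda>j. if c j < l then c j else Suc (c j))"
    using *(2) by (fastforce simp: strict_mono_on_def)
  moreover have "(if c i < l then c i else Suc (c i)) < Suc m" if "i < N" for i
    using *(4) that by (auto simp: image_subset_iff intro: less_SucI)
  moreover have "r i < n" if "i < N" for i
    using *(3) that assms(2) by (auto simp: image_subset_iff intro: less_le_trans)
  ultimately show "0 \<le> Determinant.det (Matrix.mat N N (\<lambda>(i, j). K (r i) (if c j < l then c j else Suc (c j))))"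
    using tp_kernelD[OF assms(1) *(1)] by simp
qed

lemma sum_skip:
  fixes f :: "nat \<Rightarrow> 'a::ab_group_add"
  assumes "l < Suc m"
  shows "(\<Sum>j<m. f (if j < l then j else Suc j)) = (\<Sum>j<Suc m. f j) - f l"
proof -
  have "bij_betw (\<lambda>j. if j < l then j else Suc j) {..<m} ({..<Suc m} - {l})"
    by (rule bij_betw_byWitness[where f' = "\<lambda>j. if j < l then j else j - 1"]) (use assms in auto)
  then have "(\<Sum>j<m. f (if j < l then j else Suc j)) = sum f ({..<Suc m} - {l})"
    by (rule sum.reindex_bij_betw)
  also have "\<dots> = (\<Sum>j<Suc m. f j) - f l"
    using assms by (simp add: sum_diff1)
  finally show ?thesis .
qed

text \<open>If there were more rows than columns, the Laplace expansion of the singular matrix \<open>[K | K d]\<close>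
  along its last column would be a vanishing sum of terms of one sign. So all minors vanish,
  and a column can be eliminated.\<close>

lemma tp_kernel_alternation_le:
  assumes "tp_kernel K n m" "\<forall>i<n. (-1)^i * (\<Sum>j<m. K i j * d j) > 0"
  shows "n \<le> m"
  using assms
proof (induction m arbitrary: K d n)
  case 0
  then show ?case by (metis lessThan_0 mult_zero_right order_less_irrefl sum.empty not_gr_zero le0 le_refl)
next
  case (Suc m)
  define M where "M = Suc m"
  define v where "v i = (\<Sum>j<M. K i j * d j)" for i
  show ?case
  proof (rule ccontr)
    assume "\<not> n \<le> Suc m"
    then have nM: "Suc M \<le> n" by (simp add: M_def)
    have vpos: "(-1)^i * v i > 0" if "i < Suc M" for i
      using Suc.prems(2) that nM by (auto simp: v_def M_def)
    define A where "A = Matrix.mat (Suc M) (Suc M) (\<lambda>(i,j). if j < M then K i j else v i)"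
    have A: "A \<in> carrier_mat (Suc M) (Suc M)" by (simp add: A_def)
    define w where "w = Matrix.vec (Suc M) (\<lambda>j. if j < M then d j else (-1::real))"
    have "A *\<^sub>v w = 0\<^sub>v (Suc M)"
      by (rule eq_vecI) (auto simp: A_def w_def scalar_prod_def v_def atLeast0LessThan)
    moreover have "w \<noteq> 0\<^sub>v (Suc M)"
    proof
      assume "w = 0\<^sub>v (Suc M)"
      then have "vec_index w M = vec_index (0\<^sub>v (Suc M)) M" by simp
      then show False by (simp add: w_def)
    qed
    moreover have "w \<in> carrier_vec (Suc M)" by (simp add: w_def)
    ultimately have det0: "Determinant.det A = 0"
      using det_0_iff_vec_prod_zero[OF A] by blast
    define D where "D i = Determinant.det (mat_delete A i M)" for i
    have mdel: "mat_delete A i M = Matrix.mat M M (\<lambda>(a,b). K (if a < i then a else Suc a) b)" for i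
      by (rule eq_matI) (auto simp: mat_delete_def A_def)
    have Dpos: "D i \<ge> 0" if "i < Suc M" for i
      unfolding D_def mdel
      by (rule tp_kernelD[OF Suc.prems(1), where c = "\<lambda>b. b" and r = "\<lambda>a. if a < i then a else Suc a"])
         (use nM in \<open>auto simp: strict_mono_on_def M_def\<close>)
    have "0 = (\<Sum>i<Suc M. A $$ (i,M) * cofactor A i M)"
      using laplace_expansion_column[OF A, of M] det0 by simp
    also have "\<dots> = (\<Sum>i<Suc M. (-1)^M * (((-1)^i * v i) * D i))"
      by (rule sum.cong) (auto simp: A_def cofactor_def D_def power_add)
    also have "\<dots> = (-1)^M * (\<Sum>i<Suc M. ((-1)^i * v i) * D i)"
      by (simp only: sum_distrib_left)
    finally have "(\<Sum>i<Suc M. ((-1)^i * v i) * D i) = 0" by simp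
    then have "((-1)^M * v M) * D M = 0"
      using vpos Dpos by (subst (asm) sum_nonneg_eq_0_iff) (auto intro!: mult_nonneg_nonneg simp: less_imp_le)
    then have "D M = 0" using vpos[of M] by (auto simp: mult_eq_0_iff)
    moreover have "mat_delete A M M = Matrix.mat M M (\<lambda>(a,b). K a b)"
      unfolding mdel by (rule eq_matI) auto
    ultimately have "Determinant.det (Matrix.mat M M (\<lambda>(a,b). K a b)) = 0" by (simp add: D_def)
    \<comment> \<open>The vanishing minor consists of the first \<open>M\<close> rows and all
      \<open>M\<close> columns of \<open>K\<close>, so on these rows the columns are
      dependent.\<close>
    then obtain x where x: "x \<in> carrier_vec M" "x \<noteq> 0\<^sub>v M" "Matrix.mat M M (\<lambda>(a,b). K a b) *\<^sub>v x = 0\<^sub>v M"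
      using det_0_iff_vec_prod_zero[of "Matrix.mat M M (\<lambda>(a,b). K a b)" M] by auto
    obtain l where l: "l < M" "vec_index x l \<noteq> 0"
      using x(1,2) by (metis eq_vecI carrier_vecD index_zero_vec(1,2))
    have ker: "(\<Sum>j<M. K i j * vec_index x j) = 0" if "i < M" for i
    proof -
      have "vec_index (Matrix.mat M M (\<lambda>(a,b). K a b) *\<^sub>v x) i = 0" using x(3) that by simp
      then show ?thesis using that x(1) by (simp add: scalar_prod_def atLeast0LessThan)
    qed
    \<comment> \<open>Moving along the kernel vector makes the coefficient of column
      \<open>l\<close> zero and keeps the values in the first \<open>M\<close> rows. The induction
      then meets \<open>M = Suc m\<close> alternating values produced by only \<open>m\<close>
      columns.\<close>
    define d' where "d' j = d j - d l / vec_index x l * vec_index x j" for j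
    have d'l: "d' l = 0" using l by (simp add: d'_def)
    have v': "(\<Sum>j<M. K i j * d' j) = v i" if "i < M" for i
    proof -
      have "(\<Sum>j<M. K i j * d' j) = v i - d l / vec_index x l * (\<Sum>j<M. K i j * vec_index x j)"
        by (simp add: d'_def v_def algebra_simps sum_subtractf sum_distrib_left)
      then show ?thesis using ker[OF that] by simp
    qed
    have "M \<le> m"
    proof (rule Suc.IH)
      show "tp_kernel (\<lambda>i j. K i (if j < l then j else Suc j)) M m"
        using tp_kernel_skip_column[OF Suc.prems(1), of M l] nM by simp
      have "(\<Sum>j<m. K i (if j < l then j else Suc j) * d' (if j < l then j else Suc j)) = v i" if "i < M" for i
        using sum_skip[of l m "\<lambda>j. K i j * d' j"] v'[OF that] d'l l(1) by (simp add: M_def)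
      then show "\<forall>i<M. (-1)^i * (\<Sum>j<m. K i (if j < l then j else Suc j) * d' (if j < l then j else Suc j)) > 0"
        using vpos by simp
    qed
    then show False by (simp add: M_def)
  qed
qed

text \<open>Cofactors along column \<open>k\<close> do not involve that column, so the Laplace
  expansion along it is linear in its entries.\<close>

lemma det_column_linear:
  fixes a b :: "nat \<Rightarrow> real"
  assumes "k < N"
  shows "Determinant.det (Matrix.mat N N (\<lambda>(i,j). if j = k then a i + r * b i else C i j)) =
    Determinant.det (Matrix.mat N N (\<lambda>(i,j). if j = k then a i else C i j)) +
    r * Determinant.det (Matrix.mat N N (\<lambda>(i,j). if j = k then b i else C i j))"
proof -
  define X where "X f = Matrix.mat N N (\<lambda>(i,j). if j = k then f i else C i j)" for f :: "nat \<Rightarrow> real"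
  have "mat_delete (X f) i k = mat_delete (X g) i k" for f g i
    by (rule eq_matI) (auto simp: mat_delete_def X_def)
  then have cof: "cofactor (X f) i k = cofactor (X g) i k" for f g i
    unfolding cofactor_def by metis
  have det: "Determinant.det (X f) = (\<Sum>i<N. f i * cofactor (X f) i k)" for f
    using assms by (subst laplace_expansion_column[of _ N k]) (auto simp: X_def)
  have "Determinant.det (X (\<lambda>i. a i + r * b i)) = Determinant.det (X a) + r * Determinant.det (X b)"
    unfolding det cof[of "\<lambda>i. a i + r * b i" _ a] cof[of b _ a]
    by (simp add: algebra_simps sum.distrib sum_distrib_left)
  then show ?thesis by (simp add: X_def)
qed

text \<open>A minor through the merged column splits by linearity into one through column
  \<open>l\<close> plus \<open>r\<close> times one through column \<open>Suc l\<close>. The two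
  columns are adjacent, so in either case the selected columns are still in increasing order and
  both terms are minors of \<open>K\<close>.\<close>

lemma tp_kernel_merge:
  assumes K: "tp_kernel K n (Suc m)" and "r \<ge> 0" "Suc l < Suc m"
  shows "tp_kernel (\<lambda>i j. if j = l then K i l + r * K i (Suc l) else K i (if j < l then j else Suc j)) n m"
    (is "tp_kernel ?K n m")
  unfolding tp_kernel_def
proof (intro allI impI)
  fix N and \<rho> c :: "nat \<Rightarrow> nat"
  assume *: "strict_mono_on {..<N} \<rho>" "strict_mono_on {..<N} c"
    "\<rho> ` {..<N} \<subseteq> {..<n}" "c ` {..<N} \<subseteq> {..<m}"
  show "0 \<le> Determinant.det (Matrix.mat N N (\<lambda>(i, j). ?K (\<rho> i) (c j)))"
  proof (cases "\<exists>k<N. c k = l")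
    case False
    define c' where "c' j = (if c j < l then c j else Suc (c j))" for j
    have "Matrix.mat N N (\<lambda>(i, j). ?K (\<rho> i) (c j)) = Matrix.mat N N (\<lambda>(i, j). K (\<rho> i) (c' j))"
      using False by (intro eq_matI) (auto simp: c'_def)
    moreover have "strict_mono_on {..<N} c'"
      using *(2) by (fastforce simp: strict_mono_on_def c'_def)
    moreover have "c' j < Suc m" if "j < N" for j
      using that *(4) by (auto simp: c'_def image_subset_iff intro: less_SucI)
    ultimately show ?thesis
      using tp_kernelD[OF K *(1), of c'] *(3) by (auto simp: image_subset_iff)
  next
    case True
    then obtain k where k: "k < N" "c k = l" by blast
    have ck: "c j < l \<longleftrightarrow> j < k" "c j = l \<longleftrightarrow> j = k" if "j < N" for j
      using strict_mono_onD[OF *(2), of j k] strict_mono_onD[OF *(2), of k j] that k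
      by (cases j k rule: linorder_cases; auto)+
    \<comment> \<open>Translates a selection of merged columns into one of original columns, with
      \<open>x\<close> standing for the merged one.\<close>
    define c' where "c' x j = (if j = k then x else if c j < l then c j else Suc (c j))" for x j
    have c': "strict_mono_on {..<N} (c' x)" "\<forall>j<N. c' x j < Suc m" if "x = l \<or> x = Suc l" for x
    proof -
      have "c' x i < c' x j" if "i < j" "j < N" for i j
        using strict_mono_onD[OF *(2), of i j] strict_mono_onD[OF *(2), of i k]
          strict_mono_onD[OF *(2), of k j] that k \<open>x = l \<or> x = Suc l\<close> ck[of i] ck[of j]
        by (cases "i = k"; cases "j = k") (auto simp: c'_def)
      then show "strict_mono_on {..<N} (c' x)" by (auto simp: strict_mono_on_def)
      show "\<forall>j<N. c' x j < Suc m"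
        using *(4) \<open>x = l \<or> x = Suc l\<close> assms(3) by (auto simp: c'_def image_subset_iff intro: less_SucI)
    qed
    have eq: "Matrix.mat N N (\<lambda>(i, j). if j = k then K (\<rho> i) x else K (\<rho> i) (c' x j)) =
      Matrix.mat N N (\<lambda>(i, j). K (\<rho> i) (c' x j))" for x
      by (rule eq_matI) (auto simp: c'_def)
    have pos: "Determinant.det (Matrix.mat N N (\<lambda>(i, j). if j = k then K (\<rho> i) x else K (\<rho> i) (c' x j))) \<ge> 0"
      if "x = l \<or> x = Suc l" for x
      unfolding eq using tp_kernelD[OF K *(1) c'(1)[OF that]] c'(2)[OF that] *(3) by (auto simp: image_subset_iff)
    have eq2: "Matrix.mat N N (\<lambda>(i, j). if j = k then K (\<rho> i) (Suc l) else K (\<rho> i) (c' (Suc l) j)) =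
       Matrix.mat N N (\<lambda>(i, j). if j = k then K (\<rho> i) (Suc l) else K (\<rho> i) (c' l j))"
      by (rule eq_matI) (auto simp: c'_def)
    have "Matrix.mat N N (\<lambda>(i, j). ?K (\<rho> i) (c j)) =
      Matrix.mat N N (\<lambda>(i, j). if j = k then K (\<rho> i) l + r * K (\<rho> i) (Suc l) else K (\<rho> i) (c' l j))"
      using ck by (intro eq_matI) (auto simp: c'_def)
    then have "Determinant.det (Matrix.mat N N (\<lambda>(i, j). ?K (\<rho> i) (c j))) =
       Determinant.det (Matrix.mat N N (\<lambda>(i,j). if j = k then K (\<rho> i) l else K (\<rho> i) (c' l j))) +
       r * Determinant.det (Matrix.mat N N (\<lambda>(i,j). if j = k then K (\<rho> i) (Suc l) else K (\<rho> i) (c' (Suc l) j)))"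
      using det_column_linear[OF k(1), of "\<lambda>i. K (\<rho> i) l" r "\<lambda>i. K (\<rho> i) (Suc l)" "\<lambda>i j. K (\<rho> i) (c' l j)"]
      unfolding eq2 by simp
    then show ?thesis using pos assms(2) by simp
  qed
qed

text \<open>Two neighbouring coefficients of the same sign can share one column: their joint
  contribution is \<open>d l\<close> times column \<open>l\<close> plus \<open>r\<close> times the
  next column, with \<open>r > 0\<close>. Each element of \<open>T\<close> thus saves a column
  without changing the values, and the bound by the number of columns applies to what is
  left.\<close>

theorem tp_kernel_variation_diminishing:
  assumes "tp_kernel K n m" "\<forall>i<n. (-1)^i * (\<Sum>j<m. K i j * d j) > 0"
    "\<And>j. j \<in> T \<Longrightarrow> Suc j < m \<and> d j * d (Suc j) > 0"
  shows "n + card T \<le> m"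
  using assms
proof (induction "card T" arbitrary: K d m T)
  case 0
  moreover have "finite T" using 0(4) by (meson finite_nat_set_iff_bounded Suc_lessD)
  ultimately show ?case using tp_kernel_alternation_le by simp
next
  case (Suc t)
  have fin: "finite T" using Suc.prems(3) by (meson finite_nat_set_iff_bounded Suc_lessD)
  have ne: "T \<noteq> {}" using Suc.hyps(2) by auto
  \<comment> \<open>Merging at the largest element leaves the indices of the other pairs unchanged.
    A pair ending at \<open>l\<close> keeps its sign because the merged column has coefficient
    \<open>d l\<close> again.\<close>
  define l where "l = Max T"
  have lT: "l \<in> T" using fin ne by (simp add: l_def)
  then have l: "Suc l < m" "d l * d (Suc l) > 0" using Suc.prems(3) by auto
  then obtain m' where m': "m = Suc m'" by (cases m) auto
  define r where "r = d (Suc l) / d l"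
  have dl: "d l \<noteq> 0" using l(2) by auto
  have r: "r > 0" using l(2) unfolding r_def by (metis mult.commute zero_less_divide_iff zero_less_mult_iff)
  define K' where "K' = (\<lambda>i j. if j = l then K i l + r * K i (Suc l) else K i (if j < l then j else Suc j))"
  define d' where "d' j = (if j \<le> l then d j else d (Suc j))" for j
  have sum: "(\<Sum>j<m'. K' i j * d' j) = (\<Sum>j<m. K i j * d j)" for i
  proof -
    have "(\<Sum>j<m'. K' i j * d' j) = (\<Sum>j<m'. (\<lambda>j. K i j * d j) (if j < Suc l then j else Suc j)) +
        (\<Sum>j<m'. if j = l then K i (Suc l) * d (Suc l) else 0)"
      unfolding sum.distrib[symmetric] using dl
      by (intro sum.cong) (auto simp: K'_def d'_def r_def field_simps less_Suc_eq)
    also have "\<dots> = (\<Sum>j<m. K i j * d j)"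
      by (subst sum_skip) (use l m' in auto)
    finally show ?thesis .
  qed
  have "n + card (T - {l}) \<le> m'"
  proof (rule Suc.hyps(1))
    show "t = card (T - {l})" using Suc.hyps(2) lT fin by simp
    show "tp_kernel K' n m'"
      unfolding K'_def using tp_kernel_merge[of K n m' r l] Suc.prems(1) r l m' by simp
    show "\<forall>i<n. (-1)^i * (\<Sum>j<m'. K' i j * d' j) > 0" using Suc.prems(2) by (simp add: sum)
    fix j assume j: "j \<in> T - {l}"
    then have "j < l" using fin by (metis DiffD1 DiffD2 Max_ge insertI1 l_def le_neq_implies_less)
    then show "Suc j < m' \<and> d' j * d' (Suc j) > 0"
      using Suc.prems(3)[of j] j l m' by (auto simp: d'_def)
  qed
  then show ?case using lT fin m' by (metis Suc_le_mono add_Suc_right card_Suc_Diff1)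
qed

section \<open>Combs of totally positive functions\<close>

lemma summable_on_int_exp:
  assumes "b > (0::real)"
  shows "(\<lambda>k::int. exp (- b * \<bar>of_int k\<bar>)) summable_on UNIV"
proof -
  have s: "summable (\<lambda>n::nat. exp (- b * of_nat n))"
    using summable_geometric[of "exp (- b)"] assms
    by (simp add: exp_of_nat_mult[symmetric] mult.commute)
  then have n: "(\<lambda>n::nat. exp (- b * of_nat n)) summable_on UNIV"
    by (intro norm_summable_imp_summable_on) simp
  have "(\<lambda>k::int. exp (- b * \<bar>of_int k\<bar>)) summable_on (range int)"
    by (subst summable_on_reindex) (use n in \<open>auto simp: o_def inj_on_def\<close>)
  moreover have "(\<lambda>k::int. exp (- b * \<bar>of_int k\<bar>)) summable_on (range (\<lambda>n. - int n))"
    by (subst summable_on_reindex) (use n in \<open>auto simp: o_def inj_on_def\<close>)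
  ultimately have "(\<lambda>k::int. exp (- b * \<bar>of_int k\<bar>)) summable_on (range int \<union> range (\<lambda>n. - int n))"
    by (rule summable_on_union)
  moreover have "k \<in> range int \<union> range (\<lambda>n. - int n)" for k
    by (cases k rule: int_cases2) auto
  then have "range int \<union> range (\<lambda>n. - int n) = UNIV" by blast
  ultimately show ?thesis by simp
qed

lemma infsum_int_tail:
  fixes f :: "int \<Rightarrow> real"
  assumes f: "f summable_on UNIV" "\<And>k. f k \<ge> 0" and "\<eta> > 0"
  shows "\<exists>W::nat. W \<ge> 1 \<and> infsum f {k. \<bar>k\<bar> \<ge> int W} < \<eta>"
proof -
  obtain F where F: "finite F" "dist (sum f F) (infsum f UNIV) \<le> \<eta>/2"
    using infsum_finite_approximation[OF f(1), of "\<eta>/2"] assms(3) by auto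
  have "infsum f (F \<union> -F) = infsum f F + infsum f (-F)"
    by (intro infsum_Un_disjoint summable_on_subset[OF f(1)]) auto
  then have lt: "infsum f (-F) < \<eta>" using F assms(3) by (auto simp: dist_real_def)
  define W where "W = Suc (\<Sum>k\<in>F. nat \<bar>k\<bar>)"
  have "{k. \<bar>k\<bar> \<ge> int W} \<subseteq> -F"
  proof
    fix k assume k: "k \<in> {k. \<bar>k\<bar> \<ge> int W}"
    have "nat \<bar>k\<bar> < W" if "k \<in> F"
      unfolding W_def less_Suc_eq_le using that F(1) by (intro member_le_sum) auto
    with k show "k \<in> -F" by fastforce
  qed
  then have "infsum f {k. \<bar>k\<bar> \<ge> int W} \<le> infsum f (-F)"
    by (intro infsum_mono2 summable_on_subset[OF f(1)]) (use f(2) in auto)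
  moreover have "W \<ge> 1" by (simp add: W_def)
  ultimately show ?thesis using lt by (intro exI[of _ W] conjI) linarith+
qed

lemma infsum_int_shift: "infsum (\<lambda>k::int. f (k + m)) UNIV = infsum f UNIV"
  by (rule infsum_reindex_bij_witness[of _ "\<lambda>k. k - m" "\<lambda>k. k + m"]) auto

lemma summable_on_int_shift: "(\<lambda>k::int. f (k + m)) summable_on UNIV \<longleftrightarrow> f summable_on UNIV"
  by (rule summable_on_reindex_bij_witness[of _ "\<lambda>k. k - m" "\<lambda>k. k + m"]) auto

definition comb :: "(real \<Rightarrow> real) \<Rightarrow> real \<Rightarrow> (int \<Rightarrow> real) \<Rightarrow> real \<Rightarrow> real" where
  "comb g h v t = (\<Sum>\<^sub>\<infinity>k\<in>(UNIV::int set). v k * g (t - of_int k * h))"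

section \<open>Log-concavity and decay\<close>

locale tp_function =
  fixes g :: "real \<Rightarrow> real"
  assumes tp: "\<And>N x y. strict_mono_on {..<N} x \<Longrightarrow> strict_mono_on {..<N} y \<Longrightarrow>
        Determinant.det (Matrix.mat N N (\<lambda>(j, k). g (x j - y k))) \<ge> 0"
begin

lemma nonneg: "g t \<ge> 0"
proof -
  have "0 \<le> Determinant.det (Matrix.mat 1 1 (\<lambda>(j, k). g ((\<lambda>_. t) j - (\<lambda>_. 0) k)))"
    by (rule tp) (auto simp: strict_mono_on_def)
  then show ?thesis by (simp add: det_single)
qed

lemma tp_kernel_comb:
  assumes "strict_mono_on {..<n} x" "strict_mono_on {..<m} y"
  shows "tp_kernel (\<lambda>i j. g (x i - y j)) n m"
  unfolding tp_kernel_def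
proof (intro allI impI)
  fix N and r c :: "nat \<Rightarrow> nat"
  assume *: "strict_mono_on {..<N} r" "strict_mono_on {..<N} c"
    "r ` {..<N} \<subseteq> {..<n}" "c ` {..<N} \<subseteq> {..<m}"
  have "strict_mono_on {..<N} (x \<circ> r)" "strict_mono_on {..<N} (y \<circ> c)"
    using * assms by (auto simp: strict_mono_on_def image_subset_iff)
  from tp[OF this] show "0 \<le> Determinant.det (Matrix.mat N N (\<lambda>(i, j). g (x (r i) - y (c j))))"
    by simp
qed

text \<open>This is log-concavity, read off from the 2 by 2 minor with row points \<open>m1\<close>,
  \<open>w\<close> and column points 0, \<open>m1 - u\<close>.\<close>

lemma tp2:
  assumes "u < m1" "m1 < w" "m1 + m2 = u + w"
  shows "g u * g w \<le> g m1 * g m2"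
proof -
  define x y where "x i = (if i = 0 then m1 else w)" and "y i = (if i = 0 then 0 else m1 - u)" for i :: nat
  have "0 \<le> Determinant.det (Matrix.mat 2 2 (\<lambda>(j, k). g (x j - y k)))"
    by (rule tp) (use assms in \<open>auto simp: strict_mono_on_def x_def y_def\<close>)
  also have "\<dots> = (\<Sum>i<2. Matrix.mat 2 2 (\<lambda>(j, k). g (x j - y k)) $$ (i, 0) *
       cofactor (Matrix.mat 2 2 (\<lambda>(j, k). g (x j - y k))) i 0)"
    by (rule laplace_expansion_column) auto
  also have "\<dots> = g m1 * g (w - (m1 - u)) - g w * g u"
    by (simp add: numeral_2_eq_2 cofactor_def mat_delete_def det_single x_def y_def)
  also have "w - (m1 - u) = m2" using assms by simp
  finally show ?thesis by (simp add: mult.commute)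
qed

text \<open>A zero between two positive values would contradict log-concavity; the support is an
  interval.\<close>

lemma pos_between:
  assumes "g u > 0" "g w > 0" "u < m" "m < w"
  shows "g m > 0"
proof (rule ccontr)
  assume "\<not> g m > 0"
  then have "g m = 0" using nonneg[of m] by simp
  moreover have "g u * g w \<le> g m * g (u + w - m)" by (rule tp2) (use assms in auto)
  ultimately show False using mult_pos_pos[OF assms(1,2)] by simp
qed

text \<open>For positive values this says that \<open>g (x + d) / g x\<close> is antitone in
  \<open>x\<close>. The product form also covers zeros of \<open>g\<close>.\<close>

lemma ratio_antimono:
  assumes "x \<le> y" "d \<ge> 0"
  shows "g x * g (y + d) \<le> g (x + d) * g y"
proof (cases "x = y \<or> d = 0")
  case False
  then show ?thesis using assms by (intro tp2) auto
qed (auto simp: mult.commute)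

end

text \<open>\<open>C\<close> and \<open>a\<close> are parameters, so that limits of translates can
  be shown to inherit the same constants. \<open>two_points\<close> excludes the zero function and
  functions supported at a single point, all of whose minors can be nonnegative.\<close>

locale tp_decay = tp_function +
  fixes C a :: real
  assumes decay: "\<And>t. g t \<le> C * exp (- a * \<bar>t\<bar>)"
    and a_pos: "a > 0"
    and two_points: "\<exists>s t. s < t \<and> g s > 0 \<and> g t > 0"
begin

lemma C_pos: "C > 0"
proof -
  obtain s where "g s > 0" using two_points by blast
  with decay[of s] have "0 < C * exp (- a * \<bar>s\<bar>)" by simp
  then show ?thesis by (simp add: zero_less_mult_iff)
qed

lemma g_le_shift:
  "g (t - of_int k * h) \<le> C * exp (a * \<bar>t\<bar>) * exp (- (a * \<bar>h\<bar>) * \<bar>of_int k\<bar>)"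
proof -
  have "\<bar>of_int k\<bar> * \<bar>h\<bar> - \<bar>t\<bar> \<le> \<bar>t - of_int k * h\<bar>" by (simp add: abs_mult[symmetric])
  then have "a * (\<bar>of_int k\<bar> * \<bar>h\<bar> - \<bar>t\<bar>) \<le> a * \<bar>t - of_int k * h\<bar>" using a_pos by simp
  then have "exp (- a * \<bar>t - of_int k * h\<bar>) \<le> exp (a * \<bar>t\<bar> + - (a * \<bar>h\<bar>) * \<bar>of_int k\<bar>)"
    by (simp add: algebra_simps)
  then have "C * exp (- a * \<bar>t - of_int k * h\<bar>) \<le> C * (exp (a * \<bar>t\<bar>) * exp (- (a * \<bar>h\<bar>) * \<bar>of_int k\<bar>))"
    unfolding exp_add[symmetric] using C_pos by (intro mult_left_mono) auto
  with decay[of "t - of_int k * h"] show ?thesis by (simp add: mult.assoc)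
qed

lemma summable_shift:
  assumes "h \<noteq> 0"
  shows "(\<lambda>k::int. g (t - of_int k * h)) summable_on UNIV"
proof -
  have "(\<lambda>k::int. C * exp (a * \<bar>t\<bar>) * exp (- (a * \<bar>h\<bar>) * \<bar>of_int k\<bar>)) summable_on UNIV"
    by (intro summable_on_cmult_right summable_on_int_exp) (use a_pos assms in auto)
  then show ?thesis
    by (rule summable_on_comparison_test) (use nonneg g_le_shift in blast)+
qed

lemma summable_comb_abs:
  assumes "h \<noteq> 0" "\<And>k. \<bar>v k\<bar> \<le> V"
  shows "(\<lambda>k::int. \<bar>v k * g (t - of_int k * h)\<bar>) summable_on UNIV"
proof -
  have "(\<lambda>k::int. V * g (t - of_int k * h)) summable_on UNIV"
    by (intro summable_on_cmult_right summable_shift assms)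
  moreover have "\<bar>v k * g (t - of_int k * h)\<bar> \<le> V * g (t - of_int k * h)" for k
    using nonneg assms(2) by (simp add: abs_mult mult_right_mono)
  ultimately show ?thesis by (rule summable_on_comparison_test) auto
qed

lemma summable_comb:
  assumes "h \<noteq> 0" "\<And>k. \<bar>v k\<bar> \<le> V"
  shows "(\<lambda>k::int. v k * g (t - of_int k * h)) summable_on UNIV"
  using summable_comb_abs[OF assms] by (subst summable_on_iff_abs_summable_on_real) simp

lemma comb_add:
  assumes "h \<noteq> 0" "\<And>k. \<bar>v k\<bar> \<le> V" "\<And>k. \<bar>w k\<bar> \<le> V'"
  shows "comb g h (\<lambda>k. v k + r * w k) t = comb g h v t + r * comb g h w t"
proof -
  have "comb g h (\<lambda>k. v k + r * w k) t =
      (\<Sum>\<^sub>\<infinity>k\<in>(UNIV::int set). v k * g (t - of_int k * h) + r * (w k * g (t - of_int k * h)))"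
    by (simp add: comb_def algebra_simps)
  also have "\<dots> = comb g h v t + r * comb g h w t"
    unfolding comb_def
    by (subst infsum_add) (auto intro!: summable_on_cmult_right summable_comb assms infsum_cmult_right)
  finally show ?thesis .
qed

lemma comb_shift: "comb g h v (t + of_int N * h) = comb g h (\<lambda>k. v (k + N)) t"
proof -
  have "comb g h v (t + of_int N * h) = (\<Sum>\<^sub>\<infinity>k\<in>(UNIV::int set). v (k + N) * g (t + of_int N * h - of_int (k + N) * h))"
    unfolding comb_def by (rule infsum_int_shift[symmetric])
  then show ?thesis by (simp add: comb_def algebra_simps)
qed

lemma comb_cmult: "comb g h (\<lambda>k. r * v k) t = r * comb g h v t"
  by (simp add: comb_def mult.assoc infsum_cmult_right')

text \<open>To the left of the window distances are measured from \<open>X\<close>, to the right of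
  it from \<open>X + of_nat D * h\<close>. After a shift by \<open>D\<close> both parts are tails of
  one exponential series, which is why \<open>W\<close> does not depend on \<open>D\<close>.\<close>

lemma comb_tail:
  assumes "h > 0" "\<eta> > 0"
  shows "\<exists>W::nat. W \<ge> 1 \<and> (\<forall>(D::nat) t. t \<in> {X..X + of_nat D * h} \<longrightarrow>
    (\<Sum>\<^sub>\<infinity>k\<in>-{- int W..<int (D + W)}. g (t - of_int k * h)) < \<eta>)"
proof -
  define B where "B = C * exp (a * \<bar>X\<bar>)"
  define f where "f k = B * exp (- (a * h) * \<bar>of_int k\<bar>)" for k :: int
  have B: "B > 0" using C_pos by (simp add: B_def)
  have fs: "f summable_on UNIV" unfolding f_def
    by (intro summable_on_cmult_right summable_on_int_exp) (use a_pos assms in auto)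
  obtain W where W: "W \<ge> 1" "infsum f {k. \<bar>k\<bar> \<ge> int W} < \<eta>/2"
    using infsum_int_tail[OF fs, of "\<eta>/2"] B assms by (auto simp: f_def)
  \<comment> \<open>The series restricted to its tail. Together with its copy shifted by
    \<open>D\<close> it majorizes both ends at once.\<close>
  define f1 where "f1 k = (if \<bar>k\<bar> \<ge> int W then f k else 0)" for k
  have f1: "infsum f1 UNIV = infsum f {k. \<bar>k\<bar> \<ge> int W}" "f1 summable_on UNIV" "f1 k \<ge> 0" for k
    using B by (auto simp: f1_def f_def split: if_splits intro!: infsum_cong_neutral summable_on_comparison_test[OF fs])
  have main: "(\<Sum>\<^sub>\<infinity>k\<in>-{- int W..<int (D + W)}. g (t - of_int k * h)) < \<eta>"
    if t: "t \<in> {X..X + of_nat D * h}" for D :: nat and t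
  proof -
    have bnd: "g (t - of_int k * h) \<le> f1 k + f1 (k + (- int D))" if k: "k \<in> -{- int W..<int (D + W)}" for k
    proof -
      have le: "g (t - of_int k * h) \<le> f k'" if "\<bar>of_int k'\<bar> * h - \<bar>X\<bar> \<le> \<bar>t - of_int k * h\<bar>" for k'
      proof -
        have "a * (\<bar>of_int k'\<bar> * h - \<bar>X\<bar>) \<le> a * \<bar>t - of_int k * h\<bar>" using a_pos that by simp
        then have "exp (- a * \<bar>t - of_int k * h\<bar>) \<le> exp (a * \<bar>X\<bar> + - (a * h) * \<bar>of_int k'\<bar>)"
          by (simp add: algebra_simps)
        then have "C * exp (- a * \<bar>t - of_int k * h\<bar>) \<le> f k'"
          unfolding f_def B_def mult.assoc exp_add[symmetric] using C_pos by (intro mult_left_mono) auto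
        with decay[of "t - of_int k * h"] show ?thesis by simp
      qed
      consider "k < - int W" | "k \<ge> int D + int W" using k by force
      then show ?thesis
      proof cases
        case 1
        have "\<bar>real_of_int k\<bar> * h = - (real_of_int k * h)" using 1 by simp
        then have "g (t - of_int k * h) \<le> f k"
          using t abs_ge_self[of "t - of_int k * h"] abs_ge_minus_self[of X] by (intro le) auto
        then have "g (t - of_int k * h) \<le> f1 k" using 1 by (simp add: f1_def)
        then show ?thesis using f1(3)[of "k + (- int D)"] by simp
      next
        case 2
        have "0 \<le> real_of_int (k - int D) * h" using 2 assms by (intro mult_nonneg_nonneg) auto
        moreover have "real_of_int (k - int D) \<ge> 0" using 2 by (simp del: of_int_diff)
        ultimately have "g (t - of_int k * h) \<le> f (k - int D)"
          using t by (intro le) (auto simp: algebra_simps abs_if)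
        then have "g (t - of_int k * h) \<le> f1 (k + (- int D))" using 2 by (simp add: f1_def)
        then show ?thesis using f1(3)[of k] by simp
      qed
    qed
    have sm: "(\<lambda>k. f1 k + f1 (k + (- int D))) summable_on UNIV"
      by (intro summable_on_add f1(2)) (use f1(2) summable_on_int_shift in blast)
    have "(\<Sum>\<^sub>\<infinity>k\<in>-{- int W..<int (D + W)}. g (t - of_int k * h)) \<le> (\<Sum>\<^sub>\<infinity>k\<in>-{- int W..<int (D + W)}. f1 k + f1 (k + (- int D)))"
    proof (rule infsum_mono)
      show "(\<lambda>k. g (t - of_int k * h)) summable_on -{- int W..<int (D + W)}"
        by (rule summable_on_subset[OF summable_shift]) (use assms in auto)
      show "(\<lambda>k. f1 k + f1 (k + (- int D))) summable_on -{- int W..<int (D + W)}"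
        by (rule summable_on_subset[OF sm]) auto
    qed (rule bnd)
    also have "\<dots> \<le> (\<Sum>\<^sub>\<infinity>k. f1 k + f1 (k + (- int D)))"
      by (intro infsum_mono2 summable_on_subset[OF sm] sm) (use f1(3) in auto)
    also have "\<dots> = infsum f1 UNIV + infsum (\<lambda>k. f1 (k + (- int D))) UNIV"
      by (intro infsum_add f1(2)) (use f1(2) summable_on_int_shift in blast)
    also have "\<dots> = 2 * infsum f1 UNIV" unfolding infsum_int_shift by simp
    also have "\<dots> < \<eta>" using W f1(1) by simp
    finally show ?thesis .
  qed
  with W(1) show ?thesis by blast
qed

text \<open>Up to a constant independent of the length \<open>D\<close> of the window, a comb has at most as many
  sign changes as its coefficient sequence.\<close>

lemma comb_variation_diminishing:
  assumes h: "h > 0" and \<delta>: "\<delta> > 0"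
  shows "\<exists>m::nat. \<forall>(D::nat) n t v T. strict_mono_on {..<n} t \<longrightarrow> (\<forall>i<n. t i \<in> {X..X + of_nat D * h}) \<longrightarrow>
     (\<forall>k. \<bar>v k\<bar> \<le> V) \<longrightarrow> (\<forall>i<n. (-1)^i * comb g h v (t i) \<ge> \<delta>) \<longrightarrow>
     T \<subseteq> {0..<int D} \<longrightarrow> (\<forall>k\<in>T. v k * v (k + 1) > 0) \<longrightarrow> n + card T \<le> D + m"
proof -
  define V' where "V' = \<bar>V\<bar> + 1"
  obtain W where W: "W \<ge> 1" "\<And>(D::nat) t. t \<in> {X..X + of_nat D * h} \<Longrightarrow>
    (\<Sum>\<^sub>\<infinity>k\<in>-{- int W..<int (D + W)}. g (t - of_int k * h)) < \<delta> / V'"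
    using comb_tail[OF h, of "\<delta>/V'" X] \<delta> by (auto simp: V'_def)
  show ?thesis
  proof (intro exI[of _ "2 * W"] allI impI)
    fix D n :: nat and t and v :: "int \<Rightarrow> real" and T
    assume t: "strict_mono_on {..<n} t" "\<forall>i<n. t i \<in> {X..X + of_nat D * h}"
      and v: "\<forall>k. \<bar>v k\<bar> \<le> V" and alt: "\<forall>i<n. (-1)^i * comb g h v (t i) \<ge> \<delta>"
      and T: "T \<subseteq> {0..<int D}" "\<forall>k\<in>T. v k * v (k + 1) > 0"
    define I where "I = {- int W..<int (D + W)}"
    \<comment> \<open>The columns are the indices from \<open>- W\<close> to
      \<open>D + W - 1\<close>, renumbered from 0. The remaining indices move the comb by less than
      \<open>\<delta>\<close> and cannot change its sign; the \<open>2 * W\<close> surplus columns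
      are the additive constant.\<close>
    define K where "K i j = g (t i - of_int (int j - int W) * h)" for i j
    have "n + card ((\<lambda>k. nat (k + int W)) ` T) \<le> D + 2 * W"
    proof (rule tp_kernel_variation_diminishing)
      show "tp_kernel K n (D + 2 * W)"
        unfolding K_def by (intro tp_kernel_comb t) (use h in \<open>auto simp: strict_mono_on_def\<close>)
      show "\<forall>i<n. 0 < (-1)^i * (\<Sum>j<D + 2 * W. K i j * v (int j - int W))"
      proof (intro allI impI)
        fix i assume i: "i < n"
        define \<phi> where "\<phi> k = v k * g (t i - of_int k * h)" for k
        have sm: "\<phi> summable_on UNIV" "(\<lambda>k. \<bar>\<phi> k\<bar>) summable_on UNIV"
          unfolding \<phi>_def using h v by (auto intro: summable_comb summable_comb_abs)
        have "comb g h v (t i) = infsum \<phi> (I \<union> -I)" by (simp add: comb_def \<phi>_def[abs_def])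
        also have "\<dots> = infsum \<phi> I + infsum \<phi> (-I)"
          by (intro infsum_Un_disjoint summable_on_subset[OF sm(1)]) auto
        also have "infsum \<phi> I = (\<Sum>k\<in>I. \<phi> k)" by (simp add: I_def)
        also have "\<dots> = (\<Sum>j<D + 2 * W. K i j * v (int j - int W))"
          by (rule sum.reindex_bij_witness[of _ "\<lambda>j. int j - int W" "\<lambda>k. nat (k + int W)"])
             (auto simp: I_def K_def \<phi>_def)
        finally have eq: "comb g h v (t i) = (\<Sum>j<D + 2 * W. K i j * v (int j - int W)) + infsum \<phi> (-I)" .
        have "\<bar>infsum \<phi> (-I)\<bar> \<le> (\<Sum>\<^sub>\<infinity>k\<in>-I. \<bar>\<phi> k\<bar>)"
          using norm_infsum_bound[of \<phi> "-I"] summable_on_subset[OF sm(2), of "-I"] by simp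
        also have "\<dots> \<le> (\<Sum>\<^sub>\<infinity>k\<in>-I. V' * g (t i - of_int k * h))"
        proof (rule infsum_mono)
          show "(\<lambda>k. V' * g (t i - of_int k * h)) summable_on -I"
            by (intro summable_on_cmult_right summable_on_subset[OF summable_shift]) (use h in auto)
          fix k
          have "\<bar>v k\<bar> \<le> V'" using v by (auto simp: V'_def intro: order_trans)
          then show "\<bar>\<phi> k\<bar> \<le> V' * g (t i - of_int k * h)"
            using nonneg by (auto simp: \<phi>_def abs_mult intro: mult_right_mono)
        qed (auto intro: summable_on_subset[OF sm(2)])
        also have "\<dots> = V' * (\<Sum>\<^sub>\<infinity>k\<in>-I. g (t i - of_int k * h))" by (rule infsum_cmult_right')
        also have "\<dots> < V' * (\<delta> / V')"
          using W(2)[of "t i" D] t(2) i by (intro mult_strict_left_mono) (auto simp: I_def V'_def)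
        also have "\<dots> = \<delta>" by (simp add: V'_def)
        finally have "\<bar>(-1)^i * infsum \<phi> (-I)\<bar> < \<delta>" by (simp add: abs_mult)
        moreover have "(-1)^i * comb g h v (t i) \<ge> \<delta>" using alt i by blast
        ultimately show "0 < (-1)^i * (\<Sum>j<D + 2 * W. K i j * v (int j - int W))"
          unfolding eq distrib_left by linarith
      qed
      fix j assume "j \<in> (\<lambda>k. nat (k + int W)) ` T"
      then obtain k where k: "k \<in> T" "j = nat (k + int W)" by blast
      then have "0 \<le> k" "k < int D" "v k * v (k + 1) > 0" using T by auto
      then show "Suc j < D + 2 * W \<and> 0 < v (int j - int W) * v (int (Suc j) - int W)"
        using k W(1) by (auto simp: algebra_simps)
    qed
    moreover have "card ((\<lambda>k. nat (k + int W)) ` T) = card T"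
    proof (intro card_image inj_onI)
      fix x y assume *: "x \<in> T" "y \<in> T" "nat (x + int W) = nat (y + int W)"
      then have "0 \<le> x" "0 \<le> y" using T(1) by auto
      with *(3) show "x = y" by simp
    qed
    ultimately show "n + card T \<le> D + 2 * W" by simp
  qed
qed

section \<open>Periodic coefficient sequences\<close>

lemma periodic_bounded:
  fixes v :: "int \<Rightarrow> real"
  assumes "N \<ge> 1" "\<And>k. v (k + int N) = v k"
  shows "\<exists>V. \<forall>k. \<bar>v k\<bar> \<le> V"
proof -
  have per: "v (k + int N * j) = v k" for k j
  proof (induction j rule: int_induct[of _ 0])
    case (step1 i)
    then show ?case using assms(2)[of "k + int N * i"] by (simp add: algebra_simps)
  next
    case (step2 i)
    then show ?case using assms(2)[of "k + int N * (i - 1)"] by (simp add: algebra_simps)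
  qed simp
  have "\<bar>v k\<bar> \<le> (\<Sum>j\<in>{0..<int N}. \<bar>v j\<bar>)" for k
  proof -
    have "v k = v (k mod int N)" using per[of "k mod int N" "k div int N"] by (simp add: algebra_simps)
    moreover have "k mod int N \<in> {0..<int N}" using assms(1) by auto
    ultimately show ?thesis by (metis (no_types, lifting) abs_ge_zero finite_atLeastLessThan_int member_le_sum)
  qed
  then show ?thesis by blast
qed

text \<open>Repeating the rows over \<open>J\<close> periods and letting \<open>J\<close> grow removes the additive constant.\<close>

lemma comb_periodic_variation_diminishing:
  assumes h: "h > 0" and N: "N \<ge> 1" and per: "\<And>k. v (k + int N) = v k"
    and n: "even n" and s: "strict_mono_on {..<n} s" "\<And>i. i < n \<Longrightarrow> s i < s 0 + of_nat N * h"
    and alt: "\<And>i. i < n \<Longrightarrow> (-1)^i * comb g h v (s i) > 0"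
    and T: "T \<subseteq> {0..<int N}" "\<And>k. k \<in> T \<Longrightarrow> v k * v (k + 1) > 0"
  shows "n + card T \<le> N"
proof (cases "n = 0")
  case True
  then show ?thesis using card_mono[OF _ T(1)] by simp
next
  case False
  obtain V where V: "\<And>k. \<bar>v k\<bar> \<le> V" using periodic_bounded[of N v] N per by blast
  define \<delta> where "\<delta> = Min ((\<lambda>i. (-1)^i * comb g h v (s i)) ` {..<n})"
  have \<delta>: "\<delta> > 0" "\<And>i. i < n \<Longrightarrow> \<delta> \<le> (-1)^i * comb g h v (s i)"
  proof -
    have "\<delta> \<in> (\<lambda>i. (-1)^i * comb g h v (s i)) ` {..<n}"
      unfolding \<delta>_def using False by (intro Min_in) auto
    then show "\<delta> > 0" using alt by auto
    show "\<And>i. i < n \<Longrightarrow> \<delta> \<le> (-1)^i * comb g h v (s i)"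
      by (auto simp: \<delta>_def intro!: Min_le)
  qed
  obtain m where m: "\<And>(D::nat) n t v T. strict_mono_on {..<n} t \<Longrightarrow> (\<forall>i<n. t i \<in> {s 0..s 0 + of_nat D * h}) \<Longrightarrow>
     (\<forall>k. \<bar>v k\<bar> \<le> V) \<Longrightarrow> (\<forall>i<n. (-1)^i * comb g h v (t i) \<ge> \<delta>) \<Longrightarrow>
     T \<subseteq> {0..<int D} \<Longrightarrow> (\<forall>k\<in>T. v k * v (k + 1) > 0) \<Longrightarrow> n + card T \<le> D + m"
    using comb_variation_diminishing[OF h \<delta>(1), of "s 0" V] by metis
  have perj: "v (k + int N * int j) = v k" for k j
  proof (induction j)
    case (Suc j)
    then show ?case using per[of "k + int N * int j"] by (simp add: algebra_simps)
  qed simp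
  \<comment> \<open>With more periods than \<open>m\<close>, an excess of one sign change per period
    already outweighs the constant.\<close>
  define J where "J = Suc m"
  define t where "t i = s (i mod n) + of_nat (i div n) * of_nat N * h" for i
  define T' where "T' = (\<lambda>(k, j). k + int N * int j) ` (T \<times> {..<J})"
  have finT: "finite T" using T(1) finite_subset by blast
  have "n * J + card T' \<le> N * J + m"
  proof (rule m)
    show "\<forall>k. \<bar>v k\<bar> \<le> V" using V by blast
    show "strict_mono_on {..<n * J} t"
    proof (rule strict_mono_onI)
      fix i j assume ij: "i \<in> {..<n * J}" "j \<in> {..<n * J}" "i < j"
      have mm: "i mod n < n" "j mod n < n" using False by auto
      have s0: "s 0 \<le> s l" if "l < n" for l
        using strict_mono_onD[OF s(1), of 0 l] that False by (cases "l = 0") auto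
      show "t i < t j"
      proof (cases "i div n = j div n")
        case True
        then have "i mod n < j mod n" using ij(3)
          by (metis mult_div_mod_eq nat_add_left_cancel_less)
        then show ?thesis using strict_mono_onD[OF s(1), of "i mod n" "j mod n"] mm True by (simp add: t_def)
      next
        case False
        then have "Suc (i div n) \<le> j div n" using div_le_mono[of i j n] ij(3) by simp
        then have "real (Suc (i div n)) * (of_nat N * h) \<le> real (j div n) * (of_nat N * h)"
          using h by (intro mult_right_mono) auto
        moreover have "s (i mod n) < s (j mod n) + of_nat N * h"
          using s(2)[OF mm(1)] s0[OF mm(2)] by simp
        ultimately show ?thesis by (simp add: t_def algebra_simps)
      qed
    qed
    show "\<forall>i<n * J. t i \<in> {s 0..s 0 + of_nat (N * J) * h}"
    proof (intro allI impI)
      fix i assume i: "i < n * J"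
      have mm: "i mod n < n" using False by auto
      have "s 0 \<le> s (i mod n)"
        using strict_mono_onD[OF s(1), of 0 "i mod n"] mm False by (cases "i mod n = 0") auto
      moreover have "s (i mod n) < s 0 + of_nat N * h" using s(2)[OF mm] .
      moreover have "real (i div n) * (of_nat N * h) \<ge> 0" using h by simp
      moreover have "Suc (i div n) \<le> J" using i by (simp add: less_mult_imp_div_less mult.commute Suc_leI)
      then have "real (Suc (i div n)) * (of_nat N * h) \<le> real J * (of_nat N * h)"
        using h by (intro mult_right_mono) auto
      ultimately show "t i \<in> {s 0..s 0 + of_nat (N * J) * h}"
        by (simp add: t_def algebra_simps)
    qed
    show "\<forall>i<n * J. (-1)^i * comb g h v (t i) \<ge> \<delta>"
    proof (intro allI impI)
      fix i assume i: "i < n * J"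
      have "comb g h v (t i) = comb g h (\<lambda>k. v (k + int (i div n * N))) (s (i mod n))"
        using comb_shift[of h v "s (i mod n)" "int (i div n * N)"] by (simp add: t_def)
      also have "(\<lambda>k. v (k + int (i div n * N))) = v"
        using perj[of _ "i div n"] by (intro ext) (simp add: mult.commute)
      finally have "comb g h v (t i) = comb g h v (s (i mod n))" .
      \<comment> \<open>Since \<open>n\<close> is even, the alternation continues with the right
        sign from one period to the next.\<close>
      moreover have "(-1::real)^i = (-1)^(i mod n)"
        using n by (metis (no_types, lifting) dvd_mult2 mod_mult_div_eq power_add power_minus_mult minus_one_power_iff even_add)
      ultimately show "(-1)^i * comb g h v (t i) \<ge> \<delta>" using \<delta>(2)[of "i mod n"] False by simp
    qed
    show "T' \<subseteq> {0..<int (N * J)}"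
    proof
      fix x assume "x \<in> T'"
      then obtain k j where kj: "k \<in> T" "j < J" "x = k + int N * int j" by (auto simp: T'_def)
      have k: "0 \<le> k" "k < int N" using kj(1) T(1) by auto
      have "int N * int (Suc j) \<le> int N * int J" using kj(2) by (intro mult_left_mono) auto
      then show "x \<in> {0..<int (N * J)}" using k kj(3) by (auto simp: algebra_simps)
    qed
    show "\<forall>k\<in>T'. v k * v (k + 1) > 0"
    proof
      fix x assume "x \<in> T'"
      then obtain k j where kj: "k \<in> T" "x = k + int N * int j" by (auto simp: T'_def)
      then show "v x * v (x + 1) > 0"
        using T(2)[OF kj(1)] perj[of k j] perj[of "k + 1" j] by (simp add: algebra_simps)
    qed
  qed
  moreover have "card T' = card T * J"
  proof -
    have "inj_on (\<lambda>(k, j). k + int N * int j) (T \<times> {..<J})"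
    proof (rule inj_onI, clarify)
      fix k j k' j' assume *: "k \<in> T" "k' \<in> T" "k + int N * int j = k' + int N * int j'"
      then have "(k + int N * int j) mod int N = (k' + int N * int j') mod int N" by simp
      then have "k mod int N = k' mod int N" by simp
      then have "k = k'" using * T(1) by (auto simp: subset_iff)
      with * N show "k = k' \<and> j = j'" by simp
    qed
    then show ?thesis by (simp add: T'_def card_image card_cartesian_product)
  qed
  ultimately have "(n + card T) * J \<le> N * J + m" by (simp add: algebra_simps)
  then have "\<not> Suc N \<le> n + card T"
    using mult_le_mono1[of "Suc N" "n + card T" J] by (auto simp: J_def)
  then show ?thesis by simp
qed

end

section \<open>Symbols and their roots\<close>

text \<open>By compactness a subsequence of the powers converges, so two powers with far apart
  exponents are close; the difference of the exponents serves as \<open>k\<close>.\<close>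

lemma cis_recurrence:
  assumes "\<eta> > 0"
  shows "\<exists>k::nat. k \<ge> N \<and> cmod (cis (\<alpha> * of_nat k) - 1) < \<eta>"
proof -
  have "\<forall>n. cis (\<alpha> * of_nat n) \<in> cball 0 1" by simp
  from seq_compactE[OF compact_imp_seq_compact[OF compact_cball] this]
  obtain l r where r: "strict_mono r" "(\<lambda>n. cis (\<alpha> * of_nat (r n))) \<longlonglongrightarrow> l"
    unfolding o_def by blast
  then have "Cauchy (\<lambda>n. cis (\<alpha> * of_nat (r n)))" by (meson convergentI convergent_Cauchy)
  then obtain M where M: "\<And>m n. m \<ge> M \<Longrightarrow> n \<ge> M \<Longrightarrow> dist (cis (\<alpha> * of_nat (r m))) (cis (\<alpha> * of_nat (r n))) < \<eta>"
    using metric_CauchyD[OF _ assms] by metis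
  have ge: "r (M + N) \<ge> r M + N" for N
  proof (induction N)
    case (Suc N)
    have "r (M + N) < r (M + Suc N)" using r(1) by (simp add: strict_mono_def)
    with Suc show ?case by simp
  qed simp
  define k where "k = r (M + N) - r M"
  have k: "r (M + N) = r M + k" "k \<ge> N" using ge[of N] by (auto simp: k_def)
  have "cis (\<alpha> * of_nat (r (M + N))) - cis (\<alpha> * of_nat (r M)) = cis (\<alpha> * of_nat (r M)) * (cis (\<alpha> * of_nat k) - 1)"
    by (simp add: k(1) algebra_simps cis_mult)
  then have "dist (cis (\<alpha> * of_nat (r (M + N)))) (cis (\<alpha> * of_nat (r M))) = cmod (cis (\<alpha> * of_nat k) - 1)"
    by (simp add: dist_norm norm_mult)
  with M[of "M + N" M] k(2) show ?thesis by auto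
qed

text \<open>Since \<open>a 0\<close> is nonzero, the equation at \<open>j\<close> can be solved for
  \<open>u j\<close> in terms of earlier values; values below index \<open>m\<close> are
  unconstrained.\<close>

lemma alternating_convolution_solution:
  fixes a :: "nat \<Rightarrow> real"
  assumes "a 0 \<noteq> 0"
  shows "\<exists>u. \<forall>j<n. m \<le> j \<longrightarrow> (\<Sum>i\<le>m. a i * u (j - i)) = (-1)^j"
proof (induction n)
  case (Suc n)
  then obtain u where u: "\<And>j. j < n \<Longrightarrow> m \<le> j \<Longrightarrow> (\<Sum>i\<le>m. a i * u (j - i)) = (-1)^j" by blast
  define u' where "u' = u(n := ((-1)^n - (\<Sum>i\<in>{1..m}. a i * u (n - i))) / a 0)"
  have "(\<Sum>i\<le>m. a i * u' (j - i)) = (-1)^j" if "j < Suc n" "m \<le> j" for j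
  proof (cases "j < n")
    case True
    then have "u' (j - i) = u (j - i)" for i by (auto simp: u'_def)
    then show ?thesis using u True that by simp
  next
    case False
    then have [simp]: "j = n" using that by simp
    have "{..m} = insert 0 {1..m}" by auto
    then have "(\<Sum>i\<le>m. a i * u' (n - i)) = a 0 * u' n + (\<Sum>i\<in>{1..m}. a i * u' (n - i))" by simp
    also have "(\<Sum>i\<in>{1..m}. a i * u' (n - i)) = (\<Sum>i\<in>{1..m}. a i * u (n - i))"
      using that by (intro sum.cong) (auto simp: u'_def)
    finally show ?thesis using assms by (simp add: u'_def)
  qed
  then show ?case by blast
qed simp

text \<open>Each linear factor can be treated alone: for a root \<open>- \<rho>\<close> the squared
  modulus of \<open>cis \<theta> + \<rho>\<close> is the sum of
  \<open>(cos (\<theta>/2) * (1 + \<rho>))^2\<close> and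
  \<open>(sin (\<theta>/2) * (1 - \<rho>))^2\<close>, and the second summand is dropped.\<close>

lemma cmod_poly_cis_ge:
  fixes p :: "complex poly"
  assumes "\<And>w. poly p w = 0 \<Longrightarrow> Im w = 0 \<and> Re w \<le> 0" "cos (\<theta>/2) \<ge> 0"
  shows "cos (\<theta>/2) ^ degree p * cmod (poly p 1) \<le> cmod (poly p (cis \<theta>))"
  using assms(1)
proof (induction "degree p" arbitrary: p)
  case 0
  then obtain c where "p = [:c:]" by (metis degree_eq_zeroE)
  then show ?case by simp
next
  case (Suc n)
  then obtain w where w: "poly p w = 0"
    using alg_closed_imp_poly_has_root[of p] by auto
  then obtain q where q: "p = [:- w, 1:] * q" by (metis poly_eq_0_iff_dvd dvdE)
  have "q \<noteq> 0" using Suc(2) q by auto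
  then have deg: "degree p = Suc (degree q)" unfolding q by (subst degree_mult_eq) auto
  define \<rho> where "\<rho> = - Re w"
  have w': "w = - of_real \<rho>" "\<rho> \<ge> 0" using Suc.prems[OF w] by (auto simp: complex_eq_iff \<rho>_def)
  have IH: "cos (\<theta>/2) ^ degree q * cmod (poly q 1) \<le> cmod (poly q (cis \<theta>))"
    by (rule Suc.hyps(1)) (use Suc deg q in auto)
  have "(cos (\<theta>/2))\<^sup>2 = (1 + cos \<theta>) / 2"
    using cos_double_cos[of "\<theta>/2"] by simp
  then have "(cos (\<theta>/2) * cmod (1 - w))\<^sup>2 = (1 + cos \<theta>) / 2 * (1 + \<rho>)\<^sup>2"
    by (simp add: power_mult_distrib w' cmod_power2)
  also have "\<dots> \<le> (1 + cos \<theta>) / 2 * (1 + \<rho>)\<^sup>2 + (1 - cos \<theta>) / 2 * (1 - \<rho>)\<^sup>2" by simp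
  also have "\<dots> = (cos \<theta> + \<rho>)\<^sup>2 + (sin \<theta>)\<^sup>2"
    unfolding sin_squared_eq by (simp add: power2_eq_square field_simps)
  also have "\<dots> = (cmod (cis \<theta> - w))\<^sup>2" by (simp add: w' cmod_power2)
  finally have "cos (\<theta>/2) * cmod (1 - w) \<le> cmod (cis \<theta> - w)"
    by (rule power2_le_imp_le) simp
  then have "(cos (\<theta>/2) * cmod (1 - w)) * (cos (\<theta>/2) ^ degree q * cmod (poly q 1)) \<le> cmod (cis \<theta> - w) * cmod (poly q (cis \<theta>))"
    using IH assms(2) by (intro mult_mono) auto
  moreover have "poly p z = (z - w) * poly q z" for z by (simp add: q algebra_simps)
  ultimately show ?case unfolding deg by (simp add: norm_mult mult_ac)
qed

context tp_decay begin

text \<open>A root \<open>w\<close> off the negative axis yields real sequences annihilated by convolution with fewer than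
  maximally many sign changes, and these can be perturbed so that the convolution alternates.\<close>

lemma sample_polynomial_root:
  fixes w :: complex
  assumes h: "h > 0" and supp: "\<And>k::int. g (s + of_int k * h) > 0 \<longleftrightarrow> 0 \<le> k \<and> k \<le> int m"
    and root: "(\<Sum>i\<le>m. of_real (g (s + of_nat i * h)) * w ^ i) = 0"
  shows "Im w = 0 \<and> Re w < 0"
proof (rule ccontr)
  assume neg: "\<not> (Im w = 0 \<and> Re w < 0)"
  define b where "b i = g (s + of_nat i * h)" for i
  have b0: "b 0 > 0" using supp[of 0] by (simp add: b_def)
  have "w \<noteq> 0"
  proof
    assume "w = 0"
    then have "(\<Sum>i\<le>m. complex_of_real (b i) * w ^ i) = (\<Sum>i\<le>m. if i = 0 then complex_of_real (b 0) else 0)"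
      by (intro sum.cong) auto
    then show False using root b0 by (simp add: b_def)
  qed
  define \<rho> \<theta> where "\<rho> = cmod w" and "\<theta> = Arg w"
  have w: "w = of_real \<rho> * cis \<theta>" using \<open>w \<noteq> 0\<close> by (metis \<rho>_def \<theta>_def rcis_cmod_Arg rcis_def)
  have \<rho>: "\<rho> > 0" using \<open>w \<noteq> 0\<close> by (simp add: \<rho>_def)
  have "cos \<theta> \<noteq> - 1"
  proof
    assume c: "cos \<theta> = - 1"
    then have "sin \<theta> = 0" using sin_cos_squared_add[of \<theta>] by simp
    then show False using neg \<rho> c by (simp add: w)
  qed
  then have c: "cos \<theta> > - 1" using cos_ge_minus_one[of \<theta>] by linarith
  \<comment> \<open>Powers of \<open>1 / w\<close> solve the recurrence with coefficients
    \<open>b\<close>. The phase \<open>\<theta>/2\<close> makes the product of neighbours a positive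
    multiple of \<open>cos (2 * \<theta> * k) + cos \<theta>\<close>, which is positive infinitely
    often as soon as \<open>cos \<theta> > - 1\<close>.\<close>
  define d where "d k = Re (cis (\<theta>/2) * (1 / w) ^ k)" for k :: nat
  have d: "d k = (1/\<rho>) ^ k * cos (\<theta>/2 - \<theta> * of_nat k)" for k
  proof -
    have "1 / w = of_real (1/\<rho>) * cis (- \<theta>)" by (simp add: w divide_inverse)
    then have "(1 / w) ^ k = of_real (1/\<rho>) ^ k * cis (- \<theta>) ^ k" by (simp only: power_mult_distrib)
    then have "(1 / w) ^ k = of_real ((1/\<rho>) ^ k) * cis (of_nat k * - \<theta>)"
      by (simp only: Complex.DeMoivre of_real_power)
    then have "cis (\<theta>/2) * (1 / w) ^ k = of_real ((1/\<rho>) ^ k) * (cis (\<theta>/2) * cis (of_nat k * - \<theta>))"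
      by simp
    then have "d k = Re (of_real ((1/\<rho>) ^ k) * cis (\<theta>/2 + of_nat k * - \<theta>))"
      unfolding d_def cis_mult by simp
    moreover have "Re (of_real x * cis y) = x * cos y" for x y by simp
    ultimately have "d k = (1/\<rho>) ^ k * cos (\<theta>/2 + of_nat k * - \<theta>)" by (simp only:)
    then show ?thesis by (simp add: mult.commute)
  qed
  have dd: "d k * d (Suc k) = (1/\<rho>) ^ (2 * k + 1) * ((cos (2 * \<theta> * of_nat k) + cos \<theta>) / 2)" for k
  proof -
    have "cos (\<theta>/2 - \<theta> * of_nat k) * cos (\<theta>/2 - \<theta> * of_nat (Suc k)) = (cos \<theta> + cos (\<theta> - 2 * \<theta> * of_nat k - \<theta>)) / 2"
      unfolding cos_times_cos by (simp add: algebra_simps add_divide_distrib)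
    moreover have "d k * d (Suc k) = ((1/\<rho>) ^ k * (1/\<rho>) ^ Suc k) *
        (cos (\<theta>/2 - \<theta> * of_nat k) * cos (\<theta>/2 - \<theta> * of_nat (Suc k)))"
      unfolding d by (simp only: mult_ac)
    moreover have "(1/\<rho>) ^ k * (1/\<rho>) ^ Suc k = (1/\<rho>) ^ (2 * k + 1)"
      unfolding power_add[symmetric] by (simp add: mult_2)
    ultimately show ?thesis by (simp only: add.commute) (simp add: mult.commute)
  qed
  define S where "S = {k. d k * d (Suc k) > 0}"
  have "infinite S"
  proof (rule ccontr)
    assume "\<not> infinite S"
    then obtain N where N: "\<And>k. k \<in> S \<Longrightarrow> k < N" by (meson finite_nat_set_iff_bounded)
    obtain k where k: "k \<ge> N" "cmod (cis (2 * \<theta> * of_nat k) - 1) < 1 + cos \<theta>"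
      using cis_recurrence[of "1 + cos \<theta>" N "2 * \<theta>"] c by auto
    have "\<bar>Re (cis (2 * \<theta> * of_nat k) - 1)\<bar> < 1 + cos \<theta>"
      using abs_Re_le_cmod k(2) by (meson order_le_less_trans)
    then have "cos (2 * \<theta> * of_nat k) + cos \<theta> > 0" by simp
    then have "k \<in> S" using \<rho> by (simp add: S_def dd)
    with N k(1) show False by force
  qed
  \<comment> \<open>One pair of equal signs more than the \<open>m\<close> rows that are lost to the
    width of the convolution.\<close>
  then obtain T where T: "T \<subseteq> S" "finite T" "card T = Suc m"
    using infinite_arbitrarily_large by blast
  define n where "n = Max T + Suc (Suc m)"
  have Tn: "Suc k < n" if "k \<in> T" for k using Max_ge[OF T(2) that] by (simp add: n_def)
  obtain u where u: "\<And>j. j < n \<Longrightarrow> m \<le> j \<Longrightarrow> (\<Sum>i\<le>m. b i * u (j - i)) = (-1)^j"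
    using alternating_convolution_solution[of b n m] b0 by fastforce
  have "\<forall>\<^sub>F \<epsilon> in at_right (0::real). \<forall>k\<in>T. (d k + \<epsilon> * u k) * (d (Suc k) + \<epsilon> * u (Suc k)) > 0"
  proof (rule eventually_ball_finite[OF T(2)], rule ballI)
    fix k assume "k \<in> T"
    then have "d k * d (Suc k) > 0" using T(1) by (auto simp: S_def)
    moreover have "((\<lambda>\<epsilon>. (d k + \<epsilon> * u k) * (d (Suc k) + \<epsilon> * u (Suc k))) \<longlongrightarrow> (d k + 0 * u k) * (d (Suc k) + 0 * u (Suc k))) (at_right 0)"
      by (intro tendsto_intros)
    ultimately show "\<forall>\<^sub>F \<epsilon> in at_right 0. (d k + \<epsilon> * u k) * (d (Suc k) + \<epsilon> * u (Suc k)) > 0"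
      by (intro order_tendstoD) auto
  qed
  then have "\<forall>\<^sub>F \<epsilon> in at_right (0::real). \<epsilon> > 0 \<and> (\<forall>k\<in>T. (d k + \<epsilon> * u k) * (d (Suc k) + \<epsilon> * u (Suc k)) > 0)"
    by (intro eventually_conj eventually_at_right_less)
  then obtain \<epsilon> where \<epsilon>: "\<epsilon> > 0" "\<And>k. k \<in> T \<Longrightarrow> (d k + \<epsilon> * u k) * (d (Suc k) + \<epsilon> * u (Suc k)) > 0"
    by (metis (no_types, lifting) eventually_happens trivial_limit_at_right_real)
  \<comment> \<open>\<open>d\<close> contributes nothing to the convolution, the multiple of
    \<open>u\<close> makes it alternate, and \<open>\<epsilon>\<close> is small enough to keep the
    equal signs on \<open>T\<close>. The factor \<open>(-1)^m\<close> compensates for row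
    \<open>i\<close> being the convolution at \<open>m + i\<close>.\<close>
  define v where "v k = (-1)^m * (d k + \<epsilon> * u k)" for k
  define K where "K i j = g ((s + of_nat (m + i) * h) - of_nat j * h)" for i j
  have dconv: "(\<Sum>i\<le>m. b i * d (j - i)) = 0" if "m \<le> j" for j
  proof -
    have "(\<Sum>i\<le>m. b i * d (j - i)) = Re (cis (\<theta>/2) * (1/w)^j * (\<Sum>i\<le>m. of_real (b i) * w ^ i))"
    proof -
      have "cis (\<theta>/2) * (1/w)^j * (of_real (b i) * w ^ i) = of_real (b i) * (cis (\<theta>/2) * (1/w)^(j - i))" if "i \<le> m" for i
        using \<open>m \<le> j\<close> that \<open>w \<noteq> 0\<close> by (simp add: power_diff power_one_over field_simps)
      then have "(\<Sum>i\<le>m. cis (\<theta>/2) * (1/w)^j * (of_real (b i) * w ^ i)) = (\<Sum>i\<le>m. of_real (b i) * (cis (\<theta>/2) * (1/w)^(j - i)))"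
        by (intro sum.cong) auto
      moreover have "Re (of_real x * z) = x * Re z" for x z by simp
      ultimately show ?thesis unfolding sum_distrib_left d_def by (simp only: Re_sum)
    qed
    then show ?thesis using root by (simp add: b_def)
  qed
  have conv: "(\<Sum>j<n. K i j * v j) = (-1)^i * \<epsilon>" if i: "i < n - m" for i
  proof -
    have "(\<Sum>j<n. K i j * v j) = (\<Sum>j\<in>{i..m+i}. K i j * v j)"
    proof (rule sum.mono_neutral_right)
      show "\<forall>j\<in>{..<n} - {i..m + i}. K i j * v j = 0"
      proof
        fix j assume j: "j \<in> {..<n} - {i..m + i}"
        have "K i j = g (s + of_int (int m + int i - int j) * h)" by (simp add: K_def algebra_simps)
        moreover have "\<not> g (s + of_int (int m + int i - int j) * h) > 0" unfolding supp using j by auto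
        ultimately show "K i j * v j = 0" using nonneg[of "s + of_int (int m + int i - int j) * h"] by simp
      qed
    qed (use i in auto)
    also have "\<dots> = (\<Sum>l\<le>m. b l * v (m + i - l))"
      by (rule sum.reindex_bij_witness[of _ "\<lambda>l. m + i - l" "\<lambda>j. m + i - j"])
         (auto simp: K_def b_def algebra_simps of_nat_diff)
    also have "\<dots> = (-1)^m * ((\<Sum>l\<le>m. b l * d (m + i - l)) + \<epsilon> * (\<Sum>l\<le>m. b l * u (m + i - l)))"
      by (simp add: v_def sum_distrib_left sum.distrib algebra_simps)
    also have "\<dots> = (-1)^m * (\<epsilon> * (-1)^(m + i))" using dconv[of "m + i"] u[of "m + i"] i by simp
    also have "\<dots> = (-1)^i * \<epsilon>" by (simp add: power_add)
    finally show ?thesis .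
  qed
  have "(n - m) + card T \<le> n"
  proof (rule tp_kernel_variation_diminishing)
    show "tp_kernel K (n - m) n" unfolding K_def
      by (rule tp_kernel_comb) (use h in \<open>auto simp: strict_mono_on_def\<close>)
    show "\<forall>i<n - m. 0 < (-1)^i * (\<Sum>j<n. K i j * v j)" using conv \<epsilon>(1) by simp
    fix j assume "j \<in> T"
    moreover have "v j * v (Suc j) = ((-1)^m * (-1)^m) * ((d j + \<epsilon> * u j) * (d (Suc j) + \<epsilon> * u (Suc j)))"
      unfolding v_def by (simp only: mult_ac)
    moreover have "(-1::real)^m * (-1)^m = 1" by (simp flip: power_mult_distrib)
    ultimately show "Suc j < n \<and> 0 < v j * v (Suc j)" using Tn \<epsilon>(2)[of j] by simp
  qed
  then show False using T(3) by (simp add: n_def)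
qed

text \<open>For bounded support, sample with mesh proportional to \<open>1 / r\<close>. The sample
  polynomial has degree of order \<open>r\<close>, its value at 1 is of order at most
  \<open>r\<close>, and all its roots are negative, so between 1 and \<open>cis (pi / r)\<close> its
  modulus drops by a bounded amount only: each root costs a factor \<open>1 - O(1 / r^2)\<close>.
  But the samples in \<open>[b0, b1]\<close> are at least \<open>c0\<close>, and the constant part
  of \<open>2 * r\<close> consecutive ones cancels at that root of unity, a drop of order
  \<open>r\<close>.\<close>

lemma unbounded_support: "\<exists>t. \<bar>t\<bar> > M \<and> g t > 0"
proof (rule ccontr)
  assume "\<not> ?thesis"
  then have M: "g t = 0" if "\<bar>t\<bar> > M" for t using that nonneg[of t] by force
  obtain b0 b1 where b: "b0 < b1" "g b0 > 0" "g b1 > 0" using two_points by blast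
  define c0 where "c0 = g b0 * g b1 / C"
  have gC: "g t \<le> C" for t
  proof -
    have "exp (- a * \<bar>t\<bar>) \<le> 1" using a_pos by simp
    then have "C * exp (- a * \<bar>t\<bar>) \<le> C * 1" using C_pos by (intro mult_left_mono) auto
    with decay[of t] show ?thesis by simp
  qed
  have c0: "c0 > 0" "c0 \<le> g t" if "b0 \<le> t" "t \<le> b1" for t
  proof -
    show "c0 > 0" using b C_pos by (simp add: c0_def)
    have "g b0 * g b1 \<le> g t * C"
    proof (cases "t = b0 \<or> t = b1")
      case True
      have "g b0 * g b1 \<le> g b0 * C" "g b1 * g b0 \<le> g b1 * C"
        using gC nonneg by (auto intro: mult_left_mono)
      with True show ?thesis by (auto simp: mult.commute)
    next
      case False
      then have "g b0 * g b1 \<le> g t * g (b0 + b1 - t)" using that by (intro tp2) auto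
      also have "\<dots> \<le> g t * C" using gC nonneg by (intro mult_left_mono) auto
      finally show ?thesis .
    qed
    then show "c0 \<le> g t" using C_pos by (simp add: c0_def field_simps)
  qed
  have Mpos: "\<bar>b0\<bar> \<le> M" using M[of b0] b(2) by force
  define \<kappa> where "\<kappa> = 4 * M / (b1 - b0)"
  have \<kappa>: "\<kappa> \<ge> 0" using Mpos b(1) by (simp add: \<kappa>_def)
  have main: "of_nat r * c0 \<le> C * \<kappa> * (\<kappa> + 1)" if r: "r \<ge> 1" for r :: nat
  proof -
    \<comment> \<open>The interval \<open>[b0, b1]\<close> is cut into \<open>2 * r\<close> steps,
      to match the order of the root of unity used below.\<close>
    define h where "h = (b1 - b0) / (2 * of_nat r)"
    have h: "h > 0" using b r by (simp add: h_def)
    define Ks where "Ks = {k::int. g (b0 + of_int k * h) > 0}"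
    have mem: "k \<in> Ks" if "0 \<le> k" "k \<le> 2 * int r" for k
    proof -
      have "of_int k * h \<le> of_int (2 * int r) * h" using that h by (intro mult_right_mono) (auto simp del: of_int_mult)
      also have "\<dots> = b1 - b0" using r by (simp add: h_def)
      finally show ?thesis using c0[of "b0 + of_int k * h"] that h by (auto simp: Ks_def)
    qed
    have bound: "\<bar>of_int k * h\<bar> \<le> 2 * M" if "k \<in> Ks" for k
      using that M[of "b0 + of_int k * h"] Mpos by (force simp: Ks_def)
    have fin: "finite Ks"
    proof (rule finite_subset)
      show "Ks \<subseteq> {- \<lceil>2 * M / h\<rceil>..\<lceil>2 * M / h\<rceil>}"
      proof
        fix k assume "k \<in> Ks"
        then have "\<bar>of_int k\<bar> \<le> 2 * M / h" using bound h by (simp add: abs_mult field_simps)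
        then show "k \<in> {- \<lceil>2 * M / h\<rceil>..\<lceil>2 * M / h\<rceil>}" by (simp add: abs_le_iff) linarith
      qed
    qed simp
    have ne: "0 \<in> Ks" using mem[of 0] by simp
    define k0 k1 where "k0 = Min Ks" and "k1 = Max Ks"
    have k01: "k0 \<in> Ks" "k1 \<in> Ks" "k0 \<le> 0" "2 * int r \<le> k1" "\<And>k. k \<in> Ks \<Longrightarrow> k0 \<le> k \<and> k \<le> k1"
    proof -
      have "Ks \<noteq> {}" using ne by blast
      then show "k0 \<in> Ks" "k1 \<in> Ks" using fin by (auto simp: k0_def k1_def)
      show "k0 \<le> 0" "2 * int r \<le> k1" "\<And>k. k \<in> Ks \<Longrightarrow> k0 \<le> k \<and> k \<le> k1"
        using fin ne mem[of "2 * int r"] by (auto simp: k0_def k1_def)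
    qed
    have conv: "k \<in> Ks" if "k0 \<le> k" "k \<le> k1" for k
    proof (cases "k = k0 \<or> k = k1")
      case False
      then have "k0 < k" "k < k1" using that by auto
      then have "b0 + of_int k0 * h < b0 + of_int k * h" "b0 + of_int k * h < b0 + of_int k1 * h"
        using h by simp_all
      moreover have "g (b0 + of_int k0 * h) > 0" "g (b0 + of_int k1 * h) > 0"
        using k01(1,2) by (simp_all add: Ks_def)
      ultimately have "g (b0 + of_int k * h) > 0" using pos_between by blast
      then show ?thesis by (simp add: Ks_def)
    qed (use k01(1,2) in auto)
    \<comment> \<open>\<open>s\<close> is the first grid point in the support. As the support is an
      interval, the samples from \<open>s\<close> on are positive exactly at the indices 0 to
      \<open>m\<close>.\<close>
    define s m where "s = b0 + of_int k0 * h" and "m = nat (k1 - k0)"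
    have im: "int m = k1 - k0" using k01 r by (simp add: m_def)
    have supp: "g (s + of_int k * h) > 0 \<longleftrightarrow> 0 \<le> k \<and> k \<le> int m" for k :: int
    proof -
      have "g (s + of_int k * h) > 0 \<longleftrightarrow> k0 + k \<in> Ks" by (simp add: s_def Ks_def algebra_simps)
      also have "\<dots> \<longleftrightarrow> 0 \<le> k \<and> k \<le> int m" using conv[of "k0 + k"] k01(5)[of "k0 + k"] im by auto
      finally show ?thesis .
    qed
    define A where "A i = g (s + of_nat i * h)" for i
    have A: "A i \<ge> 0" "A i \<le> C" for i using nonneg gC by (auto simp: A_def)
    have mr: "of_nat m \<le> \<kappa> * of_nat r"
    proof -
      have "of_nat m * h = of_int k1 * h - of_int k0 * h" using im by (metis left_diff_distrib of_int_diff of_int_of_nat_eq)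
      also have "\<dots> \<le> 2 * M"
        using k01(1,2) M[of "b0 + of_int k1 * h"] M[of "b0 + of_int k0 * h"] by (force simp: Ks_def)
      finally show ?thesis using b r by (simp add: h_def \<kappa>_def field_simps)
    qed
    define p where "p = (\<Sum>i\<le>m. monom (complex_of_real (A i)) i)"
    have poly: "poly p z = (\<Sum>i\<le>m. of_real (A i) * z ^ i)" for z by (simp add: p_def poly_sum poly_monom)
    have deg: "degree p \<le> m" unfolding p_def by (intro degree_sum_le) (auto intro: order_trans[OF degree_monom_le])
    \<comment> \<open>Chosen so that \<open>cis \<theta>\<close> is a \<open>2 * r\<close>-th root
      of unity other than 1: its powers over a block of \<open>2 * r\<close> indices sum to
      zero.\<close>
    define \<theta> where "\<theta> = pi / of_nat r"
    have \<theta>: "0 < \<theta>" "\<theta> \<le> pi" using r by (auto simp: \<theta>_def field_simps)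
    then have cos0: "cos (\<theta>/2) \<ge> 0" by (intro cos_ge_zero) auto
    have "cos (\<theta>/2) ^ degree p * cmod (poly p 1) \<le> cmod (poly p (cis \<theta>))"
    proof (rule cmod_poly_cis_ge[OF _ cos0])
      fix w assume "poly p w = 0"
      then have "Im w = 0 \<and> Re w < 0"
        by (intro sample_polynomial_root[OF h supp]) (simp add: poly A_def)
      then show "Im w = 0 \<and> Re w \<le> 0" by simp
    qed
    moreover have "cos (\<theta>/2) ^ m * cmod (poly p 1) \<le> cos (\<theta>/2) ^ degree p * cmod (poly p 1)"
      using cos0 deg by (intro mult_right_mono power_decreasing) auto
    moreover define Sm where "Sm = (\<Sum>i\<le>m. A i)"
    have Sm: "Sm \<ge> 0" "Sm \<le> C * (of_nat m + 1)"
    proof -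
      show "Sm \<ge> 0" using A by (auto simp: Sm_def intro: sum_nonneg)
      have "Sm \<le> (\<Sum>i\<le>m. C)" unfolding Sm_def by (intro sum_mono A)
      then show "Sm \<le> C * (of_nat m + 1)" by (simp add: algebra_simps)
    qed
    have "cmod (poly p 1) = Sm"
      using Sm(1) by (simp add: poly Sm_def flip: of_real_sum)
    moreover have "cmod (poly p (cis \<theta>)) \<le> Sm - 2 * of_nat r * c0"
    proof -
      define i0 where "i0 = nat (- k0)"
      define I where "I = {i0..<i0 + 2 * r}"
      have I: "I \<subseteq> {..m}" using k01 im by (auto simp: I_def i0_def)
      have AI: "A i \<ge> c0" if "i \<in> I" for i
      proof -
        define k where "k = k0 + int i"
        have k: "0 \<le> k" "k \<le> 2 * int r" using that k01 by (auto simp: I_def i0_def k_def)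
        have "A i = g (b0 + of_int k * h)" by (simp add: A_def s_def k_def algebra_simps)
        moreover have "of_int k * h \<le> of_int (2 * int r) * h" using k h by (intro mult_right_mono) (auto simp del: of_int_mult)
        then have "of_int k * h \<le> b1 - b0" using r by (simp add: h_def)
        ultimately show ?thesis using c0(2)[of "b0 + of_int k * h"] k h by auto
      qed
      define z where "z = cis \<theta>"
      have z1: "z \<noteq> 1"
      proof
        assume "z = 1"
        then have "cos \<theta> = 1" by (simp add: z_def complex_eq_iff)
        moreover have "cos \<theta> < cos 0" using \<theta> by (intro cos_monotone_0_pi) auto
        ultimately show False by simp
      qed
      have "z ^ (2 * r) = cis (2 * pi)" using r by (simp add: z_def Complex.DeMoivre \<theta>_def)
      then have z2: "z ^ (2 * r) = 1" by simp
      have "(\<Sum>i\<in>I. z ^ i) = (\<Sum>i<2*r. z ^ (i0 + i))"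
        by (rule sum.reindex_bij_witness[of _ "\<lambda>i. i0 + i" "\<lambda>i. i - i0"]) (auto simp: I_def)
      also have "\<dots> = z ^ i0 * ((z ^ (2 * r) - 1) / (z - 1))"
        using z1 by (simp add: power_add sum_distrib_left[symmetric] geometric_sum)
      finally have sumI: "(\<Sum>i\<in>I. z ^ i) = 0" using z2 by simp
      \<comment> \<open>Removing \<open>c0\<close> from one block of \<open>2 * r\<close> samples
        does not change the value at \<open>z\<close>, but lowers the sum of the coefficients by
        \<open>2 * r * c0\<close>.\<close>
      define B where "B i = A i - (if i \<in> I then c0 else 0)" for i
      have B: "B i \<ge> 0" for i using AI A(1) by (auto simp: B_def)
      have "poly p z = (\<Sum>i\<le>m. of_real (B i) * z ^ i) + (\<Sum>i\<le>m. if i \<in> I then of_real c0 * z ^ i else 0)"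
        unfolding poly sum.distrib[symmetric] by (intro sum.cong) (auto simp: B_def algebra_simps)
      also have "(\<Sum>i\<le>m. if i \<in> I then of_real c0 * z ^ i else 0) = (\<Sum>i\<in>I. of_real c0 * z ^ i)"
        using I by (subst sum.inter_restrict[symmetric]) (auto intro: sum.cong simp: Int_absorb1)
      also have "\<dots> = 0" using sumI by (simp add: sum_distrib_left[symmetric])
      finally have "cmod (poly p z) \<le> (\<Sum>i\<le>m. cmod (of_real (B i) * z ^ i))" by (simp add: norm_sum)
      also have "\<dots> = (\<Sum>i\<le>m. B i)" using B by (simp add: norm_mult norm_power z_def)
      also have "\<dots> = Sm - (\<Sum>i\<le>m. if i \<in> I then c0 else 0)" by (simp add: B_def sum_subtractf Sm_def)
      also have "(\<Sum>i\<le>m. if i \<in> I then c0 else 0) = (\<Sum>i\<in>I. c0)"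
        using I by (subst sum.inter_restrict[symmetric]) (auto intro: sum.cong simp: Int_absorb1)
      also have "\<dots> = 2 * of_nat r * c0" by (simp add: I_def)
      finally show ?thesis by (simp add: z_def)
    qed
    ultimately have "2 * of_nat r * c0 \<le> Sm * (1 - cos (\<theta>/2) ^ m)" by (simp add: algebra_simps)
    \<comment> \<open>Bernoulli's inequality, together with
      \<open>cos (\<theta>/2) \<ge> 1 - \<theta>^2 / 8\<close>.\<close>
    also have "\<dots> \<le> Sm * (of_nat m * (\<theta>\<^sup>2 / 8))"
    proof (intro mult_left_mono Sm)
      have "\<bar>sin (\<theta>/4)\<bar> \<le> \<bar>\<theta>/4\<bar>" by (rule abs_sin_x_le_abs_x)
      then have "(sin (\<theta>/4))\<^sup>2 \<le> (\<theta>/4)\<^sup>2" by (simp only: abs_le_square_iff)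
      moreover have "cos (\<theta>/2) = 1 - 2 * (sin (\<theta>/4))\<^sup>2" using cos_double_sin[of "\<theta>/4"] by simp
      ultimately have "cos (\<theta>/2) - 1 \<ge> - (\<theta>\<^sup>2 / 8)" by (simp add: power2_eq_square field_simps)
      then have "of_nat m * (cos (\<theta>/2) - 1) \<ge> of_nat m * (- (\<theta>\<^sup>2 / 8))" by (intro mult_left_mono) auto
      moreover have "1 + of_nat m * (cos (\<theta>/2) - 1) \<le> (1 + (cos (\<theta>/2) - 1)) ^ m"
        using cos0 by (intro Bernoulli_inequality) auto
      ultimately show "1 - cos (\<theta>/2) ^ m \<le> of_nat m * (\<theta>\<^sup>2 / 8)" by simp
    qed
    also have "\<dots> \<le> (C * (of_nat m + 1)) * (of_nat m * (\<theta>\<^sup>2 / 8))"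
      by (intro mult_right_mono Sm) auto
    also have "\<dots> \<le> (C * (\<kappa> * of_nat r + of_nat r)) * ((\<kappa> * of_nat r) * (\<theta>\<^sup>2 / 8))"
      using mr r C_pos \<kappa> by (intro mult_mono add_mono mult_nonneg_nonneg) auto
    also have "\<dots> = C * \<kappa> * (\<kappa> + 1) * (pi\<^sup>2 / 8)"
      using r by (simp add: \<theta>_def power2_eq_square field_simps)
    also have "\<dots> \<le> C * \<kappa> * (\<kappa> + 1) * 2"
    proof (intro mult_left_mono)
      have "pi\<^sup>2 \<le> 4\<^sup>2" using pi_less_4 by (intro power_mono) auto
      then show "pi\<^sup>2 / 8 \<le> 2" by simp
    qed (use C_pos \<kappa> in auto)
    finally show ?thesis by simp
  qed
  obtain r :: nat where r: "C * \<kappa> * (\<kappa> + 1) / c0 < of_nat r" using reals_Archimedean2 by blast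
  have "c0 > 0" using c0(1)[of b0] b by simp
  then have "C * \<kappa> * (\<kappa> + 1) < of_nat r * c0" using r by (simp add: field_simps)
  moreover have "of_nat r * c0 \<le> C * \<kappa> * (\<kappa> + 1)"
  proof (cases "r \<ge> 1")
    case False
    then have "r = 0" by simp
    then show ?thesis using C_pos \<kappa> by simp
  qed (use main in auto)
  ultimately show False by simp
qed

text \<open>The support is an interval that is unbounded to at least one side, so it contains a
  half-line, and every grid runs into it.\<close>

lemma grid_meets_support:
  assumes h: "h > 0"
  shows "\<exists>k::int. g (t - of_int k * h) > 0"
proof -
  obtain b where b: "g b > 0" using two_points by blast
  have "(\<forall>M. \<exists>t>M. g t > 0) \<or> (\<forall>M. \<exists>t<M. g t > 0)"
  proof (rule ccontr)
    assume "\<not> ?thesis"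
    then obtain M1 M2 where *: "\<And>t. t > M1 \<Longrightarrow> \<not> g t > 0" "\<And>t. t < M2 \<Longrightarrow> \<not> g t > 0" by blast
    obtain t where "\<bar>t\<bar> > \<bar>M1\<bar> + \<bar>M2\<bar>" "g t > 0" using unbounded_support by blast
    then show False using *(1)[of t] *(2)[of t] by (cases "t \<ge> 0") auto
  qed
  then consider "\<forall>M. \<exists>t>M. g t > 0" | "\<forall>M. \<exists>t<M. g t > 0" by blast
  then show ?thesis
  proof cases
    case 1
    obtain n :: nat where n: "(b - t) / h < of_nat n" using reals_Archimedean2 by blast
    then have "b < t - of_int (- int n) * h" using h by (simp add: field_simps)
    moreover obtain x where "x > t - of_int (- int n) * h" "g x > 0" using 1 by blast
    ultimately show ?thesis using pos_between[OF b, of x] by blast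
  next
    case 2
    obtain n :: nat where n: "(t - b) / h < of_nat n" using reals_Archimedean2 by blast
    then have "t - of_int (int n) * h < b" using h by (simp add: field_simps)
    moreover obtain x where "x < t - of_int (int n) * h" "g x > 0" using 2 by blast
    ultimately show ?thesis using pos_between[OF _ b, of x] by blast
  qed
qed

lemma comb_one_pos:
  assumes h: "h > 0"
  shows "comb g h (\<lambda>_. 1) t > 0"
proof -
  obtain k where k: "g (t - of_int k * h) > 0" using grid_meets_support[OF h] by blast
  have "(\<Sum>k\<in>{k}. 1 * g (t - of_int k * h)) \<le> comb g h (\<lambda>_. 1) t"
    unfolding comb_def using h nonneg by (intro finite_sum_le_infsum summable_comb[where V = 1]) auto
  with k show ?thesis by simp
qed

end

section \<open>The alternating comb\<close>

definition altsign :: "int \<Rightarrow> real" where "altsign k = (if even k then 1 else - 1)"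

lemma altsign_simps [simp]:
  "\<bar>altsign k\<bar> = 1" "altsign (k + 1) = - altsign k" "altsign k * altsign k = 1" "altsign k \<noteq> 0"
  by (auto simp: altsign_def)

lemma altsign_add_even: "even j \<Longrightarrow> altsign (k + j) = altsign k"
  by (auto simp: altsign_def)

context tp_decay begin

lemma comb_altsign_add:
  "comb g h altsign (t + of_nat i * h) = (-1)^i * comb g h altsign t"
proof (induction i)
  case (Suc i)
  have "comb g h altsign ((t + of_nat i * h) + of_int 1 * h) = comb g h (\<lambda>k. - 1 * altsign k) (t + of_nat i * h)"
    by (subst comb_shift) simp
  also have "\<dots> = - 1 * comb g h altsign (t + of_nat i * h)" by (rule comb_cmult)
  finally show ?case using Suc by (simp add: algebra_simps)
qed simp

lemma comb_one_add: "comb g h (\<lambda>_. 1) (t + of_int i * h) = comb g h (\<lambda>_. 1) t"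
  by (subst comb_shift) simp

text \<open>The coefficients form the pattern \<open>++--\<close>; separating even and odd indices
  leaves two alternating combs of twice the mesh. If those vanish identically, so does this
  comb.\<close>

lemma comb_half:
  assumes "h > 0"
  shows "comb g h (\<lambda>k. altsign (k div 2)) t = comb g (2 * h) altsign t + comb g (2 * h) altsign (t - h)"
proof -
  define \<phi> where "\<phi> k = altsign (k div 2) * g (t - of_int k * h)" for k :: int
  have sm: "\<phi> summable_on UNIV" unfolding \<phi>_def
    by (rule summable_comb[where V = 1]) (use assms in auto)
  have "k \<in> range (\<lambda>l. 2 * l) \<union> range (\<lambda>l. 2 * l + 1)" for k :: int
    by (cases "even k") (auto elim!: evenE oddE)
  then have "(UNIV :: int set) = range (\<lambda>l. 2 * l) \<union> range (\<lambda>l. 2 * l + 1)" by blast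
  then have "infsum \<phi> UNIV = infsum \<phi> (range (\<lambda>l. 2 * l) \<union> range (\<lambda>l. 2 * l + 1))" by simp
  also have "\<dots> = infsum \<phi> (range (\<lambda>l. 2 * l)) + infsum \<phi> (range (\<lambda>l. 2 * l + 1))"
    by (intro infsum_Un_disjoint summable_on_subset[OF sm]) (auto, presburger)
  also have "infsum \<phi> (range (\<lambda>l. 2 * l)) = comb g (2 * h) altsign t"
    by (subst infsum_reindex) (auto simp: inj_on_def comb_def \<phi>_def o_def mult_ac)
  also have "infsum \<phi> (range (\<lambda>l. 2 * l + 1)) = comb g (2 * h) altsign (t - h)"
    by (subst infsum_reindex) (auto simp: inj_on_def comb_def \<phi>_def o_def algebra_simps)
  finally show ?thesis by (simp add: comb_def \<phi>_def[abs_def])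
qed

text \<open>A complex exponential is an eigenvector of the convolution with the samples, with the
  symbol \<open>Z\<close> or its conjugate as eigenvalue. The phase \<open>Arg Z\<close> in the
  coefficients cancels that of the eigenvalue; \<open>- \<psi>/2\<close> centres the rounding error
  when an extremum is moved up to the next grid point.\<close>

lemma comb_cos:
  fixes Z
  assumes h: "h > 0" and Z: "Z = (\<Sum>\<^sub>\<infinity>l\<in>(UNIV::int set). of_real (g (of_int l * h)) * cis (\<psi> * of_int l))"
  shows "comb g h (\<lambda>k. cos (\<psi> * of_int k + (Arg Z - \<psi>/2))) (of_int j * h) = cmod Z * cos (\<psi> * of_int j - \<psi>/2)"
proof -
  define \<phi> where "\<phi> = Arg Z - \<psi>/2"
  have sg: "(\<lambda>l::int. g (of_int l * h)) summable_on UNIV"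
    using summable_shift[of h 0] summable_on_reindex_bij_witness[of UNIV uminus uminus UNIV "\<lambda>l::int. g (of_int l * h)" "\<lambda>l. g (0 - of_int l * h)"] h by simp
  have s: "(\<lambda>l::int. of_real (g (of_int l * h)) * cis (\<psi> * of_int l)) summable_on UNIV"
    by (rule abs_summable_summable) (use sg nonneg in \<open>simp add: norm_mult\<close>)
  have "comb g h (\<lambda>k. cos (\<psi> * of_int k + \<phi>)) (of_int j * h) =
      (\<Sum>\<^sub>\<infinity>l\<in>(UNIV::int set). cos (\<psi> * of_int (j - l) + \<phi>) * g (of_int j * h - of_int (j - l) * h))"
    unfolding comb_def by (rule infsum_reindex_bij_witness[of _ "\<lambda>l. j - l" "\<lambda>k. j - k"]) auto
  also have "\<dots> = (\<Sum>\<^sub>\<infinity>l\<in>(UNIV::int set). Re (cis (\<psi> * of_int j + \<phi>) * cnj (of_real (g (of_int l * h)) * cis (\<psi> * of_int l))))"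
    by (intro infsum_cong) (simp add: algebra_simps cos_diff cos_add sin_add)
  also have "\<dots> = Re (\<Sum>\<^sub>\<infinity>l\<in>(UNIV::int set). cis (\<psi> * of_int j + \<phi>) * cnj (of_real (g (of_int l * h)) * cis (\<psi> * of_int l)))"
    by (rule infsum_Re, rule summable_on_cmult_right) (use s in \<open>simp only: summable_on_cnj_iff\<close>)
  also have "\<dots> = Re (cis (\<psi> * of_int j + \<phi>) * cnj Z)"
    unfolding Z infsum_cnj[symmetric] by (subst infsum_cmult_right') simp
  also have "cnj Z = of_real (cmod Z) * cis (- Arg Z)"
    by (metis rcis_cmod_Arg rcis_def complex_cnj_mult complex_cnj_complex_of_real cis_cnj)
  also have "cis (\<psi> * of_int j + \<phi>) * (of_real (cmod Z) * cis (- Arg Z)) = of_real (cmod Z) * cis (\<psi> * of_int j - \<psi>/2)"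
    by (simp add: \<phi>_def cis_mult mult.left_commute)
  finally show ?thesis by (simp add: \<phi>_def)
qed

text \<open>If \<open>\<Sum>\<^sub>k (-1)\<^sup>k g (t - k h)\<close> vanished identically, then the pattern \<open>++--\<close> on the grid of mesh \<open>h/2\<close> would be
  annihilated too; perturbing it by faster oscillations shows that the symbol of the sampled \<open>g\<close>
  vanishes on an arc, hence everywhere on an annulus, although its value at 1 is positive.\<close>

lemma symbol_vanishes_on_arc:
  assumes h: "h > 0" and zero: "\<And>t. comb g (2 * h) altsign t = 0" and \<psi>: "pi/2 < \<psi>" "\<psi> < pi"
  shows "(\<Sum>\<^sub>\<infinity>l\<in>(UNIV::int set). of_real (g (of_int l * h)) * cis (\<psi> * of_int l)) = (0::complex)" (is "?Z = 0")
proof (rule ccontr)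
  define Z where "Z = ?Z"
  assume "?Z \<noteq> 0"
  then have Z: "cmod Z > 0" by (simp add: Z_def)
  define u w where "u k = altsign (k div 2)" and "w k = cos (\<psi> * of_int k + (Arg Z - \<psi>/2))" for k :: int
  \<comment> \<open>The factor 1/2 lets \<open>v\<close> keep the signs of \<open>u\<close>, one
    change per two indices. Its comb is that of \<open>w\<close> alone, halved, and changes sign
    \<open>\<psi> / pi > 1/2\<close> times per index.\<close>
  define v where "v k = u k + 1/2 * w k" for k
  have w1: "\<bar>w k\<bar> \<le> 1" for k by (simp add: w_def)
  have u1: "\<bar>u k\<bar> = 1" for k by (simp add: u_def)
  have v2: "\<bar>v k\<bar> \<le> 2" for k using w1[of k] u1[of k] by (auto simp: v_def abs_if split: if_splits)
  have cpos: "cos (\<psi>/2) > 0" using \<psi> pi_gt_zero by (intro cos_gt_zero_pi) linarith+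
  define \<delta> where "\<delta> = cmod Z * cos (\<psi>/2) / 2"
  have \<delta>: "\<delta> > 0" using Z cpos by (simp add: \<delta>_def)
  \<comment> \<open>Rounding \<open>pi * i / \<psi>\<close> up adds a phase in
    \<open>[0, \<psi>)\<close>; after the offset \<open>- \<psi>/2\<close> the cosine is evaluated
    within \<open>\<psi>/2\<close> of its \<open>i\<close>-th extremum.\<close>
  define j where "j i = \<lceil>pi * of_nat i / \<psi>\<rceil>" for i :: nat
  have vj: "(-1)^i * comb g h v (of_int (j i) * h) \<ge> \<delta>" for i
  proof -
    define e where "e = \<psi> * of_int (j i) - pi * of_nat i - \<psi>/2"
    have "pi * of_nat i / \<psi> \<le> of_int (j i)" "of_int (j i) < pi * of_nat i / \<psi> + 1" unfolding j_def by linarith+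
    then have "pi * of_nat i \<le> \<psi> * of_int (j i)" "\<psi> * of_int (j i) < pi * of_nat i + \<psi>"
      using \<psi> pi_gt_zero by (simp_all add: field_simps)
    then have "\<bar>e\<bar> \<le> \<psi>/2" unfolding e_def abs_le_iff by linarith
    then have "cos (\<psi>/2) \<le> cos \<bar>e\<bar>" using \<psi> by (intro cos_monotone_0_pi_le) auto
    then have ce: "cos (\<psi>/2) \<le> cos e" by simp
    have "comb g h v (of_int (j i) * h) = comb g h u (of_int (j i) * h) + 1/2 * comb g h w (of_int (j i) * h)"
      unfolding v_def by (rule comb_add[where V = 1 and V' = 1]) (use h u1 w1 in auto)
    also have "comb g h u (of_int (j i) * h) = 0" unfolding u_def using comb_half[OF h] zero by simp
    also have "comb g h w (of_int (j i) * h) = cmod Z * cos (\<psi> * of_int (j i) - \<psi>/2)"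
      unfolding w_def by (rule comb_cos[OF h]) (simp add: Z_def)
    also have "\<psi> * of_int (j i) - \<psi>/2 = e + of_nat i * pi" by (simp add: e_def mult.commute)
    also have "cos (e + of_nat i * pi) = (-1)^i * cos e"
      by (induction i) (simp_all add: algebra_simps cos_add)
    finally have "(-1)^i * comb g h v (of_int (j i) * h) = cmod Z * cos e / 2"
      by (cases "even i") simp_all
    also have "\<dots> \<ge> \<delta>" using ce Z by (simp add: \<delta>_def)
    finally show ?thesis .
  qed
  obtain m where m: "\<And>(D::nat) n t v T. strict_mono_on {..<n} t \<Longrightarrow> (\<forall>i<n. t i \<in> {0..0 + of_nat D * h}) \<Longrightarrow>
     (\<forall>k. \<bar>v k\<bar> \<le> 2) \<Longrightarrow> (\<forall>i<n. (-1)^i * comb g h v (t i) \<ge> \<delta>) \<Longrightarrow>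
     T \<subseteq> {0..<int D} \<Longrightarrow> (\<forall>k\<in>T. v k * v (k + 1) > 0) \<Longrightarrow> n + card T \<le> D + m"
    using comb_variation_diminishing[OF h \<delta>, of 0 2] by metis
  have bound: "of_nat J * (2 * \<psi> / pi - 1) \<le> of_nat m + 1" for J :: nat
  proof -
    \<comment> \<open>About \<open>2 * J * \<psi> / pi\<close> alternations fall into a window of
      \<open>2 * J\<close> steps, in which the pairs \<open>(2 * l, 2 * l + 1)\<close> have equal
      signs. The excess grows linearly in \<open>J\<close>.\<close>
    define n where "n = nat \<lfloor>2 * of_nat J * \<psi> / pi\<rfloor>"
    define T where "T = (\<lambda>l. 2 * int l) ` {..<J}"
    have "0 \<le> 2 * of_nat J * \<psi> / pi" using \<psi> pi_gt_zero by simp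
    then have n: "of_nat n \<le> 2 * of_nat J * \<psi> / pi" "2 * of_nat J * \<psi> / pi < of_nat n + 1"
      unfolding n_def by linarith+
    have "n + card T \<le> 2 * J + m"
    proof (rule m)
      show "strict_mono_on {..<n} (\<lambda>i. of_int (j i) * h)"
      proof (rule strict_mono_onI)
        fix i i' assume "i < (i'::nat)"
        then have "pi * (of_nat i + 1) \<le> pi * of_nat i'" by (intro mult_left_mono) auto
        then have "pi * (of_nat i + 1) / \<psi> \<le> pi * of_nat i' / \<psi>" using \<psi> by (intro divide_right_mono) (auto intro: order_trans[of _ "pi/2"])
        moreover have "1 < pi / \<psi>" using \<psi> pi_gt_zero by (simp add: field_simps)
        ultimately have "pi * of_nat i / \<psi> + 1 < pi * of_nat i' / \<psi>" by (simp add: distrib_left add_divide_distrib)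
        then have "j i < j i'" unfolding j_def by linarith
        then show "of_int (j i) * h < of_int (j i') * h" using h by simp
      qed
      show "\<forall>i<n. of_int (j i) * h \<in> {0..0 + of_nat (2 * J) * h}"
      proof (intro allI impI)
        fix i assume "i < n"
        then have "real i \<le> 2 * of_nat J * \<psi> / pi" using n(1) by (meson less_imp_le of_nat_mono order_trans)
        then have "pi * of_nat i / \<psi> \<le> of_int (2 * int J)" using \<psi> pi_gt_zero by (simp add: field_simps)
        then have "j i \<le> 2 * int J" unfolding j_def by (simp add: ceiling_le_iff)
        then have "real_of_int (j i) \<le> of_nat (2 * J)" by linarith
        then have "of_int (j i) * h \<le> of_nat (2 * J) * h" using h by (intro mult_right_mono) auto
        moreover have "0 \<le> pi * of_nat i / \<psi>" using \<psi> pi_gt_zero by simp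
        then have "0 \<le> j i" unfolding j_def by linarith
        ultimately show "of_int (j i) * h \<in> {0..0 + of_nat (2 * J) * h}" using h by simp
      qed
      show "\<forall>k. \<bar>v k\<bar> \<le> 2" using v2 by blast
      show "\<forall>i<n. \<delta> \<le> (-1)^i * comb g h v (of_int (j i) * h)" using vj by blast
      show "T \<subseteq> {0..<int (2 * J)}" by (auto simp: T_def)
      show "\<forall>k\<in>T. v k * v (k + 1) > 0"
      proof
        fix k assume "k \<in> T"
        then obtain l where l: "k = 2 * l" by (auto simp: T_def)
        have eq: "u (k + 1) = u k" by (simp add: u_def l)
        have "\<bar>1/2 * w k\<bar> \<le> 1/2" "\<bar>1/2 * w (k + 1)\<bar> \<le> 1/2" using w1 by (simp_all add: abs_mult)
        then have "u k = 1 \<Longrightarrow> v k > 0 \<and> v (k + 1) > 0" "u k = - 1 \<Longrightarrow> v k < 0 \<and> v (k + 1) < 0"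
          unfolding v_def eq by linarith+
        moreover have "u k = 1 \<or> u k = - 1" by (auto simp: u_def altsign_def)
        ultimately show "v k * v (k + 1) > 0" using mult_pos_pos mult_neg_neg by blast
      qed
    qed
    moreover have "card T = J" by (simp add: T_def card_image inj_on_def)
    ultimately have "real n \<le> of_nat J + of_nat m" by linarith
    with n(2) show ?thesis by (simp add: algebra_simps)
  qed
  have "2 * \<psi> / pi - 1 > 0" using \<psi> pi_gt_zero by (simp add: field_simps)
  then obtain J :: nat where "of_nat m + 1 < of_nat J * (2 * \<psi> / pi - 1)"
    by (metis reals_Archimedean3)
  with bound[of J] show False by simp
qed

text \<open>The decay of \<open>g\<close> makes the symbol for mesh \<open>\<gamma>/2\<close> a
  Laurent series that converges on an annulus around the unit circle. The identity theorem carries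
  its zeros from the arc to the point 1, where it is the sum of all samples.\<close>

lemma comb_altsign_nonzero:
  assumes "\<gamma> > 0"
  shows "\<exists>t. comb g \<gamma> altsign t \<noteq> 0"
proof (rule ccontr)
  assume neg: "\<not> ?thesis"
  define h where "h = \<gamma>/2"
  have h: "h > 0" and zero: "\<And>t. comb g (2 * h) altsign t = 0"
    using assms neg by (auto simp: h_def)
  define R where "R = exp (a * h)"
  have R: "R > 1" using a_pos h by (simp add: R_def)
  \<comment> \<open>Nonnegative powers go into \<open>b\<close> and negative ones into
    \<open>c\<close>, with \<open>c 0 = 0\<close> so that the middle sample is counted once.\<close>
  define b c where "b n = complex_of_real (g (of_nat n * h))"
    and "c n = complex_of_real (if n = 0 then 0 else g (- (of_nat n * h)))" for n :: nat
  have decayn: "g (of_nat n * h) \<le> C * (1/R)^n" "g (- (of_nat n * h)) \<le> C * (1/R)^n" for n :: nat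
  proof -
    have "exp (- a * (of_nat n * h)) = (1/R)^n"
      by (simp add: R_def exp_of_nat_mult[symmetric] power_one_over exp_minus inverse_eq_divide mult_ac)
    then show "g (of_nat n * h) \<le> C * (1/R)^n" "g (- (of_nat n * h)) \<le> C * (1/R)^n"
      using decay[of "of_nat n * h"] decay[of "- (of_nat n * h)"] h by (simp_all add: abs_mult)
  qed
  have summ: "summable (\<lambda>n. norm (x n * z ^ n))"
    if "\<And>n. norm (x n) \<le> C * (1/R)^n" "cmod z < R" for x :: "nat \<Rightarrow> complex" and z
  proof (rule summable_comparison_test')
    show "summable (\<lambda>n. C * (cmod z / R)^n)"
      by (intro summable_mult summable_geometric) (use that(2) R in auto)
    fix n
    have "norm (x n) * cmod z ^ n \<le> (C * (1/R)^n) * cmod z ^ n" using that(1) by (intro mult_right_mono) auto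
    then show "norm (norm (x n * z ^ n)) \<le> C * (cmod z / R)^n"
      by (simp add: norm_mult norm_power power_divide)
  qed
  have xb: "norm (b n) \<le> C * (1/R)^n" "norm (c n) \<le> C * (1/R)^n" for n
    using decayn[of n] nonneg C_pos R by (auto simp: b_def c_def)
  define f1 f2 where "f1 z = (\<Sum>n. b n * z ^ n)" and "f2 z = (\<Sum>n. c n * z ^ n)" for z
  have ps: "(\<lambda>n. x n * z ^ n) sums (\<Sum>n. x n * z ^ n)" "((\<lambda>n. x n * z ^ n) has_sum (\<Sum>n. x n * z ^ n)) UNIV"
    if "\<And>n. norm (x n) \<le> C * (1/R)^n" "cmod z < R" for x :: "nat \<Rightarrow> complex" and z
  proof -
    have s: "summable (\<lambda>n. norm (x n * z ^ n))" by (rule summ[OF that])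
    then show "(\<lambda>n. x n * z ^ n) sums (\<Sum>n. x n * z ^ n)"
      by (intro summable_sums) (rule summable_norm_cancel)
    with s show "((\<lambda>n. x n * z ^ n) has_sum (\<Sum>n. x n * z ^ n)) UNIV"
      by (rule norm_summable_imp_has_sum)
  qed
  have hol: "f1 holomorphic_on ball 0 R" "f2 holomorphic_on ball 0 R"
    unfolding f1_def f2_def
    by (rule power_series_holomorphic, simp, rule ps(1)[OF xb(1)], simp)
       (rule power_series_holomorphic, simp, rule ps(1)[OF xb(2)], simp)
  define S where "S = {z::complex. 1/R < norm z \<and> norm z < R}"
  define G where "G z = f1 z + f2 (1/z)" for z
  have G: "G (cis \<psi>) = (\<Sum>\<^sub>\<infinity>l\<in>(UNIV::int set). of_real (g (of_int l * h)) * cis (\<psi> * of_int l))" for \<psi>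
  proof -
    define \<phi> where "\<phi> l = complex_of_real (g (of_int l * h)) * cis (\<psi> * of_int l)" for l :: int
    have hs: "((\<lambda>n. b n * cis \<psi> ^ n) has_sum f1 (cis \<psi>)) UNIV" "((\<lambda>n. c n * (1/cis \<psi>) ^ n) has_sum f2 (1/cis \<psi>)) UNIV"
      unfolding f1_def f2_def using R by (auto intro!: ps(2) xb simp: norm_divide)
    have 1: "(\<phi> has_sum f1 (cis \<psi>)) {0..}"
      using hs(1) by (rule has_sum_reindex_bij_witness[of UNIV nat int, THEN iffD1, rotated -1])
        (auto simp: \<phi>_def b_def Complex.DeMoivre mult.commute)
    have "((\<lambda>n. c n * (1/cis \<psi>) ^ n) has_sum f2 (1/cis \<psi>)) {1..}"
      using hs(2) by (rule has_sum_cong_neutral[THEN iffD1, rotated -1]) (auto simp: c_def)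
    then have 2: "(\<phi> has_sum f2 (1/cis \<psi>)) {..<0}"
      by (rule has_sum_reindex_bij_witness[of "{1..}" "\<lambda>l. nat (- l)" "\<lambda>n. - int n", THEN iffD1, rotated -1])
        (auto simp: \<phi>_def c_def Complex.DeMoivre mult.commute divide_inverse)
    have "(\<phi> has_sum (f1 (cis \<psi>) + f2 (1/cis \<psi>))) ({0..} \<union> {..<0})"
      by (rule has_sum_Un_disjoint[OF 1 2]) auto
    moreover have "{0..} \<union> {..<0} = (UNIV :: int set)" by auto
    ultimately show ?thesis by (simp add: G_def \<phi>_def[abs_def] infsumI)
  qed
  have "G 1 = 0"
  proof (rule analytic_continuation[of G S "cis ` {pi/2<..<pi}" "cis (3*pi/4)"])
    have S: "z \<noteq> 0 \<and> 1/z \<in> ball 0 R" if "z \<in> S" for z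
    proof -
      have "0 < 1/R" "1/R < norm z" using that R by (auto simp: S_def)
      then have "0 < norm z" by linarith
      with \<open>1/R < norm z\<close> R show ?thesis by (auto simp: norm_divide field_simps)
    qed
    then have "(\<lambda>z. f2 (1/z)) holomorphic_on S"
      by (intro holomorphic_on_compose_gen[OF _ hol(2), unfolded o_def]) (auto intro!: holomorphic_intros)
    moreover have "f1 holomorphic_on S" by (rule holomorphic_on_subset[OF hol(1)]) (auto simp: S_def)
    ultimately show "G holomorphic_on S" unfolding G_def by (intro holomorphic_intros)
    have "S = {z. 1/R < norm z} \<inter> {z. norm z < R}" by (auto simp: S_def)
    then show "open S" by (auto intro!: open_Int open_Collect_less continuous_intros)
    show "connected S" unfolding S_def using connected_annulus(1)[where a = "0::complex" and ?r1.0 = "1/R" and ?r2.0 = R] by simp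
    have Rinv: "1/R < 1" using R by simp
    then show "cis ` {pi/2<..<pi} \<subseteq> S" "cis (3*pi/4) \<in> S" "1 \<in> S" using R by (auto simp: S_def)
    show "cis (3*pi/4) islimpt cis ` {pi/2<..<pi}"
    proof (rule connected_imp_perfect)
      show "connected (cis ` {pi/2<..<pi})"
        by (intro connected_continuous_image continuous_intros) auto
      have "cos (3*pi/4) < cos (2*pi/3)" by (intro cos_monotone_0_pi) auto
      then have "cis (3*pi/4) \<noteq> cis (2*pi/3)" by (auto simp: complex_eq_iff)
      moreover have "cis (3*pi/4) \<in> cis ` {pi/2<..<pi}" "cis (2*pi/3) \<in> cis ` {pi/2<..<pi}" by auto
      ultimately show "cis ` {pi/2<..<pi} \<noteq> {x}" for x by (metis singletonD)
      show "cis (3*pi/4) \<in> cis ` {pi/2<..<pi}" by auto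
    qed
    fix z assume "z \<in> cis ` {pi/2<..<pi}"
    then show "G z = 0" using G symbol_vanishes_on_arc[OF h zero] by auto
  qed
  moreover have "G 1 = of_real (comb g h (\<lambda>_. 1) 0)"
  proof -
    have "G 1 = (\<Sum>\<^sub>\<infinity>l\<in>(UNIV::int set). of_real (g (of_int l * h)))" using G[of 0] by simp
    also have "\<dots> = of_real (\<Sum>\<^sub>\<infinity>l\<in>(UNIV::int set). g (of_int l * h))" by (rule infsumI, subst has_sum_of_real_iff, rule has_sum_infsum)
        (use summable_shift[of h 0] summable_on_reindex_bij_witness[of UNIV uminus uminus UNIV "\<lambda>l::int. g (of_int l * h)" "\<lambda>l. g (0 - of_int l * h)"] h in simp)
    also have "(\<Sum>\<^sub>\<infinity>l\<in>(UNIV::int set). g (of_int l * h)) = comb g h (\<lambda>_. 1) 0"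
      unfolding comb_def by (rule infsum_reindex_bij_witness[of _ uminus uminus]) auto
    finally show ?thesis .
  qed
  ultimately show False using comb_one_pos[OF h, of 0] by simp
qed

end

section \<open>Injectivity of sampled combs\<close>

lemma alternating_four:
  assumes "(0::real) < f (0::nat)" "f 1 < 0" "0 < f 2" "f 3 < 0" "i < 4"
  shows "(-1)^i * f i > 0"
proof -
  have "i = 0 \<or> i = 1 \<or> i = 2 \<or> i = 3" using assms(5) by auto
  then show ?thesis using assms by (auto simp: power_numeral_odd)
qed

context tp_decay begin

text \<open>Subtracting a small constant comb would create four sign changes per two columns.\<close>

lemma altsign_comb_no_return:
  assumes \<gamma>: "\<gamma> > 0" and t: "t1 < s1" "s1 < s2" "s2 < t1 + \<gamma>"
    and F: "comb g \<gamma> altsign t1 > 0" "comb g \<gamma> altsign s1 \<le> 0" "comb g \<gamma> altsign s2 > 0"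
  shows False
proof -
  define F P where "F = comb g \<gamma> altsign" and "P = comb g \<gamma> (\<lambda>_. 1)"
  have P: "P t > 0" for t using comb_one_pos[OF \<gamma>] by (simp add: P_def)
  have "\<forall>\<^sub>F \<epsilon> in at_right (0::real). \<epsilon> > 0 \<and> F t1 + \<epsilon> * - P t1 > 0 \<and> F s2 + \<epsilon> * - P s2 > 0"
  proof (intro eventually_conj eventually_at_right_less)
    have "\<forall>\<^sub>F \<epsilon> in at_right 0. F x + \<epsilon> * - P x > 0" if "F x > 0" for x
    proof -
      have "((\<lambda>\<epsilon>. F x + \<epsilon> * - P x) \<longlongrightarrow> F x + 0 * - P x) (at_right 0)" by (intro tendsto_intros)
      from order_tendstoD(1)[OF this, of 0] that show ?thesis by simp
    qed
    then show "\<forall>\<^sub>F \<epsilon> in at_right 0. F t1 + \<epsilon> * - P t1 > 0" "\<forall>\<^sub>F \<epsilon> in at_right 0. F s2 + \<epsilon> * - P s2 > 0"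
      using F by (auto simp: F_def)
  qed
  then obtain \<epsilon> where \<epsilon>: "\<epsilon> > 0" "F t1 + \<epsilon> * - P t1 > 0" "F s2 + \<epsilon> * - P s2 > 0"
    by (metis (no_types, lifting) eventually_happens trivial_limit_at_right_real)
  define v where "v k = altsign k + (- \<epsilon>) * 1" for k
  have v: "comb g \<gamma> v t = F t - \<epsilon> * P t" for t
    unfolding v_def F_def P_def by (subst comb_add[where V = 1 and V' = 1]) (use \<gamma> in auto)
  \<comment> \<open>Four points within less than one period \<open>2 * \<gamma>\<close>. At the
    last, \<open>t1 + \<gamma>\<close>, the alternating comb has the sign opposite to that at
    \<open>t1\<close>.\<close>
  define s where "s i = (if i = 0 then t1 else if i = 1 then s1 else if i = 2 then s2 else t1 + \<gamma>)" for i :: nat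
  have "4 + card ({}::int set) \<le> 2"
  proof (rule comb_periodic_variation_diminishing[where v = v and h = \<gamma> and s = s])
    show "v (k + int 2) = v k" for k by (simp add: v_def altsign_add_even)
    show "strict_mono_on {..<4} s" using t \<gamma> by (auto simp: strict_mono_on_def s_def)
    show "s i < s 0 + of_nat 2 * \<gamma>" for i using t \<gamma> by (auto simp: s_def)
    have "F (t1 + \<gamma>) = - F t1" using comb_altsign_add[of \<gamma> t1 1] by (simp add: F_def)
    moreover have "\<epsilon> * P t > 0" for t using \<epsilon>(1) P by simp
    moreover have F': "F s1 \<le> 0" "F t1 - \<epsilon> * P t1 > 0" "F s2 - \<epsilon> * P s2 > 0"
      using F(2) \<epsilon>(2,3) by (simp_all add: F_def)
    moreover have "F s1 - \<epsilon> * P s1 < 0"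
      using F'(1) \<open>\<And>t. \<epsilon> * P t > 0\<close>[of s1] by linarith
    moreover have "F (t1 + \<gamma>) - \<epsilon> * P (t1 + \<gamma>) < 0"
      using F'(2) \<open>F (t1 + \<gamma>) = - F t1\<close> \<open>\<And>t. \<epsilon> * P t > 0\<close>[of t1] \<open>\<And>t. \<epsilon> * P t > 0\<close>[of "t1 + \<gamma>"] by linarith
    ultimately show "(-1)^i * comb g \<gamma> v (s i) > 0" if "i < 4" for i
      using that by (intro alternating_four) (simp_all add: v s_def)
  qed (use \<gamma> in auto)
  then show False by simp
qed

text \<open>Otherwise some combination of \<open>w\<close> and the constant sequence would have comb
  values -1 at \<open>t0\<close> and 1 at \<open>t0'\<close>. A small multiple of it, added to the
  alternating sequence, turns the two zeros into two extra sign changes, \<open>N + 2\<close> per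
  period of \<open>N\<close> coefficients.\<close>

lemma two_zeros_dependent:
  assumes \<gamma>: "\<gamma> > 0" and t: "t1 < t0" "t0 < t0'" "t0' < t1 + \<gamma>"
    and F: "comb g \<gamma> altsign t1 > 0" "comb g \<gamma> altsign t0 = 0" "comb g \<gamma> altsign t0' = 0"
    and N: "even N" "N \<ge> 1" and w: "\<And>k. w (k + int N) = w k"
  shows "comb g \<gamma> w t0 * comb g \<gamma> (\<lambda>_. 1) t0' = comb g \<gamma> w t0' * comb g \<gamma> (\<lambda>_. 1) t0"
proof (rule ccontr)
  define F P E where "F = comb g \<gamma> altsign" and "P = comb g \<gamma> (\<lambda>_. 1)" and "E = comb g \<gamma> w"
  assume "\<not> ?thesis"
  then have ne: "E t0 * P t0' - E t0' * P t0 \<noteq> 0" by (simp add: E_def P_def)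
  \<comment> \<open>Cramer's rule for \<open>y * P + x * E\<close> to take the values -1 at
    \<open>t0\<close> and 1 at \<open>t0'\<close>.\<close>
  define x y where "x = (- P t0' - P t0) / (E t0 * P t0' - E t0' * P t0)"
    and "y = (E t0 + E t0') / (E t0 * P t0' - E t0' * P t0)"
  obtain V where V: "\<And>k. \<bar>w k\<bar> \<le> V" using periodic_bounded[of N w] N w by blast
  define w' where "w' k = y * 1 + x * w k" for k
  have E': "comb g \<gamma> w' t = y * P t + x * E t" for t
  proof -
    have "comb g \<gamma> w' t = comb g \<gamma> (\<lambda>_. y * 1) t + x * E t"
      unfolding w'_def E_def by (rule comb_add[where V = "\<bar>y\<bar>" and V' = V]) (use \<gamma> V in auto)
    then show ?thesis using comb_cmult[of \<gamma> y "\<lambda>_. 1" t] by (simp add: P_def)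
  qed
  have E'0: "comb g \<gamma> w' t0 = - 1" "comb g \<gamma> w' t0' = 1"
  proof -
    define Q where "Q = E t0 * P t0' - E t0' * P t0"
    have "Q \<noteq> 0" using ne by (simp add: Q_def)
    have "y * P t0 + x * E t0 = ((E t0 + E t0') * P t0 + (- P t0' - P t0) * E t0) / Q"
      "y * P t0' + x * E t0' = ((E t0 + E t0') * P t0' + (- P t0' - P t0) * E t0') / Q"
      unfolding x_def y_def Q_def[symmetric]
      by (simp_all only: times_divide_eq_left add_divide_distrib[symmetric])
    moreover have "(E t0 + E t0') * P t0 + (- P t0' - P t0) * E t0 = - Q"
      "(E t0 + E t0') * P t0' + (- P t0' - P t0) * E t0' = Q"
      by (simp_all add: Q_def algebra_simps)
    ultimately show "comb g \<gamma> w' t0 = - 1" "comb g \<gamma> w' t0' = 1"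
      unfolding E' using \<open>Q \<noteq> 0\<close> by simp_all
  qed
  have w'per: "w' (k + int N) = w' k" for k by (simp add: w'_def w)
  obtain V' where V': "\<And>k. \<bar>w' k\<bar> \<le> V'" using periodic_bounded[of N w'] N w'per by blast
  define E2 where "E2 = comb g \<gamma> w'"
  have F1: "F t1 > 0" using F by (simp add: F_def)
  have "\<forall>\<^sub>F \<epsilon> in at_right (0::real). \<epsilon> > 0 \<and> (\<forall>i\<in>{..<N}. F t1 + \<epsilon> * ((-1)^i * E2 (t1 + of_nat i * \<gamma>)) > 0)"
  proof (intro eventually_conj eventually_at_right_less eventually_ball_finite ballI)
    fix i
    have "((\<lambda>\<epsilon>. F t1 + \<epsilon> * ((-1)^i * E2 (t1 + of_nat i * \<gamma>))) \<longlongrightarrow> F t1 + 0 * ((-1)^i * E2 (t1 + of_nat i * \<gamma>))) (at_right 0)"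
      by (intro tendsto_intros)
    from order_tendstoD(1)[OF this, of 0] F1
    show "\<forall>\<^sub>F \<epsilon> in at_right 0. F t1 + \<epsilon> * ((-1)^i * E2 (t1 + of_nat i * \<gamma>)) > 0" by simp
  qed auto
  then obtain \<epsilon> where \<epsilon>: "\<epsilon> > 0" "\<And>i. i < N \<Longrightarrow> F t1 + \<epsilon> * ((-1)^i * E2 (t1 + of_nat i * \<gamma>)) > 0"
    by (metis (no_types, lifting) eventually_happens trivial_limit_at_right_real lessThan_iff)
  define v where "v k = altsign k + \<epsilon> * w' k" for k
  have v: "comb g \<gamma> v t = F t + \<epsilon> * E2 t" for t
    unfolding v_def F_def E2_def by (rule comb_add[where V = 1 and V' = V']) (use \<gamma> V' in auto)
  \<comment> \<open>After \<open>t1\<close>, \<open>t0\<close>, \<open>t0'\<close> come the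
    translates \<open>t1 + \<gamma>\<close> up to \<open>t1 + (N - 1) * \<gamma>\<close>. Two points
    have been inserted, so the parity of the alternation is unchanged.\<close>
  define s where "s i = (if i = 0 then t1 else if i = 1 then t0 else if i = 2 then t0' else t1 + of_nat (i - 2) * \<gamma>)" for i :: nat
  have N2: "N \<ge> 2" using N by (metis One_nat_def Suc_1 Suc_leI le_neq_implies_less odd_one)
  have "(N + 2) + card ({}::int set) \<le> N"
  proof (rule comb_periodic_variation_diminishing[where v = v and h = \<gamma> and s = s])
    show "v (k + int N) = v k" for k using N by (simp add: v_def altsign_add_even w'per)
    have ge: "t1 + \<gamma> \<le> s i" if "i \<ge> 3" for i
    proof -
      have "1 * \<gamma> \<le> of_nat (i - 2) * \<gamma>" using that \<gamma> by (intro mult_right_mono) auto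
      then show ?thesis using that by (simp add: s_def)
    qed
    show "strict_mono_on {..<N + 2} s"
    proof (rule strict_mono_onI)
      fix i j assume "i < (j::nat)"
      show "s i < s j"
      proof (cases "i \<ge> 3")
        case True
        then have "real (i - 2) < real (j - 2)" using \<open>i < j\<close> by simp
        then show ?thesis using True \<open>i < j\<close> \<gamma> by (simp add: s_def)
      next
        case False
        show ?thesis
        proof (cases "j \<ge> 3")
          case True
          have "s i < t1 + \<gamma>" using False t \<gamma> by (auto simp: s_def)
          then show ?thesis using ge[OF True] by simp
        next
          case j: False
          then show ?thesis using \<open>i < j\<close> t by (auto simp: s_def)
        qed
      qed
    qed
    show "s i < s 0 + of_nat N * \<gamma>" if i: "i < N + 2" for i
    proof (cases "i \<ge> 3")
      case True
      then have "real (i - 2) * \<gamma> < of_nat N * \<gamma>" using i \<gamma> by (intro mult_strict_right_mono) auto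
      then show ?thesis using True by (simp add: s_def)
    next
      case False
      have "1 * \<gamma> \<le> of_nat N * \<gamma>" using N \<gamma> by (intro mult_right_mono) auto
      moreover have "s i < t1 + \<gamma>" using False t \<gamma> by (auto simp: s_def)
      moreover have "s 0 = t1" by (simp add: s_def)
      ultimately show ?thesis by linarith
    qed
    show "(-1)^i * comb g \<gamma> v (s i) > 0" if i: "i < N + 2" for i
    proof -
      have pos: "(-1)^j * comb g \<gamma> v (t1 + of_nat j * \<gamma>) > 0" if "j < N" for j
      proof -
        have "(-1)^j * comb g \<gamma> v (t1 + of_nat j * \<gamma>) = F t1 + \<epsilon> * ((-1)^j * E2 (t1 + of_nat j * \<gamma>))"
          using comb_altsign_add[of \<gamma> t1 j] by (cases "even j") (simp_all add: v F_def)
        with \<epsilon>(2)[OF that] show ?thesis by simp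
      qed
      consider "i = 0" | "i = 1" | "i = 2" | "i \<ge> 3" by linarith
      then show ?thesis
      proof cases
        case 4
        then have "s i = t1 + of_nat (i - 2) * \<gamma>" by (simp add: s_def)
        moreover have "(-1::real)^i = (-1)^(i - 2)" using 4 by (auto simp: minus_one_power_iff)
        ultimately show ?thesis using pos[of "i - 2"] i 4 by simp
      qed (use pos[of 0] N E'0 F \<epsilon>(1) in \<open>auto simp: s_def v F_def E2_def\<close>)
    qed
  qed (use \<gamma> N in auto)
  then show False by simp
qed

text \<open>Counting per period admits only sequences of even period, so a single coefficient is
  approached by periodized unit sequences. The copies drift away and the decay of \<open>g\<close>
  removes them.\<close>

lemma comb_indicator_tendsto:
  assumes \<gamma>: "\<gamma> > 0"
  shows "(\<lambda>n. comb g \<gamma> (\<lambda>j. if (2 * int (Suc n)) dvd (j - k) then 1 else 0) t) \<longlonglongrightarrow> g (t - of_int k * \<gamma>)"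
proof (rule LIMSEQ_I)
  fix r :: real assume r: "r > 0"
  define f where "f j = g (t - of_int j * \<gamma>)" for j :: int
  have f: "f summable_on UNIV" "\<And>j. f j \<ge> 0" unfolding f_def using \<gamma> nonneg by (auto intro: summable_shift)
  obtain W where W: "infsum f {j. \<bar>j\<bar> \<ge> int W} < r" using infsum_int_tail[OF f r] by blast
  show "\<exists>no. \<forall>n\<ge>no. norm (comb g \<gamma> (\<lambda>j. if (2 * int (Suc n)) dvd (j - k) then 1 else 0) t - g (t - of_int k * \<gamma>)) < r"
  proof (intro exI[of _ "W + nat \<bar>k\<bar>"] allI impI)
    fix n assume n: "n \<ge> W + nat \<bar>k\<bar>"
    define \<phi> where "\<phi> j = (if (2 * int (Suc n)) dvd (j - k) then 1 else 0) * f j" for j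
    have sm: "\<phi> summable_on UNIV" unfolding \<phi>_def f_def by (rule summable_comb[where V = 1]) (use \<gamma> in auto)
    have "comb g \<gamma> (\<lambda>j. if (2 * int (Suc n)) dvd (j - k) then 1 else 0) t = infsum \<phi> ({k} \<union> -{k})"
      by (simp add: comb_def \<phi>_def[abs_def] f_def)
    also have "\<dots> = infsum \<phi> {k} + infsum \<phi> (-{k})"
      by (intro infsum_Un_disjoint summable_on_subset[OF sm]) auto
    also have "infsum \<phi> {k} = g (t - of_int k * \<gamma>)" by (simp add: \<phi>_def f_def)
    finally have eq: "comb g \<gamma> (\<lambda>j. if (2 * int (Suc n)) dvd (j - k) then 1 else 0) t - g (t - of_int k * \<gamma>) = infsum \<phi> (-{k})"
      by simp
    have "infsum \<phi> (-{k}) \<le> infsum f {j. \<bar>j\<bar> \<ge> int W}"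
    proof (rule infsum_mono_neutral)
      fix j assume j: "j \<in> -{k} - {j. \<bar>j\<bar> \<ge> int W}"
      have "\<not> (2 * int (Suc n)) dvd (j - k)"
      proof
        assume "(2 * int (Suc n)) dvd (j - k)"
        then have "2 * int (Suc n) \<le> \<bar>j - k\<bar>" using j zdvd_imp_le[of "2 * int (Suc n)" "\<bar>j - k\<bar>"] by auto
        then show False using j n by auto
      qed
      then show "\<phi> j \<le> 0" by (simp add: \<phi>_def)
    next
      show "\<phi> summable_on -{k}" by (rule summable_on_subset[OF sm]) simp
      show "f summable_on {j. \<bar>j\<bar> \<ge> int W}" by (rule summable_on_subset[OF f(1)]) simp
    qed (use f in \<open>auto simp: \<phi>_def\<close>)
    moreover have "infsum \<phi> (-{k}) \<ge> 0" by (rule infsum_nonneg) (use f in \<open>simp add: \<phi>_def\<close>)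
    ultimately show "norm (comb g \<gamma> (\<lambda>j. if (2 * int (Suc n)) dvd (j - k) then 1 else 0) t - g (t - of_int k * \<gamma>)) < r"
      unfolding eq using W by simp
  qed
qed

text \<open>Periodized unit sequences in \<open>two_zeros_dependent\<close> isolate the coefficient
  \<open>k\<close>. The ratio between the two rows does not depend on \<open>k\<close>.\<close>

lemma two_zeros_proportional:
  assumes \<gamma>: "\<gamma> > 0" and t: "t1 < t0" "t0 < t0'" "t0' < t1 + \<gamma>"
    and F: "comb g \<gamma> altsign t1 > 0" "comb g \<gamma> altsign t0 = 0" "comb g \<gamma> altsign t0' = 0"
  shows "g (t0 - of_int k * \<gamma>) * comb g \<gamma> (\<lambda>_. 1) t0' = g (t0' - of_int k * \<gamma>) * comb g \<gamma> (\<lambda>_. 1) t0"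
proof -
  define w where "w n = (\<lambda>j::int. if (2 * int (Suc n)) dvd (j - k) then 1 else (0::real))" for n
  have lim: "(\<lambda>n. comb g \<gamma> (w n) t) \<longlonglongrightarrow> g (t - of_int k * \<gamma>)" for t
    unfolding w_def by (rule comb_indicator_tendsto[OF \<gamma>])
  have "comb g \<gamma> (w n) t0 * comb g \<gamma> (\<lambda>_. 1) t0' = comb g \<gamma> (w n) t0' * comb g \<gamma> (\<lambda>_. 1) t0" for n
  proof (rule two_zeros_dependent[OF \<gamma> t F, of "2 * Suc n"])
    show "w n (j + int (2 * Suc n)) = w n j" for j
    proof -
      have "j + int (2 * Suc n) - k = (j - k) + 2 * int (Suc n)" by simp
      then show ?thesis unfolding w_def by (metis dvd_add_triv_right_iff)
    qed
  qed auto
  then have "(\<lambda>n. comb g \<gamma> (w n) t0 * comb g \<gamma> (\<lambda>_. 1) t0') \<longlonglongrightarrow> g (t0' - of_int k * \<gamma>) * comb g \<gamma> (\<lambda>_. 1) t0"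
    by (simp only:) (intro tendsto_intros lim)
  moreover have "(\<lambda>n. comb g \<gamma> (w n) t0 * comb g \<gamma> (\<lambda>_. 1) t0') \<longlonglongrightarrow> g (t0 - of_int k * \<gamma>) * comb g \<gamma> (\<lambda>_. 1) t0'"
    by (intro tendsto_intros lim)
  ultimately show ?thesis by (rule LIMSEQ_unique[symmetric])
qed

text \<open>If a translate of \<open>g\<close> is proportional to \<open>g\<close> on a whole grid, then \<open>g\<close> is geometric on that grid.\<close>

lemma proportional_geometric:
  assumes \<gamma>: "\<gamma> > 0" and \<Delta>: "\<Delta> > 0" and c: "c > 0"
    and eqs: "g (s0 + \<Delta>) = c * g s0" "g (s0 + 2 * \<gamma> + \<Delta>) = c * g (s0 + 2 * \<gamma>)"
    and pos: "g s0 > 0" "g (s0 + 2 * \<gamma>) > 0"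
  shows "(g (s0 + \<gamma>))\<^sup>2 = g s0 * g (s0 + 2 * \<gamma>)"
proof (rule antisym)
  \<comment> \<open>The ratio \<open>g (s + \<Delta>) / g s\<close> is antitone and equals
    \<open>c\<close> at both ends of the interval, hence throughout.\<close>
  have shift: "g (s + \<Delta>) = c * g s" if "s0 \<le> s" "s \<le> s0 + 2 * \<gamma>" for s
  proof (rule antisym)
    have "g s0 * g (s + \<Delta>) \<le> g (s0 + \<Delta>) * g s" using that \<Delta> by (intro ratio_antimono) auto
    then have "g s0 * g (s + \<Delta>) \<le> g s0 * (c * g s)" using eqs by (simp add: mult_ac)
    then show "g (s + \<Delta>) \<le> c * g s" using pos(1) by simp
    have "g s * g (s0 + 2 * \<gamma> + \<Delta>) \<le> g (s + \<Delta>) * g (s0 + 2 * \<gamma>)" using that \<Delta> by (intro ratio_antimono) auto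
    then have "g (s0 + 2 * \<gamma>) * (c * g s) \<le> g (s0 + 2 * \<gamma>) * g (s + \<Delta>)" using eqs by (simp add: mult_ac)
    then show "c * g s \<le> g (s + \<Delta>)" using pos(2) by simp
  qed
  \<comment> \<open>The least number of steps \<open>\<Delta>\<close> that reaches
    \<open>\<gamma>\<close>. The antitone ratio for the shift \<open>\<gamma>\<close>, compared at
    \<open>s0 + \<gamma>\<close> and at the later point \<open>s0 + of_nat n * \<Delta>\<close>,
    then yields the reverse of log-concavity after cancelling \<open>c ^ n\<close>.\<close>
  define n where "n = nat \<lceil>\<gamma> / \<Delta>\<rceil>"
  have n: "of_nat n * \<Delta> \<ge> \<gamma>" "of_nat n * \<Delta> < \<gamma> + \<Delta>"
  proof -
    have "0 \<le> \<gamma> / \<Delta>" using \<gamma> \<Delta> by simp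
    then have "\<gamma> / \<Delta> \<le> of_nat n" "of_nat n < \<gamma> / \<Delta> + 1" unfolding n_def by linarith+
    then show "of_nat n * \<Delta> \<ge> \<gamma>" "of_nat n * \<Delta> < \<gamma> + \<Delta>" using \<Delta> by (simp_all add: field_simps)
  qed
  have iter: "g (s + of_nat i * \<Delta>) = c ^ i * g s" if "s0 \<le> s" "s \<le> s0 + \<gamma>" "i \<le> n" for i s
    using that(3)
  proof (induction i)
    case (Suc i)
    have "(of_nat i + 1) * \<Delta> \<le> of_nat n * \<Delta>" using Suc.prems \<Delta> by (intro mult_right_mono) auto
    then have "of_nat i * \<Delta> \<le> \<gamma>" using n(2) by (simp add: distrib_right)
    moreover have "0 \<le> of_nat i * \<Delta>" using \<Delta> by simp
    ultimately have "g (s + of_nat i * \<Delta> + \<Delta>) = c * g (s + of_nat i * \<Delta>)"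
      using that by (intro shift) linarith+
    then show ?case using Suc by (simp add: algebra_simps)
  qed simp
  have "g (s0 + \<gamma>) * g (s0 + of_nat n * \<Delta> + \<gamma>) \<le> g (s0 + \<gamma> + \<gamma>) * g (s0 + of_nat n * \<Delta>)"
    using n(1) \<gamma> by (intro ratio_antimono) auto
  moreover have "g (s0 + of_nat n * \<Delta> + \<gamma>) = c ^ n * g (s0 + \<gamma>)"
    using iter[of "s0 + \<gamma>" n] \<gamma> by (simp add: add_ac)
  moreover have "g (s0 + of_nat n * \<Delta>) = c ^ n * g s0" using iter[of s0 n] \<gamma> by simp
  ultimately have "c ^ n * (g (s0 + \<gamma>))\<^sup>2 \<le> c ^ n * (g s0 * g (s0 + 2 * \<gamma>))"
    by (simp add: power2_eq_square mult_ac add.assoc)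
  then show "(g (s0 + \<gamma>))\<^sup>2 \<le> g s0 * g (s0 + 2 * \<gamma>)" using c by simp
  show "g s0 * g (s0 + 2 * \<gamma>) \<le> (g (s0 + \<gamma>))\<^sup>2"
    using ratio_antimono[of s0 "s0 + \<gamma>" \<gamma>] \<gamma> by (simp add: power2_eq_square add.assoc)
qed

text \<open>A convex set of integers that fits into no finite interval and is not everything must be
  a half-line.\<close>

lemma int_interval_boundary:
  fixes K :: "int set"
  assumes conv: "\<And>i j k. i \<in> K \<Longrightarrow> k \<in> K \<Longrightarrow> i \<le> j \<Longrightarrow> j \<le> k \<Longrightarrow> j \<in> K"
    and unb: "\<And>l u. \<not> K \<subseteq> {l..u}" and ne: "K \<noteq> UNIV"
  shows "\<exists>!k. (k \<in> K) \<noteq> (k + 1 \<in> K)"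
proof (rule ex_ex1I)
  show "\<exists>k. (k \<in> K) \<noteq> (k + 1 \<in> K)"
  proof (rule ccontr)
    assume "\<not> ?thesis"
    then have step: "(k \<in> K) = (k + 1 \<in> K)" for k by blast
    obtain k0 where k0: "k0 \<in> K" using unb[of 0 0] by blast
    have "k \<in> K" for k
    proof (induction k rule: int_induct[of _ k0])
      case (step1 i)
      then show ?case using step[of i] by simp
    next
      case (step2 i)
      then show ?case using step[of "i - 1"] by simp
    qed (use k0 in simp)
    with ne show False by blast
  qed
  have "False" if k: "(k \<in> K) \<noteq> (k + 1 \<in> K)" and l: "(l \<in> K) \<noteq> (l + 1 \<in> K)" and "k < l" for k l
  proof (cases "k \<in> K")
    case True
    then have "k + 1 \<notin> K" using k by simp
    then have "j \<notin> K" if "j > k" for j using conv[of k j "k + 1"] True that by auto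
    then show False using l \<open>k < l\<close> by auto
  next
    case False
    then have k1: "k + 1 \<in> K" using k by simp
    have low: "j \<notin> K" if "j \<le> k" for j using conv[of j "k + 1" k] False k1 that by auto
    have "l \<in> K"
    proof (rule ccontr)
      assume "l \<notin> K"
      then have "l + 1 \<in> K" using l by simp
      then show False using conv[of "k + 1" "l + 1" l] k1 \<open>k < l\<close> \<open>l \<notin> K\<close> by auto
    qed
    then have "l + 1 \<notin> K" using l by simp
    then have high: "j \<notin> K" if "j > l" for j using conv[of l j "l + 1"] \<open>l \<in> K\<close> that by auto
    have "K \<subseteq> {k..l}" using low high by (meson atLeastAtMost_iff linorder_not_less order_less_imp_le subsetI)
    with unb show False by blast
  qed
  then show "k = l" if "(k \<in> K) \<noteq> (k + 1 \<in> K)" "(l \<in> K) \<noteq> (l + 1 \<in> K)" for k l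
    using that by (metis linorder_neqE)
qed

text \<open>Neighbouring quotients agree wherever three consecutive values are positive. As the
  positive values form an interval, the quotient at one pair spreads to all others.\<close>

lemma int_interval_geometric:
  fixes b :: "int \<Rightarrow> real"
  assumes nn: "\<And>k. b k \<ge> 0" and conv: "\<And>i j k. b i > 0 \<Longrightarrow> b k > 0 \<Longrightarrow> i \<le> j \<Longrightarrow> j \<le> k \<Longrightarrow> b j > 0"
    and geo: "\<And>k. b k > 0 \<Longrightarrow> b (k + 2) > 0 \<Longrightarrow> (b (k + 1))\<^sup>2 = b k * b (k + 2)"
  shows "\<exists>R>0. \<forall>k. b k > 0 \<longrightarrow> b (k + 1) > 0 \<longrightarrow> b (k + 1) = R * b k"
proof (cases "\<exists>k. b k > 0 \<and> b (k + 1) > 0")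
  case True
  then obtain k0 where k0: "b k0 > 0" "b (k0 + 1) > 0" by blast
  define R where "R = b (k0 + 1) / b k0"
  have R: "R > 0" using k0 by (simp add: R_def)
  have "b (k + 1) = R * b k" if "b k > 0" "b (k + 1) > 0" for k
    using that
  proof (induction k rule: int_induct[of _ k0])
    case base
    then show ?case using k0 by (simp add: R_def)
  next
    case (step1 i)
    have bi: "b i > 0" using conv[of k0 "i + 1" i] k0 step1 by simp
    then have IH: "b (i + 1) = R * b i" using step1 by simp
    have "(b (i + 1))\<^sup>2 = b i * b (i + 2)" using geo[of i] bi step1.prems by (simp add: add.assoc)
    then have "b i * b (i + 2) = b i * (R * b (i + 1))" using IH by (auto simp: power2_eq_square mult_ac)
    then have "b (i + 2) = R * b (i + 1)" using bi unfolding mult_cancel_left by auto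
    then show ?case by (simp add: add.assoc)
  next
    case (step2 i)
    have bi: "b (i + 1) > 0" using conv[of i "k0 + 1" "i + 1"] k0 step2 by simp
    then have IH: "b (i + 1) = R * b i" using step2 by simp
    have "(b i)\<^sup>2 = b (i - 1) * b (i + 1)" using geo[of "i - 1"] bi step2.prems by (simp add: add.commute)
    then have "b i * b i = b i * (R * b (i - 1))" using IH by (auto simp: power2_eq_square mult_ac)
    then show ?case using step2.prems by simp
  qed
  with R show ?thesis by blast
next
  case False
  then show ?thesis by (intro exI[of _ 1]) auto
qed

text \<open>The samples \<open>b\<close> are geometric with quotient \<open>R\<close> on their
  support, which is all integers or a half-line. In the first case they are not summable. In the
  second, \<open>R * b k - b (k + 1)\<close> is nonzero only at the boundary, while its alternating
  sum is made up of the comb at \<open>t0\<close> and its shift, which were supposed to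
  vanish.\<close>

lemma proportional_rows_nonzero:
  assumes \<gamma>: "\<gamma> > 0" and t: "t0 < t0'" and c: "c > 0"
    and eqs: "\<And>k::int. g (t0' - of_int k * \<gamma>) = c * g (t0 - of_int k * \<gamma>)"
  shows "comb g \<gamma> altsign t0 \<noteq> 0"
proof
  assume F0: "comb g \<gamma> altsign t0 = 0"
  define b where "b k = g (t0 - of_int k * \<gamma>)" for k :: int
  have conv: "b j > 0" if "b i > 0" "b k > 0" "i \<le> j" "j \<le> k" for i j k
  proof (cases "j = i \<or> j = k")
    case False
    then have "of_int i * \<gamma> < of_int j * \<gamma>" "of_int j * \<gamma> < of_int k * \<gamma>" using that \<gamma> by auto
    then show ?thesis using that(1,2) pos_between[of "t0 - of_int k * \<gamma>" "t0 - of_int i * \<gamma>" "t0 - of_int j * \<gamma>"]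
      by (simp add: b_def)
  qed (use that in auto)
  have geo: "(b (k + 1))\<^sup>2 = b k * b (k + 2)" if "b k > 0" "b (k + 2) > 0" for k
  proof -
    define s0 where "s0 = t0 - of_int (k + 2) * \<gamma>"
    have e: "s0 + 2 * \<gamma> = t0 - of_int k * \<gamma>" "s0 + \<gamma> = t0 - of_int (k + 1) * \<gamma>"
      "s0 + (t0' - t0) = t0' - of_int (k + 2) * \<gamma>" "s0 + 2 * \<gamma> + (t0' - t0) = t0' - of_int k * \<gamma>"
      by (simp_all add: s0_def algebra_simps)
    have "(g (s0 + \<gamma>))\<^sup>2 = g s0 * g (s0 + 2 * \<gamma>)"
    proof (rule proportional_geometric[OF \<gamma> _ c])
      show "t0' - t0 > 0" using t by simp
      show "g (s0 + (t0' - t0)) = c * g s0" "g (s0 + 2 * \<gamma> + (t0' - t0)) = c * g (s0 + 2 * \<gamma>)"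
        subgoal unfolding e(3) unfolding s0_def by (rule eqs)
        subgoal unfolding e(4) unfolding e(1) by (rule eqs)
        done
      show "g s0 > 0" "g (s0 + 2 * \<gamma>) > 0" using that unfolding e by (simp_all add: b_def s0_def)
    qed
    then show ?thesis unfolding e by (simp add: b_def s0_def mult.commute)
  qed
  have "\<exists>R>0. \<forall>k. b k > 0 \<longrightarrow> b (k + 1) > 0 \<longrightarrow> b (k + 1) = R * b k"
  proof (rule int_interval_geometric)
    show "b k \<ge> 0" for k by (simp add: b_def nonneg)
  qed (erule (3) conv, erule (1) geo)
  then obtain R where R: "R > 0" "\<And>k. b k > 0 \<Longrightarrow> b (k + 1) > 0 \<Longrightarrow> b (k + 1) = R * b k"
    by blast
  have sb: "b summable_on UNIV" unfolding b_def using \<gamma> by (intro summable_shift) auto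
  have ab: "(\<lambda>k. altsign k * b k) summable_on UNIV" unfolding b_def
    by (rule summable_comb[where V = 1]) (use \<gamma> in auto)
  have b1: "(\<lambda>k. altsign k * b (k + 1)) summable_on UNIV" "(\<Sum>\<^sub>\<infinity>k. altsign k * b (k + 1)) = 0"
  proof -
    have eq: "altsign k * b (k + 1) = - 1 * (altsign (k + 1) * b (k + 1))" for k by simp
    show "(\<lambda>k. altsign k * b (k + 1)) summable_on UNIV" unfolding eq
      by (intro summable_on_cmult_right) (use ab summable_on_int_shift[of "\<lambda>k. altsign k * b k" 1] in blast)
    show "(\<Sum>\<^sub>\<infinity>k. altsign k * b (k + 1)) = 0" unfolding eq infsum_cmult_right'
      using infsum_int_shift[of "\<lambda>k. altsign k * b k" 1] F0 by (simp add: comb_def b_def)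
  qed
  define \<phi> where "\<phi> k = R * b k - b (k + 1)" for k
  have "(\<Sum>\<^sub>\<infinity>k. altsign k * \<phi> k) = (\<Sum>\<^sub>\<infinity>k. R * (altsign k * b k) + (- 1) * (altsign k * b (k + 1)))"
    by (simp add: \<phi>_def algebra_simps)
  also have "\<dots> = (\<Sum>\<^sub>\<infinity>k. R * (altsign k * b k)) + (\<Sum>\<^sub>\<infinity>k. (- 1) * (altsign k * b (k + 1)))"
    by (intro infsum_add summable_on_cmult_right ab b1)
  also have "\<dots> = 0" unfolding infsum_cmult_right' b1(2) using F0 by (simp add: comb_def b_def)
  finally have S0: "(\<Sum>\<^sub>\<infinity>k. altsign k * \<phi> k) = 0" .
  define K where "K = {k. b k > 0}"
  have bK: "k \<notin> K \<Longrightarrow> b k = 0" for k using nonneg[of "t0 - of_int k * \<gamma>"] by (auto simp: K_def b_def)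
  have neK: "K \<noteq> {}" using grid_meets_support[OF \<gamma>, of t0] by (auto simp: K_def b_def)
  show False
  proof (cases "K = UNIV")
    case True
    then have bk: "b (k + 1) = R * b k" for k using R(2) by (auto simp: K_def)
    \<comment> \<open>Shift invariance of the sum forces \<open>R = 1\<close>, and a positive
      constant is not summable over the integers.\<close>
    have "infsum b UNIV = infsum (\<lambda>k. b (k + 1)) UNIV" by (rule infsum_int_shift[symmetric])
    also have "\<dots> = R * infsum b UNIV" unfolding bk by (rule infsum_cmult_right')
    finally have "infsum b UNIV = R * infsum b UNIV" .
    moreover have "infsum b UNIV > 0" using comb_one_pos[OF \<gamma>, of t0] by (simp add: comb_def b_def[abs_def])
    ultimately have "R = 1" by simp
    then have const: "b (int n) = b 0" for n
    proof (induction n)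
      case (Suc n)
      then show ?case using bk[of "int n"] \<open>R = 1\<close> by (simp add: add.commute)
    qed simp
    have b0: "b 0 > 0" using True by (auto simp: K_def)
    obtain n :: nat where n: "infsum b UNIV < of_nat n * b 0" using reals_Archimedean3[OF b0] by blast
    have "sum b (int ` {..<n}) \<le> infsum b UNIV"
      by (intro finite_sum_le_infsum sb) (use nonneg in \<open>auto simp: b_def\<close>)
    moreover have "sum b (int ` {..<n}) = of_nat n * b 0"
      by (subst sum.reindex) (auto simp: const)
    ultimately show False using n by simp
  next
    case False
    \<comment> \<open>A far point of the support and the grid point of some \<open>k\<close> in
      \<open>K\<close> enclose the grid point just outside the supposed index range.\<close>
    have unb: "\<not> K \<subseteq> {l..u}" for l u
    proof
      assume sub: "K \<subseteq> {l..u}"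
      obtain k where k: "k \<in> K" using neK by blast
      then have kb: "b k > 0" "l \<le> k" "k \<le> u" using sub by (auto simp: K_def)
      obtain x where x: "\<bar>x\<bar> > \<bar>t0 - of_int (l - 1) * \<gamma>\<bar> + \<bar>t0 - of_int (u + 1) * \<gamma>\<bar>" "g x > 0"
        using unbounded_support by blast
      have lu: "of_int (l - 1) * \<gamma> < of_int k * \<gamma>" "of_int k * \<gamma> < of_int (u + 1) * \<gamma>"
        using kb(2,3) \<gamma> by (intro mult_strict_right_mono; simp)+
      have "l - 1 \<in> K \<or> u + 1 \<in> K"
      proof (cases "x \<ge> 0")
        case True
        then have "t0 - of_int (l - 1) * \<gamma> < x" using x(1) by linarith
        then have "g (t0 - of_int (l - 1) * \<gamma>) > 0"
          using pos_between[of "t0 - of_int k * \<gamma>" x "t0 - of_int (l - 1) * \<gamma>"] kb(1) x(2) lu by (simp add: b_def)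
        then show ?thesis by (simp add: K_def b_def)
      next
        case False
        then have "x < t0 - of_int (u + 1) * \<gamma>" using x(1) by linarith
        then have "g (t0 - of_int (u + 1) * \<gamma>) > 0"
          using pos_between[of x "t0 - of_int k * \<gamma>" "t0 - of_int (u + 1) * \<gamma>"] kb(1) x(2) lu by (simp add: b_def)
        then show ?thesis by (simp add: K_def b_def)
      qed
      then show False using sub by auto
    qed
    obtain k0 where k0: "(k0 \<in> K) \<noteq> (k0 + 1 \<in> K)" "\<And>k. (k \<in> K) \<noteq> (k + 1 \<in> K) \<Longrightarrow> k = k0"
    proof -
      have "\<exists>!k. (k \<in> K) \<noteq> (k + 1 \<in> K)"
      proof (rule int_interval_boundary)
        show "j \<in> K" if "i \<in> K" "k \<in> K" "i \<le> j" "j \<le> k" for i j k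
          using conv[of i k j] that by (simp add: K_def)
      qed (fact unb, fact False)
      then show ?thesis using that by (elim ex1E) metis
    qed
    have \<phi>0: "\<phi> k = 0" if "k \<noteq> k0" for k
    proof (cases "k \<in> K")
      case True
      then have "k + 1 \<in> K" using k0(2)[of k] that by blast
      with True show ?thesis using R(2)[of k] by (simp add: \<phi>_def K_def)
    next
      case False
      then have "k + 1 \<notin> K" using k0(2)[of k] that by blast
      with False show ?thesis using bK by (simp add: \<phi>_def)
    qed
    have "(\<Sum>\<^sub>\<infinity>k. altsign k * \<phi> k) = (\<Sum>\<^sub>\<infinity>k\<in>{k0}. altsign k * \<phi> k)"
      by (rule infsum_cong_neutral) (use \<phi>0 in auto)
    then have "\<phi> k0 = 0" using S0 by simp
    moreover have "\<phi> k0 \<noteq> 0"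
    proof (cases "k0 \<in> K")
      case True
      then have "k0 + 1 \<notin> K" using k0(1) by blast
      then have "b (k0 + 1) = 0" by (rule bK)
      moreover have "b k0 > 0" using True by (simp add: K_def)
      ultimately show ?thesis using R(1) by (simp add: \<phi>_def)
    next
      case False
      then have "b k0 = 0" by (rule bK)
      moreover have "k0 + 1 \<in> K" using k0(1) False by blast
      then have "b (k0 + 1) > 0" by (simp add: K_def)
      ultimately show ?thesis by (simp add: \<phi>_def)
    qed
    ultimately show False by simp
  qed
qed

text \<open>Take \<open>z\<close> as the supremum of the points in
  \<open>[t1, t1 + \<gamma>]\<close> with positive comb. Without returns the comb is positive from
  \<open>t1\<close> to \<open>z\<close>, and beyond \<open>z\<close> it is not positive. There it is
  even negative, since two zeros are impossible and a single one would produce a return one step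
  earlier. Shifted back by \<open>\<gamma>\<close>, the negative part completes the block to the
  left of \<open>t1\<close>.\<close>

lemma altsign_comb_blocks:
  assumes \<gamma>: "\<gamma> > 0"
  shows "\<exists>z. \<forall>t. z - \<gamma> < t \<longrightarrow> t < z \<longrightarrow> comb g \<gamma> altsign t > 0"
proof -
  define F where "F = comb g \<gamma> altsign"
  have per: "F (t + \<gamma>) = - F t" "F (t - \<gamma>) = - F t" for t
    using comb_altsign_add[of \<gamma> t 1] comb_altsign_add[of \<gamma> "t - \<gamma>" 1] by (simp_all add: F_def)
  obtain t1 where t1: "F t1 > 0"
  proof -
    obtain t where "F t \<noteq> 0" using comb_altsign_nonzero[OF \<gamma>] by (auto simp: F_def)
    then have "F t > 0 \<or> F (t + \<gamma>) > 0" by (auto simp: per)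
    then show ?thesis using that by blast
  qed
  define z where "z = Sup {s. t1 \<le> s \<and> s \<le> t1 + \<gamma> \<and> F s > 0}"
  have bdd: "bdd_above {s. t1 \<le> s \<and> s \<le> t1 + \<gamma> \<and> F s > 0}" by (rule bdd_aboveI[of _ "t1 + \<gamma>"]) auto
  have t1in: "t1 \<in> {s. t1 \<le> s \<and> s \<le> t1 + \<gamma> \<and> F s > 0}" using t1 \<gamma> by simp
  have z: "t1 \<le> z" "z \<le> t1 + \<gamma>"
    unfolding z_def using cSup_upper[OF t1in bdd] t1in by (auto intro!: cSup_least)
  have pos: "F s > 0" if s: "t1 < s" "s < z" for s
  proof (rule ccontr)
    assume neg: "\<not> F s > 0"
    obtain s2 where s2: "s < s2" "t1 \<le> s2" "s2 \<le> t1 + \<gamma>" "F s2 > 0"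
      using less_cSupD[of "{s. t1 \<le> s \<and> s \<le> t1 + \<gamma> \<and> F s > 0}" s] s t1in unfolding z_def by blast
    moreover have "s2 \<noteq> t1 + \<gamma>" using s2(4) per t1 by auto
    ultimately show False
      using altsign_comb_no_return[OF \<gamma>, of t1 s s2] s neg t1 by (simp add: F_def)
  qed
  have le0: "F s \<le> 0" if "z < s" "s \<le> t1 + \<gamma>" for s
  proof (rule ccontr)
    assume "\<not> F s \<le> 0"
    then have "s \<le> z" unfolding z_def using that z by (intro cSup_upper bdd) auto
    with that show False by simp
  qed
  have one_zero: False if "t1 < s" "s < s'" "s' < t1 + \<gamma>" "F s = 0" "F s' = 0" for s s'
  proof -
    define P where "P = comb g \<gamma> (\<lambda>_. 1)"
    have P: "P t > 0" for t using comb_one_pos[OF \<gamma>] by (simp add: P_def)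
    have eq: "g (s - of_int k * \<gamma>) * P s' = g (s' - of_int k * \<gamma>) * P s" for k
      using two_zeros_proportional[OF \<gamma>, of t1 s s' k] that t1 by (simp add: F_def P_def)
    have "g (s' - of_int k * \<gamma>) = (P s' / P s) * g (s - of_int k * \<gamma>)" for k
      using eq[of k] P[of s] by (simp add: field_simps)
    then have "F s \<noteq> 0" unfolding F_def
      using proportional_rows_nonzero[OF \<gamma> \<open>s < s'\<close>, of "P s' / P s"] P by simp
    with that show False by simp
  qed
  have neg: "F s < 0" if s: "z < s" "s < t1 + \<gamma>" for s
  proof (rule ccontr)
    assume "\<not> F s < 0"
    then have Fs: "F s = 0" using le0[of s] s by simp
    \<comment> \<open>Between \<open>z\<close> and the supposed zero \<open>s\<close> the comb must
      be negative at \<open>s'\<close>. One step \<open>\<gamma>\<close> back this reads positive,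
      zero, and then positive again at \<open>t1\<close>.\<close>
    define s' where "s' = (z + s) / 2"
    have s': "z < s'" "s' < s" using s by (auto simp: s'_def)
    have "F s' \<noteq> 0" using one_zero[of s' s] s s' z Fs by auto
    then have "F s' < 0" using le0[of s'] s s' by simp
    then have "F (s' - \<gamma>) > 0" "F (s - \<gamma>) \<le> 0" using Fs by (auto simp: per)
    then show False
      using altsign_comb_no_return[OF \<gamma>, of "s' - \<gamma>" "s - \<gamma>" t1] t1 s s' z by (simp add: F_def)
  qed
  show ?thesis
  proof (intro exI[of _ z] allI impI)
    fix t assume t: "z - \<gamma> < t" "t < z"
    have "F t > 0"
    proof (cases "t = t1")
      case False
      show ?thesis
      proof (cases "t < t1")
        case True
        then have "F (t + \<gamma>) < 0" using neg[of "t + \<gamma>"] t by simp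
        then show ?thesis by (simp add: per)
      qed (use pos[of t] t False in auto)
    qed (use t1 in simp)
    then show "comb g \<gamma> altsign t > 0" by (simp add: F_def)
  qed
qed

text \<open>Adding a multiple \<open>\<tau> d\<close> of a kernel element to the alternating sequence leaves the sampled values unchanged,
  so by variation diminishing only boundedly many sign changes may get lost. Since \<open>d\<close> is recurrent,
  none is lost for any \<open>\<tau>\<close>, and \<open>d\<close> is itself a multiple of the alternating sequence.\<close>

lemma comb_kernel_trivial:
  fixes d :: "int \<Rightarrow> real"
  assumes pq: "p > 0" "p < q" and \<gamma>: "\<gamma> = of_nat q / of_nat p"
    and bounded: "\<And>k. \<bar>d k\<bar> \<le> V"
    and recurrent: "\<And>k \<eta> N. \<eta> > 0 \<Longrightarrow> \<exists>k'\<ge>N. even (k' - k) \<and> \<bar>d k' - d k\<bar> < \<eta> \<and> \<bar>d (k' + 1) - d (k + 1)\<bar> < \<eta>"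
    and kernel: "\<And>j::int. comb g \<gamma> d (x + of_int j) = 0"
  shows "d k = 0"
proof -
  have \<gamma>1: "\<gamma> > 1" using pq by (simp add: \<gamma>)
  then have \<gamma>0: "\<gamma> > 0" by simp
  define F where "F = comb g \<gamma> altsign"
  obtain z where z: "\<And>t. z - \<gamma> < t \<Longrightarrow> t < z \<Longrightarrow> F t > 0"
    using altsign_comb_blocks[OF \<gamma>0] by (auto simp: F_def)
  \<comment> \<open>\<open>r i\<close> is the first coset point strictly beyond the left end of the
    \<open>i\<close>-th block. As blocks are longer than 1, it lies inside.\<close>
  define n where "n i = \<lfloor>z - \<gamma> + of_nat i * \<gamma> - x\<rfloor> + 1" for i :: nat
  define r where "r i = x + of_int (n i)" for i
  have r: "z - \<gamma> + of_nat i * \<gamma> < r i" "r i < z + of_nat i * \<gamma>" for i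
    unfolding r_def n_def using \<gamma>1 by linarith+
  \<comment> \<open>Here the rationality of \<open>\<gamma>\<close> enters: the position of
    \<open>r i\<close> within its block is periodic in \<open>i\<close>, so the comb values there
    have a common positive lower bound \<open>\<delta>\<close>.\<close>
  have p\<gamma>: "of_nat (i + p) * \<gamma> = of_nat i * \<gamma> + of_nat q" for i
    using pq by (simp add: \<gamma> field_simps)
  have rper: "r (i + p) = r i + of_nat q" for i
  proof -
    have "z - \<gamma> + of_nat (i + p) * \<gamma> - x = (z - \<gamma> + of_nat i * \<gamma> - x) + of_int (int q)"
      unfolding p\<gamma> by simp
    then have "n (i + p) = n i + int q" unfolding n_def by (metis floor_add_int add.commute add.left_commute)
    then show ?thesis by (simp add: r_def)
  qed
  have Fr: "F (r i) = (-1)^i * F (r i - of_nat i * \<gamma>)" for i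
    using comb_altsign_add[of \<gamma> "r i - of_nat i * \<gamma>" i] by (simp add: F_def)
  define f where "f i = F (r i - of_nat i * \<gamma>)" for i
  have fpos: "f i > 0" for i unfolding f_def using r[of i] by (intro z) auto
  have fper: "f (i + p) = f i" for i
    unfolding f_def rper p\<gamma> by simp
  have fmod: "f i = f (i mod p)" for i
  proof -
    have "f (j + m * p) = f j" for j m
    proof (induction m)
      case (Suc m)
      then show ?case using fper[of "j + m * p"] by (simp add: add_ac)
    qed simp
    from this[of "i mod p" "i div p"] show ?thesis by simp
  qed
  define \<delta> where "\<delta> = Min (f ` {..<p})"
  have "\<delta> \<in> f ` {..<p}" unfolding \<delta>_def using pq by (intro Min_in) auto
  then have \<delta>: "\<delta> > 0" using fpos by auto
  have \<delta>f: "\<delta> \<le> f i" for i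
    unfolding fmod[of i] \<delta>_def using pq by (intro Min_le) auto
  define e where "e k = altsign k * d k" for k
  have const: "e (k + 1) = e k" for k
  proof (rule ccontr)
    assume ne: "e (k + 1) \<noteq> e k"
    \<comment> \<open>Opposite signs of the two factors mean that
      \<open>altsign + \<tau> * d\<close> has equal signs at \<open>k\<close> and
      \<open>k + 1\<close>. If the sum \<open>s\<close> of the two values of \<open>e\<close> is
      nonzero, \<open>- 2 / s\<close> makes the factors negatives of each other; if it is zero,
      \<open>2 / e k\<close> makes them 3 and -1.\<close>
    obtain \<tau> where \<tau>: "(1 + \<tau> * e k) * (1 + \<tau> * e (k + 1)) < 0"
    proof (cases "e k + e (k + 1) = 0")
      case True
      then have "e k \<noteq> 0" "e (k + 1) = - e k" using ne by auto
      then have "(1 + 2 / e k * e k) * (1 + 2 / e k * e (k + 1)) < 0" by simp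
      then show ?thesis by (rule that)
    next
      case False
      define s where "s = e k + e (k + 1)"
      have "(1 + - 2 / s * e k) * (1 + - 2 / s * e (k + 1)) = - (((e k - e (k + 1)) / s)\<^sup>2)"
        using False by (simp add: s_def power2_eq_square divide_simps) (simp add: algebra_simps)
      also have "\<dots> < 0" using ne False by (simp add: s_def)
      finally show ?thesis by (rule that)
    qed
    define v where "v k = altsign k + \<tau> * d k" for k
    have vd: "v k * v (k + 1) = - ((1 + \<tau> * e k) * (1 + \<tau> * e (k + 1)))" for k
      by (simp add: v_def e_def altsign_def algebra_simps)
    have vk: "v k * v (k + 1) > 0" using \<tau> by (simp add: vd)
    define Vb where "Vb = 1 + \<bar>\<tau>\<bar> * V"
    have vb: "\<bar>v k\<bar> \<le> Vb" for k
    proof -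
      have "\<bar>v k\<bar> \<le> \<bar>altsign k\<bar> + \<bar>\<tau> * d k\<bar>" unfolding v_def by (rule abs_triangle_ineq)
      also have "\<dots> \<le> 1 + \<bar>\<tau>\<bar> * V" using bounded by (auto simp: abs_mult intro: mult_left_mono)
      finally show ?thesis by (simp add: Vb_def)
    qed
    obtain m where m: "\<And>(D::nat) n t v T. strict_mono_on {..<n} t \<Longrightarrow> (\<forall>i<n. t i \<in> {z - \<gamma>..z - \<gamma> + of_nat D * \<gamma>}) \<Longrightarrow>
       (\<forall>k. \<bar>v k\<bar> \<le> Vb) \<Longrightarrow> (\<forall>i<n. (-1)^i * comb g \<gamma> v (t i) \<ge> \<delta>) \<Longrightarrow>
       T \<subseteq> {0..<int D} \<Longrightarrow> (\<forall>k\<in>T. v k * v (k + 1) > 0) \<Longrightarrow> n + card T \<le> D + m"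
      using comb_variation_diminishing[OF \<gamma>0 \<delta>, of "z - \<gamma>" Vb] by metis
    define S where "S = {k. k \<ge> 0 \<and> v k * v (k + 1) > 0}"
    \<comment> \<open>The sign condition is open in the two entries of \<open>d\<close>, so it
      recurs with them arbitrarily far out, at indices of the same parity as
      \<open>k\<close>.\<close>
    have infS: "infinite S"
    proof
      assume fin: "finite S"
      have tl: "((\<lambda>y. (altsign k + \<tau> * fst y) * (altsign (k + 1) + \<tau> * snd y)) \<longlongrightarrow> v k * v (k + 1)) (nhds (d k, d (k + 1)))"
        unfolding v_def by (intro tendsto_intros) (auto intro!: tendsto_eq_intros filterlim_ident)
      then have "\<forall>\<^sub>F y in nhds (d k, d (k + 1)). (altsign k + \<tau> * fst y) * (altsign (k + 1) + \<tau> * snd y) > 0"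
        using vk by (rule order_tendstoD)
      then obtain \<eta> where \<eta>: "\<eta> > 0" "\<And>y. dist y (d k, d (k + 1)) < \<eta> \<Longrightarrow> (altsign k + \<tau> * fst y) * (altsign (k + 1) + \<tau> * snd y) > 0"
        unfolding eventually_nhds_metric by blast
      define N where "N = Max (insert 0 S) + 1"
      have N: "N \<ge> 0" "\<And>s. s \<in> S \<Longrightarrow> s < N" using fin by (auto simp: N_def intro: le_imp_less_Suc add_nonneg_nonneg Max_ge order_le_less_trans[OF Max_ge])
      obtain k' where k': "k' \<ge> N" "even (k' - k)" "\<bar>d k' - d k\<bar> < \<eta>/2" "\<bar>d (k' + 1) - d (k + 1)\<bar> < \<eta>/2"
        using recurrent[of "\<eta>/2" N k] \<eta>(1) by auto
      have "dist (d k', d (k' + 1)) (d k, d (k + 1)) \<le> \<bar>d k' - d k\<bar> + \<bar>d (k' + 1) - d (k + 1)\<bar>"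
        by (simp add: dist_Pair_Pair dist_real_def sqrt_sum_squares_le_sum_abs)
      also have "\<dots> < \<eta>" using k' by simp
      finally have "(altsign k + \<tau> * d k') * (altsign (k + 1) + \<tau> * d (k' + 1)) > 0" using \<eta>(2) by fastforce
      moreover have "altsign k' = altsign k" using altsign_add_even[OF k'(2), of k] by simp
      ultimately have "v k' * v (k' + 1) > 0" by (simp add: v_def)
      then have "k' \<in> S" using k' N by (simp add: S_def)
      then show False using N(2)[of k'] k'(1) by simp
    qed
    then obtain T where T: "T \<subseteq> S" "finite T" "card T = Suc m"
      using infinite_arbitrarily_large by blast
    define D where "D = nat (Max T) + 1"
    \<comment> \<open>The window holds \<open>D\<close> coefficients and \<open>D\<close> blocks,
      hence \<open>D\<close> alternations; at most \<open>m\<close> equal-sign pairs would fit, but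
      \<open>T\<close> has one more.\<close>
    have "D + card T \<le> D + m"
    proof (rule m)
      show "strict_mono_on {..<D} r"
      proof (rule strict_mono_onI)
        fix i j assume "i < (j::nat)"
        then have "(of_nat i + 1) * \<gamma> \<le> of_nat j * \<gamma>" using \<gamma>0 by (intro mult_right_mono) auto
        then show "r i < r j" using r[of i] r[of j] by (simp add: distrib_right)
      qed
      show "\<forall>i<D. r i \<in> {z - \<gamma>..z - \<gamma> + of_nat D * \<gamma>}"
      proof (intro allI impI)
        fix i assume "i < D"
        then have "(of_nat i + 1) * \<gamma> \<le> of_nat D * \<gamma>" using \<gamma>0 by (intro mult_right_mono) auto
        then have "r i \<le> z - \<gamma> + of_nat D * \<gamma>" using r[of i] by (simp add: distrib_right)
        moreover have "0 \<le> of_nat i * \<gamma>" using \<gamma>0 by simp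
        then have "z - \<gamma> \<le> r i" using r[of i] by linarith
        ultimately show "r i \<in> {z - \<gamma>..z - \<gamma> + of_nat D * \<gamma>}" by simp
      qed
      show "\<forall>k. \<bar>v k\<bar> \<le> Vb" using vb by blast
      show "\<forall>i<D. \<delta> \<le> (-1)^i * comb g \<gamma> v (r i)"
      proof (intro allI impI)
        fix i
        have "comb g \<gamma> v (r i) = F (r i) + \<tau> * comb g \<gamma> d (r i)"
          unfolding v_def F_def by (rule comb_add[where V = 1 and V' = V]) (use \<gamma>0 bounded in auto)
        also have "\<dots> = F (r i)" using kernel by (simp add: r_def)
        finally have "(-1)^i * comb g \<gamma> v (r i) = f i"
          using Fr[of i] by (cases "even i") (simp_all add: f_def)
        then show "\<delta> \<le> (-1)^i * comb g \<gamma> v (r i)" using \<delta>f by simp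
      qed
      show "T \<subseteq> {0..<int D}"
      proof
        fix k assume "k \<in> T"
        then have "0 \<le> k" "k \<le> Max T" using T by (auto simp: S_def)
        then show "k \<in> {0..<int D}" by (simp add: D_def)
      qed
      show "\<forall>k\<in>T. v k * v (k + 1) > 0" using T(1) by (auto simp: S_def)
    qed
    then show False using T(3) by simp
  qed
  have e0: "e k = e 0" for k
  proof (induction k rule: int_induct[of _ 0])
    case (step1 i)
    then show ?case using const[of i] by simp
  next
    case (step2 i)
    then show ?case using const[of "i - 1"] by simp
  qed simp
  have d: "d k = e 0 * altsign k" for k
  proof -
    have "altsign k * e k = d k" by (simp add: e_def mult.assoc[symmetric])
    then show ?thesis using e0[of k] by (simp add: mult.commute)
  qed
  have "comb g \<gamma> (\<lambda>k. e 0 * altsign k) (r 0) = 0" using kernel[of "n 0"] by (simp add: r_def d[abs_def])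
  then have "e 0 * F (r 0) = 0" unfolding comb_cmult by (simp add: F_def)
  moreover have "F (r 0) \<noteq> 0" using fpos[of 0] by (simp add: f_def)
  ultimately show ?thesis by (simp add: d)
qed

end

section \<open>Decay and limits of translates\<close>

text \<open>By log-concavity \<open>g u * g w\<close> is at most \<open>g x * g (u + w - x)\<close>,
  hence at most the mean of the two squares. Integrate over \<open>x\<close> in
  \<open>[u, w]\<close>; reflection gives both squares the same integral.\<close>

lemma (in tp_function) product_le_square_integral:
  assumes int: "integrable lebesgue (\<lambda>t. (g t)\<^sup>2)" and "u < w"
  shows "g u * g w * (w - u) \<le> (LINT t|lebesgue. (g t)\<^sup>2)"
proof -
  define f where "f t = (g t)\<^sup>2" for t
  have f: "f absolutely_integrable_on UNIV" using int by (simp add: set_integrable_def f_def)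
  have fab: "f integrable_on {u..w}" "f integrable_on UNIV"
    using set_integrable_subset[OF f, of "{u..w}"] f by (auto intro: set_lebesgue_integral_eq_integral(1))
  define J where "J = integral {u..w} f"
  have J: "(f has_integral J) (cbox u w)" using fab(1) by (simp add: J_def has_integral_integral)
  have "(\<lambda>x. (1 / - 1) *\<^sub>R x + - ((1 / - 1) *\<^sub>R (u + w))) ` cbox u w = cbox u w"
    by (auto simp: image_iff intro!: bexI[of _ "u + w - _"])
  then have J': "((\<lambda>x. f (u + w - x)) has_integral J) (cbox u w)"
    using has_integral_affinity[OF J, of "-1" "u + w"] by simp
  have upper: "((\<lambda>x. (f x + f (u + w - x)) / 2) has_integral ((J + J) / 2)) (cbox u w)"
    using has_integral_add[OF J J'] by (rule has_integral_divide)
  have lower: "((\<lambda>x. g u * g w) has_integral (g u * g w * (w - u))) (cbox u w)"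
    using has_integral_const_real[of "g u * g w" u w] \<open>u < w\<close> by (simp add: mult.commute)
  have "g u * g w \<le> (f x + f (u + w - x)) / 2" if "x \<in> cbox u w" for x
  proof -
    have "g u * g w \<le> g x * g (u + w - x)"
    proof (cases "x = u \<or> x = w")
      case False
      then show ?thesis using that by (intro tp2) auto
    qed (auto simp: mult.commute)
    also have "\<dots> \<le> (f x + f (u + w - x)) / 2"
      using sum_squares_bound[of "g x" "g (u + w - x)"] by (simp add: f_def)
    finally show ?thesis .
  qed
  then have "g u * g w * (w - u) \<le> (J + J) / 2" by (rule has_integral_le[OF lower upper])
  also have "(J + J) / 2 \<le> integral UNIV f"
    using integral_subset_le[OF _ fab, of] by (simp add: J_def f_def)
  also have "\<dots> = (LINT t|lebesgue. f t)"
    using set_lebesgue_integral_eq_integral(2)[OF f] by (simp add: set_lebesgue_integral_def)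
  finally show ?thesis by (simp add: f_def)
qed

lemma half_powers_le_exp:
  fixes \<Delta> x :: real
  assumes "\<Delta> > 0" "x \<ge> 0"
  shows "(1/2) ^ nat \<lfloor>x / \<Delta>\<rfloor> \<le> 2 * exp (- (ln 2 / \<Delta>) * x)"
proof -
  have "x / \<Delta> < of_nat (nat \<lfloor>x / \<Delta>\<rfloor>) + 1"
  proof -
    have "0 \<le> x / \<Delta>" using assms by simp
    then have "real (nat \<lfloor>x / \<Delta>\<rfloor>) = of_int \<lfloor>x / \<Delta>\<rfloor>" by simp
    then show ?thesis by linarith
  qed
  then have "ln 2 * (x / \<Delta>) \<le> ln 2 * (of_nat (nat \<lfloor>x / \<Delta>\<rfloor>) + 1)" by (intro mult_left_mono) auto
  then have "exp (- (ln 2 * (of_nat (nat \<lfloor>x / \<Delta>\<rfloor>) + 1))) \<le> exp (- (ln 2 / \<Delta>) * x)" by simp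
  moreover have "exp (- (ln 2 * (of_nat n + 1))) = (1/2) ^ n / (2::real)" for n :: nat
  proof (induction n)
    case (Suc n)
    have "exp (- (ln 2 * (of_nat (Suc n) + 1))) = exp (- (ln 2 * (of_nat n + 1))) * exp (- ln (2::real))"
      by (simp add: exp_add[symmetric] algebra_simps)
    then show ?case using Suc by (simp add: exp_minus)
  qed (simp add: exp_minus)
  ultimately show ?thesis by simp
qed

text \<open>The bound \<open>g u g w |w - u| \<le> \<parallel>g\<parallel>\<^sup>2\<close> makes \<open>g\<close> bounded and halves it after some step; the ratio
  \<open>g (s + \<Delta>) / g s\<close> being antitone, it keeps halving.\<close>

lemma tp_decay_exists:
  assumes "tp_function g" and int: "integrable lebesgue (\<lambda>t. (g t)\<^sup>2)"
    and I: "(LINT t|lebesgue. (g t)\<^sup>2) = I" "I > 0"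
  shows "\<exists>C a. tp_decay g C a"
proof -
  interpret tp_function g by fact
  have two: "\<exists>s t. s < t \<and> g s > 0 \<and> g t > 0"
  proof (rule ccontr)
    assume neg: "\<not> ?thesis"
    have "AE t in lebesgue. (g t)\<^sup>2 = 0"
    proof (cases "\<exists>s. g s > 0")
      case True
      then obtain s where s: "g s > 0" by blast
      have "g t = 0" if "t \<noteq> s" for t
        using neg s that nonneg[of t] by (metis linorder_neqE order_le_less)
      then have "{t. (g t)\<^sup>2 \<noteq> 0} \<subseteq> {s}" by auto
      moreover have "{s} \<in> null_sets lebesgue" by (intro null_sets_completionI finite_imp_null_set_lborel) simp
      ultimately show ?thesis by (intro AE_I') auto
    next
      case False
      then have "g t = 0" for t using nonneg[of t] by (metis order_le_less)
      then show ?thesis by simp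
    qed
    then have "I = 0" unfolding I(1)[symmetric] by (rule integral_eq_zero_AE)
    with I(2) show False by simp
  qed
  then obtain a0 a1 where a01: "a0 < a1" "g a0 > 0" "g a1 > 0" by blast
  have dist: "g u * g w * \<bar>w - u\<bar> \<le> I" for u w
    using product_le_square_integral[OF int, of u w] product_le_square_integral[OF int, of w u] I
    by (cases u w rule: linorder_cases) (auto simp: mult_ac)
  \<comment> \<open>Every point has distance at least \<open>\<eta>\<close> from \<open>a0\<close>
    or from \<open>a1\<close>. The product bound against that point gives the uniform bound
    \<open>M\<close>.\<close>
  define \<eta> where "\<eta> = (a1 - a0) / 2"
  define M where "M = I / (g a0 * \<eta>) + I / (g a1 * \<eta>)"
  have \<eta>: "\<eta> > 0" using a01 by (simp add: \<eta>_def)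
  have M: "g t \<le> M" for t
  proof -
    have bound: "g t \<le> I / (g u * \<eta>)" if "g u > 0" "\<bar>t - u\<bar> \<ge> \<eta>" for u
    proof -
      have "g u * g t * \<eta> \<le> g u * g t * \<bar>t - u\<bar>" using that nonneg by (intro mult_left_mono) auto
      also have "\<dots> \<le> I" by (rule dist)
      finally show ?thesis using that \<eta> by (simp add: field_simps)
    qed
    have "\<bar>t - a0\<bar> \<ge> \<eta> \<or> \<bar>t - a1\<bar> \<ge> \<eta>"
    proof (rule ccontr)
      assume "\<not> ?thesis"
      then have "\<bar>t - a0\<bar> < \<eta>" "\<bar>t - a1\<bar> < \<eta>" by auto
      moreover have "t - a0 \<le> \<bar>t - a0\<bar>" "a1 - t \<le> \<bar>t - a1\<bar>" by simp_all
      moreover have "2 * \<eta> = a1 - a0" by (simp add: \<eta>_def)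
      ultimately show False by linarith
    qed
    moreover have "I / (g a0 * \<eta>) \<ge> 0" "I / (g a1 * \<eta>) \<ge> 0" using a01 \<eta> I by auto
    ultimately show ?thesis using bound[of a0] bound[of a1] a01 by (auto simp: M_def)
  qed
  have M0: "M > 0" using M[of a0] a01 by simp
  \<comment> \<open>At distance \<open>\<Delta>\<close> from \<open>a0\<close> the product bound
    reads exactly \<open>g t \<le> g a0 / 2\<close>.\<close>
  define \<Delta> where "\<Delta> = 2 * I / (g a0)\<^sup>2"
  have \<Delta>: "\<Delta> > 0" using I a01 by (simp add: \<Delta>_def)
  have half: "g (a0 + \<Delta>) \<le> g a0 / 2" "g (a0 - \<Delta>) \<le> g a0 / 2"
  proof -
    have "g a0 * g t * \<Delta> \<le> I" if "\<bar>t - a0\<bar> = \<Delta>" for t using dist[of a0 t] that by simp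
    then have "g t \<le> g a0 / 2" if "\<bar>t - a0\<bar> = \<Delta>" for t
      using that I a01 by (simp add: \<Delta>_def field_simps power2_eq_square)
    then show "g (a0 + \<Delta>) \<le> g a0 / 2" "g (a0 - \<Delta>) \<le> g a0 / 2" using \<Delta> by auto
  qed
  have step_right: "g (s + \<Delta>) \<le> g s / 2" if "s \<ge> a0" for s
  proof -
    have "g a0 * g (s + \<Delta>) \<le> g (a0 + \<Delta>) * g s" using that \<Delta> by (intro ratio_antimono) auto
    also have "\<dots> \<le> g a0 / 2 * g s" using half nonneg by (intro mult_right_mono) auto
    finally show ?thesis using a01 by simp
  qed
  have step_left: "g (s - \<Delta>) \<le> g s / 2" if "s \<le> a0" for s
  proof -
    have "g (s - \<Delta>) * g (a0 - \<Delta> + \<Delta>) \<le> g (s - \<Delta> + \<Delta>) * g (a0 - \<Delta>)" using that \<Delta> by (intro ratio_antimono) auto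
    also have "s - \<Delta> + \<Delta> = s" by simp
    also have "g s * g (a0 - \<Delta>) \<le> g s * (g a0 / 2)" using half nonneg by (intro mult_left_mono) auto
    finally show ?thesis using a01 by simp
  qed
  have iter: "g (a0 + r + of_nat n * \<Delta>) \<le> (1/2)^n * M" "g (a0 - r - of_nat n * \<Delta>) \<le> (1/2)^n * M" if "r \<ge> 0" for r n
  proof (induction n)
    case (Suc n)
    have nn: "0 \<le> of_nat n * \<Delta>" using \<Delta> by simp
    case 1
    have "g (a0 + r + of_nat n * \<Delta> + \<Delta>) \<le> g (a0 + r + of_nat n * \<Delta>) / 2"
      by (rule step_right) (use that nn in simp)
    with Suc(1) show ?case by (simp add: algebra_simps)
    case 2
    have "g (a0 - r - of_nat n * \<Delta> - \<Delta>) \<le> g (a0 - r - of_nat n * \<Delta>) / 2"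
      by (rule step_left) (use that nn in simp)
    with Suc(2) show ?case by (simp add: algebra_simps)
  qed (use M in auto)
  define \<kappa> where "\<kappa> = ln 2 / \<Delta>"
  have \<kappa>: "\<kappa> > 0" using \<Delta> by (simp add: \<kappa>_def)
  have "g t \<le> (2 * M * exp (\<kappa> * \<bar>a0\<bar>)) * exp (- \<kappa> * \<bar>t\<bar>)" for t
  proof -
    define n r where "n = nat \<lfloor>\<bar>t - a0\<bar> / \<Delta>\<rfloor>" and "r = \<bar>t - a0\<bar> - of_nat n * \<Delta>"
    have "of_nat n \<le> \<bar>t - a0\<bar> / \<Delta>" using \<Delta> by (simp add: n_def)
    then have r: "r \<ge> 0" using \<Delta> by (simp add: r_def field_simps)
    have "t = a0 + r + of_nat n * \<Delta> \<or> t = a0 - r - of_nat n * \<Delta>" by (auto simp: r_def abs_if)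
    then have "g t \<le> (1/2)^n * M" using iter[OF r, of n] by metis
    also have "\<dots> \<le> (2 * exp (- \<kappa> * \<bar>t - a0\<bar>)) * M"
      unfolding n_def \<kappa>_def using M0 \<Delta> by (intro mult_right_mono half_powers_le_exp) auto
    also have "\<kappa> * \<bar>t\<bar> \<le> \<kappa> * (\<bar>a0\<bar> + \<bar>t - a0\<bar>)" using \<kappa> by (intro mult_left_mono) auto
    then have "exp (- \<kappa> * \<bar>t - a0\<bar>) \<le> exp (\<kappa> * \<bar>a0\<bar> + - \<kappa> * \<bar>t\<bar>)" by (simp add: algebra_simps)
    then have "(2 * exp (- \<kappa> * \<bar>t - a0\<bar>)) * M \<le> (2 * exp (\<kappa> * \<bar>a0\<bar> + - \<kappa> * \<bar>t\<bar>)) * M"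
      using M0 by (intro mult_right_mono mult_left_mono) auto
    finally show ?thesis unfolding exp_add by (simp add: mult_ac)
  qed
  then have "tp_decay g (2 * M * exp (\<kappa> * \<bar>a0\<bar>)) \<kappa>" by unfold_locales (use \<kappa> two in auto)
  then show ?thesis by blast
qed

section \<open>Continuity in the interior of the support\<close>

context tp_decay begin

lemma bounded: "g t \<le> C"
proof -
  have "exp (- a * \<bar>t\<bar>) \<le> 1" using a_pos by simp
  then have "C * exp (- a * \<bar>t\<bar>) \<le> C * 1" using C_pos by (intro mult_left_mono) auto
  with decay[of t] show ?thesis by simp
qed

lemma lower_bound_between:
  assumes "u \<le> t" "t \<le> w"
  shows "g u * g w \<le> C * g t"
proof (cases "t = u \<or> t = w")
  case True
  have "g u * g w \<le> g u * C" "g w * g u \<le> g w * C" using bounded nonneg by (auto intro: mult_left_mono)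
  with True show ?thesis by (auto simp: mult.commute)
next
  case False
  then have "g u * g w \<le> g t * g (u + w - t)" using assms by (intro tp2) auto
  also have "\<dots> \<le> g t * C" using bounded nonneg by (intro mult_left_mono) auto
  finally show ?thesis by (simp add: mult.commute)
qed

text \<open>Along an arithmetic progression the successive ratios do not increase, so
  \<open>n\<close> steps multiply by at most the \<open>n\<close>-th power of the first ratio. The
  step \<open>\<eta>\<close> may be negative, whence the ordering by \<open>min\<close> and
  \<open>max\<close>.\<close>

lemma progression_power:
  "g (t + of_nat n * \<eta>) * g t ^ n \<le> g (t + \<eta>) ^ n * g t"
proof (induction n)
  case (Suc n)
  have step: "g t * g (t + of_nat (Suc n) * \<eta>) \<le> g (t + \<eta>) * g (t + of_nat n * \<eta>)"
  proof (cases "n = 0 \<or> \<eta> = 0")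
    case False
    define x y where "x = min t (t + of_nat (Suc n) * \<eta>)" and "y = max t (t + of_nat (Suc n) * \<eta>)"
    have "g x * g y \<le> g (t + \<eta>) * g (t + of_nat n * \<eta>)"
    proof (rule tp2)
      have "0 < of_nat n * \<eta> \<or> of_nat n * \<eta> < 0" using False by (auto simp: mult_less_0_iff zero_less_mult_iff)
      then show "x < t + \<eta>" "t + \<eta> < y" using False
        by (auto simp: x_def y_def distrib_right min_less_iff_disj less_max_iff_disj zero_less_mult_iff mult_less_0_iff)
      show "t + \<eta> + (t + of_nat n * \<eta>) = x + y" by (auto simp: x_def y_def min_def max_def algebra_simps)
    qed
    moreover have "g x * g y = g t * g (t + of_nat (Suc n) * \<eta>)" by (auto simp: x_def y_def min_def max_def)
    ultimately show ?thesis by simp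
  qed (auto simp: mult.commute)
  have "g (t + of_nat (Suc n) * \<eta>) * g t ^ Suc n = (g t * g (t + of_nat (Suc n) * \<eta>)) * g t ^ n" by simp
  also have "\<dots> \<le> (g (t + \<eta>) * g (t + of_nat n * \<eta>)) * g t ^ n" using step nonneg by (intro mult_right_mono) auto
  also have "\<dots> = g (t + \<eta>) * (g (t + of_nat n * \<eta>) * g t ^ n)" by simp
  also have "\<dots> \<le> g (t + \<eta>) * (g (t + \<eta>) ^ n * g t)" using Suc nonneg by (intro mult_left_mono) auto
  finally show ?case by simp
qed simp

text \<open>On \<open>[t - r, t + r]\<close> values lie between \<open>\<kappa> * C\<close> and
  \<open>C\<close>, so \<open>n\<close> steps lose at most the factor \<open>\<kappa>\<close>. By
  log-concavity a single step then loses at most the factor \<open>root n \<kappa>\<close>, which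
  tends to 1. Applied from \<open>t\<close> to a nearby point and back, this is continuity.\<close>

lemma isCont_interior:
  assumes r: "r > 0" and pos: "g (t - r) > 0" "g (t + r) > 0"
  shows "isCont g t"
proof -
  define \<kappa> where "\<kappa> = g (t - r) * g (t + r) / C / C"
  have \<kappa>0: "\<kappa> > 0" using pos C_pos by (simp add: \<kappa>_def)
  have low: "\<kappa> * C \<le> g s" if "t - r \<le> s" "s \<le> t + r" for s
    using lower_bound_between[OF that] C_pos by (simp add: \<kappa>_def field_simps)
  have gs: "g s > 0" if "t - r \<le> s" "s \<le> t + r" for s
    using low[OF that] \<kappa>0 C_pos by (meson less_le_trans mult_pos_pos)
  have ratio: "root n \<kappa> * g s \<le> g (s + \<eta>)"
    if "n > 0" "t - r \<le> s" "s \<le> t + r" "t - r \<le> s + of_nat n * \<eta>" "s + of_nat n * \<eta> \<le> t + r" for n s \<eta>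
  proof -
    have "\<kappa> * g s ^ n * g s \<le> \<kappa> * g s ^ n * C"
      using bounded[of s] nonneg[of s] \<kappa>0 by (intro mult_left_mono) auto
    also have "\<dots> = (\<kappa> * C) * g s ^ n" by simp
    also have "\<dots> \<le> g (s + of_nat n * \<eta>) * g s ^ n" using low that nonneg by (intro mult_right_mono) auto
    also have "\<dots> \<le> g (s + \<eta>) ^ n * g s" by (rule progression_power)
    finally have "\<kappa> * g s ^ n \<le> g (s + \<eta>) ^ n" using gs[OF that(2,3)] by simp
    then have "root n (\<kappa> * g s ^ n) \<le> root n (g (s + \<eta>) ^ n)" by (rule real_root_le_mono[OF \<open>n > 0\<close>])
    then show ?thesis using \<open>n > 0\<close> nonneg by (simp add: real_root_mult real_root_power_cancel)
  qed
  have rt: "(\<lambda>n. root n \<kappa>) \<longlonglongrightarrow> 1" by (rule LIMSEQ_root_const[OF \<kappa>0])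
  show ?thesis
    unfolding isCont_def LIM_def
  proof (intro allI impI)
    fix e :: real assume e: "e > 0"
    have "\<forall>\<^sub>F n in sequentially. n > 0 \<and> (1 - root n \<kappa>) * g t < e \<and> g t / root n \<kappa> - g t < e"
    proof (intro eventually_conj eventually_gt_at_top)
      have "(\<lambda>n. (1 - root n \<kappa>) * g t) \<longlonglongrightarrow> (1 - 1) * g t" by (intro tendsto_intros rt)
      then show "\<forall>\<^sub>F n in sequentially. (1 - root n \<kappa>) * g t < e" using e order_tendstoD(2)[of _ "(1 - 1) * g t" _ e] by simp
      have "(\<lambda>n. g t / root n \<kappa> - g t) \<longlonglongrightarrow> g t / 1 - g t" by (intro tendsto_intros rt) simp
      then show "\<forall>\<^sub>F n in sequentially. g t / root n \<kappa> - g t < e" using e order_tendstoD(2)[of _ "g t / 1 - g t" _ e] by simp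
    qed
    then obtain n where n: "n > 0" "(1 - root n \<kappa>) * g t < e" "g t / root n \<kappa> - g t < e"
      by (metis (no_types, lifting) eventually_happens trivial_limit_sequentially)
    show "\<exists>s>0. \<forall>x. x \<noteq> t \<and> dist x t < s \<longrightarrow> dist (g x) (g t) < e"
    proof (intro exI[of _ "r / of_nat n"] conjI allI impI)
      show "0 < r / of_nat n" using r n by simp
      fix x assume "x \<noteq> t \<and> dist x t < r / of_nat n"
      then have x: "of_nat n * \<bar>x - t\<bar> < r" using n(1) by (simp add: dist_real_def field_simps)
      have nx: "\<bar>x - t\<bar> \<le> of_nat n * \<bar>x - t\<bar>" using n(1) by (cases "x = t") auto
      have nabs: "\<bar>of_nat n * (x - t)\<bar> < r" using x by (simp add: abs_mult)
      have "root n \<kappa> * g t \<le> g (t + (x - t))"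
        using nabs r n(1) by (intro ratio) (auto simp: abs_less_iff)
      moreover have "root n \<kappa> * g x \<le> g (x + (t - x))"
      proof (rule ratio[OF n(1)])
        have "\<bar>x - t\<bar> < r" using nx x by simp
        then show "t - r \<le> x" "x \<le> t + r" by auto
        have "of_nat n * (t - x) = - (of_nat n * (x - t))" by (simp add: algebra_simps)
        moreover have "\<bar>(x - t) - of_nat n * (x - t)\<bar> \<le> of_nat n * \<bar>x - t\<bar>"
        proof -
          have "(x - t) - of_nat n * (x - t) = - (of_nat (n - 1) * (x - t))" using n(1) by (simp add: of_nat_diff algebra_simps)
          then have "\<bar>(x - t) - of_nat n * (x - t)\<bar> = of_nat (n - 1) * \<bar>x - t\<bar>" by (simp add: abs_mult)
          also have "\<dots> \<le> of_nat n * \<bar>x - t\<bar>" by (intro mult_right_mono) auto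
          finally show ?thesis .
        qed
        ultimately show "t - r \<le> x + of_nat n * (t - x)" "x + of_nat n * (t - x) \<le> t + r"
          using x by (auto simp: abs_le_iff)
      qed
      moreover have "root n \<kappa> > 0" using n(1) \<kappa>0 by simp
      ultimately have "g x \<le> g t / root n \<kappa>" "root n \<kappa> * g t \<le> g x" by (simp_all add: field_simps)
      then show "dist (g x) (g t) < e" using n(2,3) by (simp add: dist_real_def abs_less_iff algebra_simps)
    qed
  qed
qed

text \<open>Near a discontinuity there is support. With three discontinuities the middle one would
  have support on both sides and be an interior point, so there are at most two.\<close>

lemma finite_discontinuities: "finite {t. \<not> isCont g t}"
proof -
  have near: "\<exists>s. \<bar>s - t\<bar> < e \<and> g s > 0" if "\<not> isCont g t" "e > 0" for t e
  proof (rule ccontr)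
    assume "\<not> ?thesis"
    then have "g s = 0" if "dist s t < e" for s using that nonneg[of s] by (force simp: dist_real_def)
    then have "\<forall>\<^sub>F s in nhds t. g s = 0" unfolding eventually_nhds_metric using that by blast
    then have "isCont g t = isCont (\<lambda>_. 0 :: real) t" by (rule isCont_cong)
    with that show False by simp
  qed
  have no3: False if d: "\<not> isCont g t1" "\<not> isCont g t2" "\<not> isCont g t3" "t1 < t2" "t2 < t3" for t1 t2 t3
  proof -
    obtain s1 where s1: "\<bar>s1 - t1\<bar> < t2 - t1" "g s1 > 0" using near[of t1 "t2 - t1"] d by auto
    obtain s3 where s3: "\<bar>s3 - t3\<bar> < t3 - t2" "g s3 > 0" using near[of t3 "t3 - t2"] d by auto
    have s: "s1 < t2" "t2 < s3" using s1 s3 by auto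
    define r where "r = min (t2 - s1) (s3 - t2) / 2"
    have r: "r > 0" "s1 < t2 - r" "t2 - r < s3" "s1 < t2 + r" "t2 + r < s3" using s by (auto simp: r_def min_def field_simps)
    have "g (t2 - r) > 0" "g (t2 + r) > 0" using pos_between[OF s1(2) s3(2)] r by blast+
    then have "isCont g t2" using r(1) isCont_interior by blast
    with d show False by simp
  qed
  show ?thesis
  proof (cases "\<exists>t1 t2. t1 < t2 \<and> \<not> isCont g t1 \<and> \<not> isCont g t2")
    case True
    then obtain t1 t2 where t: "t1 < t2" "\<not> isCont g t1" "\<not> isCont g t2" by blast
    have "{t. \<not> isCont g t} \<subseteq> {t1, t2}"
    proof
      fix x assume "x \<in> {t. \<not> isCont g t}"
      then show "x \<in> {t1, t2}" using no3[of x t1 t2] no3[of t1 x t2] no3[of t1 t2 x] t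
        by (cases x t1 rule: linorder_cases; cases x t2 rule: linorder_cases) auto
    qed
    then show ?thesis by (rule finite_subset) simp
  next
    case False
    show ?thesis
    proof (cases "\<exists>x. \<not> isCont g x")
      case True
      then obtain x where x: "\<not> isCont g x" by blast
      have "{t. \<not> isCont g t} \<subseteq> {x}" using False x by (metis (mono_tags, lifting) linorder_neqE mem_Collect_eq singletonI subsetI)
      then show ?thesis by (rule finite_subset) simp
    qed simp
  qed
qed

end

section \<open>Limits of translates\<close>

lemma finite_diagonal_subsequence:
  fixes f :: "nat \<Rightarrow> 'i \<Rightarrow> 'a::heine_borel"
  assumes "finite I" "\<And>i. i \<in> I \<Longrightarrow> bounded (range (\<lambda>n. f n i))"
  shows "\<exists>r::nat \<Rightarrow> nat. strict_mono r \<and> (\<forall>i\<in>I. convergent (\<lambda>n. f (r n) i))"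
  using assms
proof (induction I rule: finite_induct)
  case empty
  show ?case by (intro exI[of _ id]) (auto simp: strict_mono_id[unfolded id_def] strict_mono_def)
next
  case (insert x I)
  then obtain r where r: "strict_mono r" "\<And>i. i \<in> I \<Longrightarrow> convergent (\<lambda>n. f (r n) i)" by auto
  have "bounded (range (\<lambda>n. f (r n) x))"
    using insert.prems[of x] by (rule bounded_subset) auto
  then obtain l s where s: "strict_mono s" "((\<lambda>n. f (r n) x) \<circ> s) \<longlonglongrightarrow> l"
    using bounded_imp_convergent_subsequence by blast
  have "convergent (\<lambda>n. f ((r \<circ> s) n) i)" if "i \<in> insert x I" for i
  proof (cases "i = x")
    case True
    then show ?thesis using s(2) by (auto simp: o_def intro: convergentI)
  next
    case False
    then show ?thesis using convergent_subseq_convergent[OF r(2) s(1), of i] that by (simp add: o_def)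
  qed
  then show ?case using strict_mono_o[OF r(1) s(1)] by blast
qed

lemma det_tendsto:
  fixes A :: "'b \<Rightarrow> nat \<Rightarrow> nat \<Rightarrow> real"
  assumes "\<And>i j. ((\<lambda>n. A n i j) \<longlongrightarrow> B i j) F"
  shows "((\<lambda>n. Determinant.det (Matrix.mat N N (\<lambda>(i, j). A n i j))) \<longlongrightarrow> Determinant.det (Matrix.mat N N (\<lambda>(i, j). B i j))) F"
proof -
  have "Determinant.det (Matrix.mat N N (\<lambda>(i, j). X i j)) =
      (\<Sum>p\<in>{p. p permutes {0..<N}}. signof p * (\<Prod>i = 0..<N. X i (p i)))" for X :: "nat \<Rightarrow> nat \<Rightarrow> real"
    by (subst det_def'[of _ N]) (auto intro!: sum.cong prod.cong dest: permutes_in_image[of _ "{0..<N}"])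
  then show ?thesis by (auto intro!: tendsto_intros assms)
qed

text \<open>\<open>g\<close> may jump (at an end point of its support), so the compactness argument below
  works with all limits of translates of \<open>g\<close>; these are again totally positive.\<close>

lemma (in tp_decay) translates_limit:
  fixes \<epsilon> :: "nat \<Rightarrow> real"
  assumes \<epsilon>: "\<epsilon> \<longlonglongrightarrow> 0"
  shows "\<exists>r g'. strict_mono r \<and> (\<forall>t. (\<lambda>n. g (t + \<epsilon> (r n))) \<longlonglongrightarrow> g' t) \<and> tp_decay g' C a"
proof -
  \<comment> \<open>At continuity points the translates converge by themselves; a subsequence is
    chosen only for the finitely many other points.\<close>
  obtain r :: "nat \<Rightarrow> nat" where r: "strict_mono r" "\<And>t. \<not> isCont g t \<Longrightarrow> convergent (\<lambda>n. g (t + \<epsilon> (r n)))"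
  proof -
    have "bounded (range (\<lambda>n. g (t + \<epsilon> n)))" for t
      by (rule boundedI[of _ C]) (use bounded nonneg in auto)
    then show ?thesis
      using finite_diagonal_subsequence[OF finite_discontinuities, of "\<lambda>n t. g (t + \<epsilon> n)"] that by auto
  qed
  have \<epsilon>r: "(\<lambda>n. t + \<epsilon> (r n)) \<longlonglongrightarrow> t" for t
    using tendsto_add[OF tendsto_const LIMSEQ_subseq_LIMSEQ[OF \<epsilon> r(1)], of t] by (simp add: o_def)
  have cont: "(\<lambda>n. g (t + \<epsilon> (r n))) \<longlonglongrightarrow> g t" if "isCont g t" for t
    using isCont_tendsto_compose[OF that \<epsilon>r] .
  define g' where "g' t = lim (\<lambda>n. g (t + \<epsilon> (r n)))" for t
  have lim: "(\<lambda>n. g (t + \<epsilon> (r n))) \<longlonglongrightarrow> g' t" for t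
    unfolding g'_def using r(2)[of t] cont[of t] by (metis convergentI convergent_LIMSEQ_iff)
  have g'_eq: "g' t = g t" if "isCont g t" for t using LIMSEQ_unique[OF lim cont[OF that]] .
  have "tp_decay g' C a"
  proof
    fix N and x y :: "nat \<Rightarrow> real" assume xy: "strict_mono_on {..<N} x" "strict_mono_on {..<N} y"
    have "(\<lambda>n. Determinant.det (Matrix.mat N N (\<lambda>(j, k). g (x j - y k + \<epsilon> (r n))))) \<longlonglongrightarrow>
        Determinant.det (Matrix.mat N N (\<lambda>(j, k). g' (x j - y k)))"
      by (rule det_tendsto) (rule lim)
    moreover have "0 \<le> Determinant.det (Matrix.mat N N (\<lambda>(j, k). g (x j - y k + \<epsilon> (r n))))" for n
    proof -
      have "strict_mono_on {..<N} (\<lambda>j. x j + \<epsilon> (r n))" using xy(1) by (auto simp: strict_mono_on_def)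
      from tp[OF this xy(2)] show ?thesis by (simp add: algebra_simps)
    qed
    ultimately show "0 \<le> Determinant.det (Matrix.mat N N (\<lambda>(j, k). g' (x j - y k)))"
      by (intro LIMSEQ_le_const[of _ _ 0]) auto
  next
    fix t
    have "(\<lambda>n. C * exp (- a * \<bar>t + \<epsilon> (r n)\<bar>)) \<longlonglongrightarrow> C * exp (- a * \<bar>t\<bar>)"
      by (intro tendsto_intros \<epsilon>r)
    then show "g' t \<le> C * exp (- a * \<bar>t\<bar>)"
      using lim[of t] decay by (intro LIMSEQ_le) auto
  next
    obtain b0 b1 where b: "b0 < b1" "g b0 > 0" "g b1 > 0" using two_points by blast
    \<comment> \<open>The points at one and two thirds of \<open>[b0, b1]\<close> are interior, so
      \<open>g'\<close> agrees with \<open>g\<close> there and stays positive at two points.\<close>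
    define d where "d = (b1 - b0) / 3"
    have d: "d > 0" "b1 = b0 + 2 * d + d" using b by (simp_all add: d_def field_simps)
    have mid: "g (b0 + d) > 0" "g (b0 + 2 * d) > 0"
      using pos_between[OF b(2,3), of "b0 + d"] pos_between[OF b(2,3), of "b0 + 2 * d"] d by auto
    have e: "b0 + d - d = b0" "b0 + d + d = b0 + 2 * d" "b0 + 2 * d - d = b0 + d" "b0 + 2 * d + d = b1"
      using d by auto
    have "isCont g (b0 + d)" "isCont g (b0 + 2 * d)"
      using b d(1) mid isCont_interior[of d "b0 + d"] isCont_interior[of d "b0 + 2 * d"]
      unfolding e by blast+
    then show "\<exists>s t. s < t \<and> g' s > 0 \<and> g' t > 0"
      using mid d by (intro exI[of _ "b0 + d"] exI[of _ "b0 + 2 * d"]) (simp add: g'_eq)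
  qed (rule a_pos)
  with r(1) lim show ?thesis by blast
qed

section \<open>Quasi-periodic row sums\<close>

lemma infsum_int_eq_suminf:
  fixes f :: "int \<Rightarrow> 'a::banach"
  assumes "(\<lambda>k. norm (f k)) summable_on UNIV"
  shows "infsum f UNIV = (\<Sum>n. f (int_decode n))"
proof -
  have bij: "bij_betw int_decode UNIV UNIV" by (rule bij_int_decode)
  have "f summable_on UNIV" using assms by (rule abs_summable_summable)
  then have "(\<lambda>n. f (int_decode n)) summable_on UNIV" using summable_on_reindex_bij_betw[OF bij] by metis
  then have "(\<lambda>n. f (int_decode n)) sums infsum (\<lambda>n. f (int_decode n)) UNIV"
    by (intro has_sum_imp_sums has_sum_infsum)
  also have "infsum (\<lambda>n. f (int_decode n)) UNIV = infsum f UNIV" by (rule infsum_reindex_bij_betw[OF bij])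
  finally show ?thesis by (rule sums_unique)
qed

text \<open>Tannery's theorem, transported along a bijection of the naturals with the
  integers.\<close>

lemma infsum_int_dominated_convergence:
  fixes f :: "nat \<Rightarrow> int \<Rightarrow> complex"
  assumes lim: "\<And>k. (\<lambda>n. f n k) \<longlonglongrightarrow> l k" and bound: "\<And>n k. norm (f n k) \<le> M k" and M: "M summable_on UNIV"
  shows "(\<lambda>n. infsum (f n) UNIV) \<longlonglongrightarrow> infsum l UNIV"
proof -
  have lM: "norm (l k) \<le> M k" for k
    using tendsto_norm[OF lim[of k]] bound by (intro LIMSEQ_le_const2) auto
  have abs: "(\<lambda>k. norm (h k)) summable_on UNIV" if "\<And>k. norm (h k) \<le> M k" for h :: "int \<Rightarrow> complex"
    by (rule summable_on_comparison_test[OF M]) (use that in auto)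
  have "summable (\<lambda>n. M (int_decode n))"
    using M summable_on_reindex_bij_betw[OF bij_int_decode, of M] by (intro summable_on_imp_summable) metis
  then have "(\<lambda>n. \<Sum>k. f n (int_decode k)) \<longlonglongrightarrow> (\<Sum>k. l (int_decode k))"
    using tannerys_theorem[of "\<lambda>k n. f n (int_decode k)" "\<lambda>k. l (int_decode k)" sequentially "\<lambda>k. M (int_decode k)"] lim bound
    by (auto simp: case_prod_unfold)
  then show ?thesis using abs[OF bound] abs[OF lM] by (simp add: infsum_int_eq_suminf)
qed

lemma quasi_periodic_shift:
  fixes c :: "int \<Rightarrow> complex"
  assumes "\<And>n. c (n + int p) = cis (2 * pi * \<nu>) * c n"
  shows "c (n + int p * m) = cis (2 * pi * \<nu> * of_int m) * c n"
proof (induction m rule: int_induct[of _ 0])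
  case (step1 i)
  have "c (n + int p * (i + 1)) = cis (2 * pi * \<nu>) * c (n + int p * i)"
    using assms[of "n + int p * i"] by (simp add: algebra_simps)
  also have "\<dots> = (cis (2 * pi * \<nu>) * cis (2 * pi * \<nu> * of_int i)) * c n" using step1(2) by simp
  also have "cis (2 * pi * \<nu>) * cis (2 * pi * \<nu> * of_int i) = cis (2 * pi * \<nu> * of_int (i + 1))"
    by (simp add: cis_mult algebra_simps)
  finally show ?case .
next
  case (step2 i)
  have "c (n + int p * i) = cis (2 * pi * \<nu>) * c (n + int p * (i - 1))"
    using assms[of "n + int p * (i - 1)"] by (simp add: algebra_simps)
  then have eq: "cis (2 * pi * \<nu>) * c (n + int p * (i - 1)) = cis (2 * pi * \<nu> * of_int i) * c n"
    using step2(2) by simp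
  have "c (n + int p * (i - 1)) = cis (- (2 * pi * \<nu>)) * (cis (2 * pi * \<nu>) * c (n + int p * (i - 1)))"
    by (simp add: cis_mult mult.assoc[symmetric])
  also have "\<dots> = (cis (- (2 * pi * \<nu>)) * cis (2 * pi * \<nu> * of_int i)) * c n" unfolding eq by simp
  also have "cis (- (2 * pi * \<nu>)) * cis (2 * pi * \<nu> * of_int i) = cis (2 * pi * \<nu> * of_int (i - 1))"
    by (simp add: cis_mult algebra_simps)
  finally show ?case .
qed simp

lemma quasi_periodic_mod:
  fixes c :: "int \<Rightarrow> complex"
  assumes "\<And>n. c (n + int p) = cis (2 * pi * \<nu>) * c n"
  shows "c n = cis (2 * pi * \<nu> * of_int (n div int p)) * c (n mod int p)"
  using quasi_periodic_shift[of c p \<nu> "n mod int p" "n div int p"] assms by simp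

lemma quasi_periodic_bound:
  fixes c :: "int \<Rightarrow> complex"
  assumes "\<And>n. c (n + int p) = cis (2 * pi * \<nu>) * c n" "p > 0"
  shows "(cmod (c n))\<^sup>2 \<le> (\<Sum>l<p. (cmod (c (int l)))\<^sup>2)"
proof -
  define l where "l = nat (n mod int p)"
  have l: "l < p" "int l = n mod int p" using assms(2) by (auto simp: l_def nat_less_iff)
  have "cmod (c n) = cmod (c (int l))"
    using quasi_periodic_mod[of c p \<nu> n] assms(1) by (simp add: norm_mult l)
  then show ?thesis using l(1) member_le_sum[of l "{..<p}" "\<lambda>l. (cmod (c (int l)))\<^sup>2"] by simp
qed

text \<open>The \<open>q / p\<close>-periodization of the product of \<open>c\<close> and
  \<open>g\<close>, evaluated on the coset \<open>s + Z/p\<close> at position \<open>i\<close>. It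
  depends only on \<open>i\<close> modulo \<open>q\<close>, so there are \<open>q\<close> equations
  for the \<open>p\<close> values that determine \<open>c\<close>.\<close>

definition row_sum :: "(real \<Rightarrow> real) \<Rightarrow> nat \<Rightarrow> nat \<Rightarrow> real \<Rightarrow> (int \<Rightarrow> complex) \<Rightarrow> int \<Rightarrow> complex" where
  "row_sum g p q s c i =
     (\<Sum>\<^sub>\<infinity>k\<in>(UNIV::int set). c (i + k * int q) * of_real (g (s + of_int (i + k * int q) / of_nat p)))"

lemma row_sum_scale: "row_sum g p q s (\<lambda>n. r * c n) i = r * row_sum g p q s c i"
  by (simp add: row_sum_def mult.assoc infsum_cmult_right')

lemma row_sum_shift: "row_sum g p q s c (i + m * int q) = row_sum g p q s c i"
proof -
  have "row_sum g p q s c i = (\<Sum>\<^sub>\<infinity>k\<in>(UNIV::int set). c (i + (k + m) * int q) * of_real (g (s + of_int (i + (k + m) * int q) / of_nat p)))"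
    unfolding row_sum_def by (rule infsum_int_shift[symmetric])
  then show ?thesis by (simp add: row_sum_def algebra_simps)
qed

section \<open>Injectivity and uniform lower bound for row sums\<close>

context tp_decay begin

lemma row_term_bound:
  assumes "p > 0" "\<bar>s\<bar> \<le> S"
  shows "g (s + of_int (i + k * int q) / of_nat p) \<le>
     C * exp (a * (S + \<bar>of_int i / of_nat p\<bar>)) * exp (- (a * (of_nat q / of_nat p)) * \<bar>of_int k\<bar>)"
proof -
  define t where "t = s + of_int i / of_nat p"
  have "s + of_int (i + k * int q) / of_nat p = t - of_int k * (- (of_nat q / of_nat p))"
    by (simp add: t_def add_divide_distrib)
  then have "g (s + of_int (i + k * int q) / of_nat p) \<le>
      C * exp (a * \<bar>t\<bar>) * exp (- (a * \<bar>- (of_nat q / of_nat p)\<bar>) * \<bar>of_int k\<bar>)"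
    using g_le_shift[of t k "- (of_nat q / of_nat p)"] by simp
  also have "\<dots> \<le> C * exp (a * (S + \<bar>of_int i / of_nat p\<bar>)) * exp (- (a * (of_nat q / of_nat p)) * \<bar>of_int k\<bar>)"
  proof -
    have "\<bar>t\<bar> \<le> S + \<bar>of_int i / of_nat p\<bar>" using assms(2) abs_triangle_ineq[of s "of_int i / of_nat p"] by (simp add: t_def)
    then have "a * \<bar>t\<bar> \<le> a * (S + \<bar>of_int i / of_nat p\<bar>)" using a_pos by (intro mult_left_mono) auto
    then have "exp (a * \<bar>t\<bar>) \<le> exp (a * (S + \<bar>of_int i / of_nat p\<bar>))" by simp
    then show ?thesis using C_pos by (simp add: mult_right_mono)
  qed
  finally show ?thesis .
qed

lemma row_bound_summable:
  assumes "p > 0" "q > 0"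
  shows "(\<lambda>k::int. B * exp (- (a * (of_nat q / of_nat p)) * \<bar>of_int k\<bar>)) summable_on UNIV"
  by (intro summable_on_cmult_right summable_on_int_exp) (use a_pos assms in auto)

text \<open>On the rows \<open>i = p * j\<close> quasi-periodicity turns the row sum into a phase
  times the comb of \<open>d k = c (- k * q)\<close> at \<open>s + j\<close>. Shifting
  \<open>d\<close> by \<open>2 * p\<close> multiplies it by a fixed phase, so \<open>d\<close> is
  recurrent and must vanish; by coprimality it determines \<open>c\<close>.\<close>

lemma row_sum_kernel_trivial:
  assumes pq: "0 < p" "p < q" "coprime p q"
    and c: "\<And>n. c (n + int p) = cis (2 * pi * \<nu>) * c n"
    and zero: "\<And>i. row_sum g p q s c (int i) = 0"
  shows "c n = 0"
proof -
  define \<gamma> where "\<gamma> = real q / of_nat p"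
  have \<gamma>: "\<gamma> \<noteq> 0" using pq by (simp add: \<gamma>_def)
  define V where "V = sqrt (\<Sum>l<p. (cmod (c (int l)))\<^sup>2) + 1"
  have cV: "cmod (c n) \<le> V" for n
    using real_le_rsqrt[OF quasi_periodic_bound[of c p \<nu> n]] c pq(1) by (simp add: V_def)
  have V0: "V > 0" by (auto simp: V_def intro!: add_nonneg_pos sum_nonneg)
  define d where "d k = c (- k * int q)" for k
  have kernel: "(\<Sum>\<^sub>\<infinity>k\<in>(UNIV::int set). d k * of_real (g ((s + of_int j) - of_int k * \<gamma>))) = 0" for j :: int
  proof -
    define i where "i = int p * j"
    have "row_sum g p q s c i = 0"
    proof -
      have "i = int (nat (i mod int q)) + (i div int q) * int q" using pq by simp
      then show ?thesis using row_sum_shift[of g p q s c "int (nat (i mod int q))" "i div int q"] zero by metis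
    qed
    moreover have "row_sum g p q s c i =
       (\<Sum>\<^sub>\<infinity>k\<in>(UNIV::int set). c (i + (- k) * int q) * of_real (g (s + of_int (i + (- k) * int q) / of_nat p)))"
      unfolding row_sum_def by (rule infsum_reindex_bij_witness[of _ uminus uminus]) auto
    moreover have "c (i + (- k) * int q) * of_real (g (s + of_int (i + (- k) * int q) / of_nat p)) =
       cis (2 * pi * \<nu> * of_int j) * (d k * of_real (g ((s + of_int j) - of_int k * \<gamma>)))" for k
    proof -
      have "of_int (i + (- k) * int q) / of_nat p = of_int j - of_int k * \<gamma>"
        using pq by (simp add: i_def \<gamma>_def field_simps)
      moreover have "c (i + (- k) * int q) = cis (2 * pi * \<nu> * of_int j) * d k"
        using quasi_periodic_shift[of c p \<nu> "- k * int q" j] c by (simp add: i_def d_def add.commute)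
      ultimately show ?thesis by (simp add: add_diff_eq)
    qed
    ultimately have "cis (2 * pi * \<nu> * of_int j) * (\<Sum>\<^sub>\<infinity>k\<in>(UNIV::int set). d k * of_real (g ((s + of_int j) - of_int k * \<gamma>))) = 0"
      by (simp only: infsum_cmult_right')
    then show ?thesis by simp
  qed
  have summ: "(\<lambda>k::int. d k * of_real (g (t - of_int k * \<gamma>))) summable_on UNIV" for t
  proof (rule abs_summable_summable, rule summable_on_comparison_test)
    show "(\<lambda>k::int. V * g (t - of_int k * \<gamma>)) summable_on UNIV"
      by (intro summable_on_cmult_right summable_shift \<gamma>)
    show "norm (d k * of_real (g (t - of_int k * \<gamma>))) \<le> V * g (t - of_int k * \<gamma>)" for k
      using cV nonneg by (simp add: norm_mult d_def mult_right_mono)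
  qed simp
  have recur: "\<exists>k'\<ge>N. even (k' - k) \<and> cmod (d k' - d k) < \<eta> \<and> cmod (d (k' + 1) - d (k + 1)) < \<eta>" if "\<eta> > 0" for k \<eta> N
  proof -
    \<comment> \<open>The rotation angle for a shift by \<open>2 * p\<close>; the factor 2 makes the
      recurrence preserve parity.\<close>
    define \<alpha> where "\<alpha> = - (4 * pi * \<nu> * of_nat q)"
    have dshift: "d (k + 2 * int p * int m) = cis (\<alpha> * of_nat m) * d k" for k and m :: nat
    proof -
      have "d (k + 2 * int p * int m) = c (- k * int q + int p * (- 2 * int q * int m))"
        by (simp add: d_def algebra_simps)
      also have "\<dots> = cis (2 * pi * \<nu> * of_int (- 2 * int q * int m)) * d k"
        using quasi_periodic_shift[of c p \<nu> "- k * int q" "- 2 * int q * int m"] c by (simp add: d_def)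
      also have "2 * pi * \<nu> * of_int (- 2 * int q * int m) = \<alpha> * of_nat m" by (simp add: \<alpha>_def)
      finally show ?thesis .
    qed
    obtain m where m: "m \<ge> nat (N - k)" "cmod (cis (\<alpha> * of_nat m) - 1) < \<eta> / V"
      using cis_recurrence[of "\<eta> / V" "nat (N - k)" \<alpha>] \<open>\<eta> > 0\<close> V0 by auto
    have close: "cmod (d (k + 2 * int p * int m) - d k) < \<eta>" for k
    proof -
      have "d (k + 2 * int p * int m) - d k = (cis (\<alpha> * of_nat m) - 1) * d k"
        unfolding dshift by (simp add: algebra_simps)
      then have "cmod (d (k + 2 * int p * int m) - d k) \<le> cmod (cis (\<alpha> * of_nat m) - 1) * V"
        using cV[of "- k * int q"] by (simp add: norm_mult d_def mult_left_mono)
      also have "\<dots> < \<eta>" using m(2) V0 by (simp add: field_simps)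
      finally show ?thesis .
    qed
    have "N - k \<le> int m" using m(1) by simp
    also have "1 * int m \<le> (2 * int p) * int m" using pq(1) by (intro mult_right_mono) auto
    then have "int m \<le> 2 * int p * int m" by simp
    finally have "N \<le> k + 2 * int p * int m" by simp
    moreover have "k + 2 * int p * int m + 1 = (k + 1) + 2 * int p * int m" by simp
    ultimately show ?thesis using close[of k] close[of "k + 1"]
      by (intro exI[of _ "k + 2 * int p * int m"]) (auto simp: add_ac)
  qed
  \<comment> \<open>\<open>comb_kernel_trivial\<close> is about real sequences. As \<open>g\<close>
    is real, real and imaginary part inherit its hypotheses separately.\<close>
  have "Re (d k) = 0 \<and> Im (d k) = 0" for k
  proof
    show "Re (d k) = 0"
    proof (rule comb_kernel_trivial[OF pq(1,2) \<gamma>_def, of "\<lambda>k. Re (d k)" V s])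
      show "\<bar>Re (d k)\<bar> \<le> V" for k using cV abs_Re_le_cmod order_trans unfolding d_def by blast
      show "\<exists>k'\<ge>N. even (k' - k) \<and> \<bar>Re (d k') - Re (d k)\<bar> < \<eta> \<and> \<bar>Re (d (k' + 1)) - Re (d (k + 1))\<bar> < \<eta>"
        if "\<eta> > 0" for k \<eta> N
        using recur[OF that, of N k] abs_Re_le_cmod order_le_less_trans unfolding minus_complex.sel[symmetric] by blast
      show "comb g \<gamma> (\<lambda>k. Re (d k)) (s + of_int j) = 0" for j
        using infsum_Re[OF summ[of "s + of_int j"]] kernel[of j] by (simp add: comb_def)
    qed
    show "Im (d k) = 0"
    proof (rule comb_kernel_trivial[OF pq(1,2) \<gamma>_def, of "\<lambda>k. Im (d k)" V s])
      show "\<bar>Im (d k)\<bar> \<le> V" for k using cV abs_Im_le_cmod order_trans unfolding d_def by blast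
      show "\<exists>k'\<ge>N. even (k' - k) \<and> \<bar>Im (d k') - Im (d k)\<bar> < \<eta> \<and> \<bar>Im (d (k' + 1)) - Im (d (k + 1))\<bar> < \<eta>"
        if "\<eta> > 0" for k \<eta> N
        using recur[OF that, of N k] abs_Im_le_cmod order_le_less_trans unfolding minus_complex.sel[symmetric] by blast
      show "comb g \<gamma> (\<lambda>k. Im (d k)) (s + of_int j) = 0" for j
        using infsum_Im[OF summ[of "s + of_int j"]] kernel[of j] by (simp add: comb_def)
    qed
  qed
  then have d0: "d k = 0" for k by (simp add: complex_eq_iff)
  \<comment> \<open>Every \<open>n\<close> is a multiple of \<open>q\<close> plus a multiple of
    \<open>p\<close>, and the latter contributes only a phase.\<close>
  obtain x y where xy: "x * int p + y * int q = 1"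
    using bezout_int[of "int p" "int q"] pq(3) by auto
  have "n = - (- y * n) * int q + int p * (x * n)" using xy by (metis (no_types, opaque_lifting) distrib_right mult.assoc mult.commute mult.left_commute mult_1 minus_mult_minus minus_minus add.commute mult_minus_left)
  then show ?thesis
    using quasi_periodic_shift[of c p \<nu> "- (- y * n) * int q" "x * n"] c d0[of "- y * n"] by (simp add: d_def)
qed

text \<open>A failing bound would, in the limit, give a kernel element for a limit of translates of \<open>g\<close>.\<close>

lemma row_sum_lower_bound:
  assumes pq: "0 < p" "p < q" "coprime p q"
  shows "\<exists>A>0. \<forall>s\<in>{0..1}. \<forall>c. (\<forall>n. c (n + int p) = cis (2 * pi * \<nu>) * c n) \<longrightarrow>
     A * (\<Sum>l<p. (cmod (c (int l)))\<^sup>2) \<le> (\<Sum>i<q. (cmod (row_sum g p q s c (int i)))\<^sup>2)"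
proof (rule ccontr)
  assume neg: "\<not> ?thesis"
  have "\<exists>s c. s \<in> {0..1} \<and> (\<forall>n. c (n + int p) = cis (2 * pi * \<nu>) * c n) \<and>
      (\<Sum>l<p. (cmod (c (int l)))\<^sup>2) = 1 \<and> (\<Sum>i<q. (cmod (row_sum g p q s c (int i)))\<^sup>2) < 1 / of_nat (Suc m)" for m
  proof -
    obtain s c where sc: "s \<in> {0..1}" "\<forall>n. c (n + int p) = cis (2 * pi * \<nu>) * c n"
      "(\<Sum>i<q. (cmod (row_sum g p q s c (int i)))\<^sup>2) < 1 / of_nat (Suc m) * (\<Sum>l<p. (cmod (c (int l)))\<^sup>2)"
      using neg by (metis not_le of_nat_0_less_iff zero_less_Suc zero_less_divide_1_iff)
    define S where "S = (\<Sum>l<p. (cmod (c (int l)))\<^sup>2)"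
    have "0 \<le> (\<Sum>i<q. (cmod (row_sum g p q s c (int i)))\<^sup>2)" by (intro sum_nonneg) auto
    then have "0 < 1 / of_nat (Suc m) * S" using sc(3) unfolding S_def by linarith
    then have S: "S > 0" by (simp add: zero_less_mult_iff zero_less_divide_iff)
    \<comment> \<open>Normalized so that the limit sequence cannot be zero.\<close>
    define c' where "c' n = of_real (1 / sqrt S) * c n" for n
    have c'2: "(cmod (of_real (1 / sqrt S) * z))\<^sup>2 = (cmod z)\<^sup>2 / S" for z
      using S by (simp add: norm_mult norm_divide power_mult_distrib power_divide)
    have "(\<Sum>l<p. (cmod (c' (int l)))\<^sup>2) = 1"
      unfolding c'_def c'2 using S by (simp add: S_def sum_divide_distrib[symmetric])
    moreover have "(\<Sum>i<q. (cmod (row_sum g p q s c' (int i)))\<^sup>2) < 1 / of_nat (Suc m)"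
      unfolding c'_def row_sum_scale c'2 sum_divide_distrib[symmetric] using sc(3) S
      by (simp add: S_def[symmetric] pos_divide_less_eq)
    moreover have "\<forall>n. c' (n + int p) = cis (2 * pi * \<nu>) * c' n" using sc(2) by (simp add: c'_def)
    ultimately show ?thesis using sc(1) by blast
  qed
  then obtain s c where s: "\<And>m. s m \<in> {0..1::real}" and c: "\<And>m n. c m (n + int p) = cis (2 * pi * \<nu>) * c m n"
    and c1: "\<And>m. (\<Sum>l<p. (cmod (c m (int l)))\<^sup>2) = 1"
    and small: "\<And>m. (\<Sum>i<q. (cmod (row_sum g p q (s m) (c m) (int i)))\<^sup>2) < 1 / of_nat (Suc m)"
    by metis
  have cle: "cmod (c m n) \<le> 1" for m n
    using quasi_periodic_bound[of "c m" p \<nu> n] c c1[of m] pq(1) by (simp add: abs_square_le_1)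
  have "bounded (range (\<lambda>m. c m (int l)))" for l
    by (rule boundedI[of _ 1]) (use cle in auto)
  then obtain r1 where r1: "strict_mono r1" "\<And>l. l < p \<Longrightarrow> convergent (\<lambda>m. c (r1 m) (int l))"
    using finite_diagonal_subsequence[of "{..<p}" "\<lambda>m l. c m (int l)"] by auto
  have "\<forall>m. s (r1 m) \<in> {0..1}" using s by blast
  from seq_compactE[OF compact_imp_seq_compact[OF compact_Icc] this]
  obtain s0 r2 where r2: "strict_mono r2" "(\<lambda>m. s (r1 (r2 m))) \<longlonglongrightarrow> s0" unfolding o_def by blast
  \<comment> \<open>Moving the base point \<open>s\<close> amounts to translating \<open>g\<close>,
    so its convergence to \<open>s0\<close> is absorbed into a limit \<open>g'\<close> of
    translates.\<close>
  define \<epsilon> where "\<epsilon> m = s (r1 (r2 m)) - s0" for m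
  have "\<epsilon> \<longlonglongrightarrow> 0" unfolding \<epsilon>_def using r2(2) by (simp add: LIM_zero_iff)
  from translates_limit[OF this] obtain r3 g' where
    r3: "strict_mono r3" "\<And>t. (\<lambda>n. g (t + \<epsilon> (r3 n))) \<longlonglongrightarrow> g' t" "tp_decay g' C a" by blast
  define r where "r m = r1 (r2 (r3 m))" for m
  have r: "strict_mono r" using r1(1) r2(1) r3(1) by (auto simp: strict_mono_def r_def)
  have "convergent (\<lambda>m. c (r m) n)" for n
  proof -
    define l where "l = nat (n mod int p)"
    have l: "l < p" "int l = n mod int p" using pq(1) by (auto simp: l_def nat_less_iff)
    have "convergent (\<lambda>m. c (r m) (int l))"
      using convergent_subseq_convergent[OF r1(2)[OF l(1)] strict_mono_o[OF r2(1) r3(1)]] by (simp add: o_def r_def)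
    then have "convergent (\<lambda>m. cis (2 * pi * \<nu> * of_int (n div int p)) * c (r m) (int l))"
      by (rule convergent_mult[OF convergent_const])
    then show ?thesis using quasi_periodic_mod[of "c (r _)" p \<nu> n] c l by simp
  qed
  then obtain c0 where c0: "\<And>n. (\<lambda>m. c (r m) n) \<longlonglongrightarrow> c0 n" unfolding convergent_def by metis
  have c0q: "c0 (n + int p) = cis (2 * pi * \<nu>) * c0 n" for n
  proof -
    have "(\<lambda>m. c (r m) (n + int p)) \<longlonglongrightarrow> cis (2 * pi * \<nu>) * c0 n" unfolding c by (intro tendsto_intros c0)
    then show ?thesis using LIMSEQ_unique[OF c0] by blast
  qed
  have row_lim: "(\<lambda>m. row_sum g p q (s (r m)) (c (r m)) i) \<longlonglongrightarrow> row_sum g' p q s0 c0 i" for i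
    unfolding row_sum_def
  proof (rule infsum_int_dominated_convergence)
    fix k
    have "(\<lambda>m. g (s0 + of_int (i + k * int q) / of_nat p + \<epsilon> (r3 m))) \<longlonglongrightarrow> g' (s0 + of_int (i + k * int q) / of_nat p)"
      by (rule r3(2))
    moreover have "s0 + of_int (i + k * int q) / of_nat p + \<epsilon> (r3 m) = s (r m) + of_int (i + k * int q) / of_nat p" for m
      by (simp add: \<epsilon>_def r_def)
    ultimately have "(\<lambda>m. g (s (r m) + of_int (i + k * int q) / of_nat p)) \<longlonglongrightarrow> g' (s0 + of_int (i + k * int q) / of_nat p)"
      by (simp only:)
    then show "(\<lambda>m. c (r m) (i + k * int q) * of_real (g (s (r m) + of_int (i + k * int q) / of_nat p)))
        \<longlonglongrightarrow> c0 (i + k * int q) * of_real (g' (s0 + of_int (i + k * int q) / of_nat p))"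
      by (intro tendsto_intros c0)
  next
    fix m k
    have "\<bar>s (r m)\<bar> \<le> 1" using s[of "r m"] by auto
    then have "cmod (c (r m) (i + k * int q)) * g (s (r m) + of_int (i + k * int q) / of_nat p) \<le>
       1 * (C * exp (a * (1 + \<bar>of_int i / of_nat p\<bar>)) * exp (- (a * (of_nat q / of_nat p)) * \<bar>of_int k\<bar>))"
      using cle nonneg pq(1) by (intro mult_mono row_term_bound) auto
    then show "norm (c (r m) (i + k * int q) * of_real (g (s (r m) + of_int (i + k * int q) / of_nat p))) \<le>
       C * exp (a * (1 + \<bar>of_int i / of_nat p\<bar>)) * exp (- (a * (of_nat q / of_nat p)) * \<bar>of_int k\<bar>)"
      using nonneg by (simp add: norm_mult)
  next
    show "(\<lambda>k::int. C * exp (a * (1 + \<bar>of_int i / of_nat p\<bar>)) * exp (- (a * (of_nat q / of_nat p)) * \<bar>of_int k\<bar>)) summable_on UNIV"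
      by (rule row_bound_summable) (use pq in auto)
  qed
  have "(\<lambda>m. \<Sum>i<q. (cmod (row_sum g p q (s (r m)) (c (r m)) (int i)))\<^sup>2) \<longlonglongrightarrow> (\<Sum>i<q. (cmod (row_sum g' p q s0 c0 (int i)))\<^sup>2)"
    by (intro tendsto_intros row_lim)
  moreover have "(\<lambda>m. \<Sum>i<q. (cmod (row_sum g p q (s (r m)) (c (r m)) (int i)))\<^sup>2) \<longlonglongrightarrow> 0"
  proof (rule tendsto_sandwich[OF _ _ tendsto_const])
    show "(\<lambda>m. 1 / of_nat (Suc (r m))) \<longlonglongrightarrow> (0::real)"
      using LIMSEQ_subseq_LIMSEQ[OF LIMSEQ_Suc[OF lim_1_over_n] r] by (simp add: o_def)
    show "\<forall>\<^sub>F m in sequentially. (\<Sum>i<q. (cmod (row_sum g p q (s (r m)) (c (r m)) (int i)))\<^sup>2) \<le> 1 / of_nat (Suc (r m))"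
      using small by (intro always_eventually) (auto intro: less_imp_le)
    show "\<forall>\<^sub>F m in sequentially. 0 \<le> (\<Sum>i<q. (cmod (row_sum g p q (s (r m)) (c (r m)) (int i)))\<^sup>2)"
      by (intro always_eventually allI sum_nonneg) auto
  qed
  ultimately have "(\<Sum>i<q. (cmod (row_sum g' p q s0 c0 (int i)))\<^sup>2) = 0" by (rule LIMSEQ_unique)
  then have row0: "row_sum g' p q s0 c0 (int i) = 0" if "i < q" for i
    using that by (subst (asm) sum_nonneg_eq_0_iff) auto
  have "row_sum g' p q s0 c0 (int i) = 0" for i
  proof -
    have "int i = int (i mod q) + int (i div q) * int q"
      by (metis add.commute mult.commute of_nat_add of_nat_mult mult_div_mod_eq)
    then show ?thesis using row_sum_shift[of g' p q s0 c0 "int (i mod q)" "int (i div q)"] row0[of "i mod q"] pq by simp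
  qed
  then have "c0 n = 0" for n
    using tp_decay.row_sum_kernel_trivial[OF r3(3) pq, of c0 \<nu> s0 n] c0q by blast
  moreover have "(\<lambda>m. \<Sum>l<p. (cmod (c (r m) (int l)))\<^sup>2) \<longlonglongrightarrow> (\<Sum>l<p. (cmod (c0 (int l)))\<^sup>2)"
    by (intro tendsto_intros c0)
  then have "(\<Sum>l<p. (cmod (c0 (int l)))\<^sup>2) = 1" unfolding c1 using LIMSEQ_unique tendsto_const by blast
  ultimately show False by simp
qed

end

section \<open>Fourier series on an interval\<close>

text \<open>A predicate rather than an explicit finite sum, so that closure under products goes by
  rule induction.\<close>

inductive trig_poly :: "(real \<Rightarrow> complex) \<Rightarrow> bool" where
  trig_poly_monom: "trig_poly (\<lambda>t. c * cis (of_int n * t))"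
| trig_poly_add: "trig_poly u \<Longrightarrow> trig_poly v \<Longrightarrow> trig_poly (\<lambda>t. u t + v t)"

lemma trig_poly_const: "trig_poly (\<lambda>_. c)"
  using trig_poly_monom[of c 0] by simp

lemma trig_poly_cmult: "trig_poly u \<Longrightarrow> trig_poly (\<lambda>t. c * u t)"
proof (induction rule: trig_poly.induct)
  case (trig_poly_monom d n)
  then show ?case using trig_poly.trig_poly_monom[of "c * d" n] by (simp add: mult.assoc)
next
  case (trig_poly_add u v)
  then show ?case using trig_poly.trig_poly_add by (simp add: distrib_left)
qed

lemma trig_poly_mult:
  assumes "trig_poly u" "trig_poly v"
  shows "trig_poly (\<lambda>t. u t * v t)"
  using assms(1)
proof (induction rule: trig_poly.induct)
  case (trig_poly_monom c n)
  show ?case using assms(2)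
  proof (induction rule: trig_poly.induct)
    case (trig_poly_monom d m)
    have "(\<lambda>t. c * cis (of_int n * t) * (d * cis (of_int m * t))) = (\<lambda>t. (c * d) * cis (of_int (n + m) * t))"
      by (intro ext) (simp add: cis_mult[symmetric] distrib_right)
    then show ?case using trig_poly.trig_poly_monom[of "c * d" "n + m"] by simp
  next
    case (trig_poly_add u v)
    then show ?case using trig_poly.trig_poly_add by (simp add: distrib_left)
  qed
next
  case (trig_poly_add u v)
  then show ?case using trig_poly.trig_poly_add by (simp add: distrib_right)
qed

lemma trig_poly_finite_sum:
  assumes "trig_poly u"
  shows "\<exists>S a. finite S \<and> u = (\<lambda>t. \<Sum>n\<in>S. a n * cis (of_int n * t))"
  using assms
proof (induction rule: trig_poly.induct)
  case (trig_poly_monom c n)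
  show ?case by (intro exI[of _ "{n}"] exI[of _ "\<lambda>_. c"]) simp
next
  case (trig_poly_add u v)
  then obtain S a S' a' where *: "finite S" "u = (\<lambda>t. \<Sum>n\<in>S. a n * cis (of_int n * t))"
    "finite S'" "v = (\<lambda>t. \<Sum>n\<in>S'. a' n * cis (of_int n * t))" by blast
  define b where "b n = (if n \<in> S then a n else 0) + (if n \<in> S' then a' n else 0)" for n
  have "u t + v t = (\<Sum>n\<in>S \<union> S'. b n * cis (of_int n * t))" for t
  proof -
    have "u t = (\<Sum>n\<in>S \<union> S'. (if n \<in> S then a n else 0) * cis (of_int n * t))"
      unfolding *(2) using *(1,3) by (intro sum.mono_neutral_cong_left) auto
    moreover have "v t = (\<Sum>n\<in>S \<union> S'. (if n \<in> S' then a' n else 0) * cis (of_int n * t))"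
      unfolding *(4) using *(1,3) by (intro sum.mono_neutral_cong_left) auto
    ultimately show ?thesis by (simp add: b_def distrib_right sum.distrib)
  qed
  then show ?case using *(1,3) by (intro exI[of _ "S \<union> S'"] exI[of _ b]) auto
qed

lemma trig_poly_of_real_polynomial:
  fixes P :: "complex \<Rightarrow> real"
  assumes "real_polynomial_function P"
  shows "trig_poly (\<lambda>t. of_real (P (cis t)))"
  using assms
proof (induction rule: real_polynomial_function.induct)
  case (linear f)
  interpret bounded_linear f by fact
  have "f (cis t) = cos t * f 1 + sin t * f \<i>" for t
  proof -
    have "cis t = cos t *\<^sub>R 1 + sin t *\<^sub>R \<i>" by (simp add: complex_eq_iff)
    then show ?thesis by (simp only: add scaleR) simp
  qed
  moreover have "complex_of_real (cos t) = (1/2) * cis (of_int 1 * t) + (1/2) * cis (of_int (- 1) * t)"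
    "complex_of_real (sin t) = (1/(2*\<i>)) * cis (of_int 1 * t) + (- 1/(2*\<i>)) * cis (of_int (- 1) * t)" for t
    by (simp_all add: complex_eq_iff Im_divide Re_divide)
  ultimately have eq: "(\<lambda>t. complex_of_real (f (cis t))) = (\<lambda>t. of_real (f 1) * ((1/2) * cis (of_int 1 * t) + (1/2) * cis (of_int (- 1) * t))
      + of_real (f \<i>) * ((1/(2*\<i>)) * cis (of_int 1 * t) + (- 1/(2*\<i>)) * cis (of_int (- 1) * t)))"
    by (simp only: of_real_add of_real_mult mult.commute)
  show ?case unfolding eq by (intro trig_poly_add trig_poly_cmult trig_poly_monom)
next
  case (const c)
  show ?case by (rule trig_poly_const)
next
  case (add f g)
  then show ?case using trig_poly_add by simp
next
  case (mult f g)
  then show ?case using trig_poly_mult by simp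
qed

text \<open>A function on an interval with equal end values factors continuously through the circle,
  where Stone--Weierstrass applies.\<close>

lemma trig_poly_uniform_approximation:
  fixes w :: "real \<Rightarrow> complex"
  assumes T: "T > 0" and w: "continuous_on {0..T} w" "w 0 = w T" and e: "e > 0"
  shows "\<exists>u. trig_poly u \<and> (\<forall>t\<in>{0..T}. cmod (w t - u (2 * pi * t / T)) < e)"
proof -
  define \<pi>' where "\<pi>' t = cis (2 * pi * t / T)" for t
  \<comment> \<open>Two points of \<open>[0, T]\<close> have the same image on the circle only if
    they coincide or are the two end points.\<close>
  have w_eq: "w t = w t'" if "t \<in> {0..T}" "t' \<in> {0..T}" "\<pi>' t = \<pi>' t'" for t t'
  proof -
    have "exp (\<i> * of_real (2 * pi * t / T)) = exp (\<i> * of_real (2 * pi * t' / T))"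
      using that(3) by (simp add: \<pi>'_def cis_conv_exp)
    then obtain n :: int where "\<i> * of_real (2 * pi * t / T) = \<i> * of_real (2 * pi * t' / T) + (of_int (2 * n) * pi) * \<i>"
      unfolding exp_eq by blast
    then have "2 * pi * t / T = 2 * pi * t' / T + 2 * of_int n * pi" by (simp add: complex_eq_iff)
    then have "2 * pi * t = 2 * pi * (t' + of_int n * T)" using T by (simp add: field_simps)
    then have tt: "t = t' + of_int n * T" by simp
    have "\<bar>of_int n * T\<bar> \<le> 1 * T" using that tt by (auto simp: abs_le_iff)
    then have "\<bar>n\<bar> \<le> 1" using T by (simp add: abs_mult)
    then consider "n = 0" | "n = 1" | "n = - 1" by linarith
    then show ?thesis
    proof cases
      case 2
      then have "t = T" "t' = 0" using tt that by auto
      then show ?thesis using w(2) by simp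
    next
      case 3
      then have "t = 0" "t' = T" using tt that by auto
      then show ?thesis using w(2) by simp
    qed (use tt in simp)
  qed
  define S where "S = \<pi>' ` {0..T}"
  define W where "W z = w (inv_into {0..T} \<pi>' z)" for z
  have W: "W (\<pi>' t) = w t" if "t \<in> {0..T}" for t
  proof -
    have "\<pi>' t \<in> \<pi>' ` {0..T}" using that by blast
    then show ?thesis unfolding W_def by (intro w_eq inv_into_into f_inv_into_f that)
  qed
  have cont: "continuous_on {0..T} \<pi>'"
    unfolding \<pi>'_def using T by (intro continuous_intros) auto
  then have S: "compact S" unfolding S_def by (intro compact_continuous_image) auto
  \<comment> \<open>A preimage of a closed set under \<open>W\<close> is the image of a compact set
    under \<open>\<pi>'\<close>, hence closed.\<close>
  have "continuous_on S W"
    unfolding continuous_on_closed_vimage[OF compact_imp_closed[OF S]]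
  proof (intro allI impI)
    fix B :: "complex set" assume "closed B"
    then have "closed (w -` B \<inter> {0..T})"
      using w(1) continuous_on_closed_vimage[of "{0..T}" w] by auto
    then have "compact ({0..T} \<inter> (w -` B \<inter> {0..T}))" by (intro compact_Int_closed) auto
    then have "compact (w -` B \<inter> {0..T})" by (simp add: Int_ac)
    then have "compact (\<pi>' ` (w -` B \<inter> {0..T}))"
      using cont by (intro compact_continuous_image) (auto intro: continuous_on_subset)
    moreover have "\<pi>' ` (w -` B \<inter> {0..T}) = W -` B \<inter> S" using W by (auto simp: S_def)
    ultimately show "closed (W -` B \<inter> S)" by (simp add: compact_imp_closed)
  qed
  then obtain P where P: "polynomial_function P" "\<And>z. z \<in> S \<Longrightarrow> norm (W z - P z) < e"
    using Stone_Weierstrass_polynomial_function[OF S _ e, of W] by blast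
  have "real_polynomial_function (Re \<circ> P)" "real_polynomial_function (Im \<circ> P)"
    using P(1) unfolding polynomial_function_def by (auto intro: bounded_linear_Re bounded_linear_Im)
  then have "trig_poly (\<lambda>t. of_real ((Re \<circ> P) (cis t)) + \<i> * of_real ((Im \<circ> P) (cis t)))"
    by (intro trig_poly_add trig_poly_cmult trig_poly_of_real_polynomial)
  then have "trig_poly (\<lambda>t. P (cis t))" by (simp add: complex_eq[symmetric])
  moreover have "cmod (w t - P (cis (2 * pi * t / T))) < e" if "t \<in> {0..T}" for t
    using P(2)[of "\<pi>' t"] W[OF that] that by (auto simp: S_def \<pi>'_def)
  ultimately show ?thesis by blast
qed

section \<open>Square-integrable functions and Parseval's identity\<close>

definition square_integrable :: "real measure \<Rightarrow> (real \<Rightarrow> complex) \<Rightarrow> bool" where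
  "square_integrable M f \<longleftrightarrow> f \<in> borel_measurable M \<and> integrable M (\<lambda>t. (cmod (f t))\<^sup>2)"

lemma cmod_add_square_le: "(cmod (x + y))\<^sup>2 \<le> 2 * (cmod x)\<^sup>2 + 2 * (cmod y)\<^sup>2"
proof -
  have "(cmod (x + y))\<^sup>2 \<le> (cmod x + cmod y)\<^sup>2" by (intro power_mono norm_triangle_ineq) auto
  also have "\<dots> \<le> 2 * (cmod x)\<^sup>2 + 2 * (cmod y)\<^sup>2"
    using sum_squares_bound[of "cmod x" "cmod y"] by (simp add: power2_sum)
  finally show ?thesis .
qed

lemma square_integrable_diff:
  assumes "square_integrable M f" "square_integrable M h"
  shows "square_integrable M (\<lambda>t. f t - h t)"
  unfolding square_integrable_def
proof
  show "integrable M (\<lambda>t. (cmod (f t - h t))\<^sup>2)"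
  proof (rule Bochner_Integration.integrable_bound)
    show "integrable M (\<lambda>t. 2 * (cmod (f t))\<^sup>2 + 2 * (cmod (h t))\<^sup>2)"
      using assms by (simp add: square_integrable_def)
    show "AE t in M. norm ((cmod (f t - h t))\<^sup>2) \<le> norm (2 * (cmod (f t))\<^sup>2 + 2 * (cmod (h t))\<^sup>2)"
      using cmod_add_square_le[of "f _" "- h _"] by simp
  qed (use assms in \<open>auto simp: square_integrable_def\<close>)
qed (use assms in \<open>auto simp: square_integrable_def\<close>)

lemma square_integrable_mult:
  assumes "square_integrable M f" "square_integrable M h"
  shows "integrable M (\<lambda>t. f t * cnj (h t))"
proof (rule Bochner_Integration.integrable_bound)
  show "integrable M (\<lambda>t. (cmod (f t))\<^sup>2 + (cmod (h t))\<^sup>2)"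
    using assms by (simp add: square_integrable_def)
  have "cmod x * cmod y \<le> (cmod x)\<^sup>2 + (cmod y)\<^sup>2" for x y
  proof -
    have "0 \<le> cmod x * cmod y" by simp
    with sum_squares_bound[of "cmod x" "cmod y"] show ?thesis unfolding mult.assoc by linarith
  qed
  then show "AE t in M. norm (f t * cnj (h t)) \<le> norm ((cmod (f t))\<^sup>2 + (cmod (h t))\<^sup>2)"
    by (simp add: norm_mult)
  have "cnj \<in> borel_measurable borel" by (intro borel_measurable_continuous_onI continuous_intros)
  then show "(\<lambda>t. f t * cnj (h t)) \<in> borel_measurable M"
    using assms unfolding square_integrable_def by (intro borel_measurable_times measurable_compose[of h M borel cnj]) auto
qed

lemma integral_norm_minus_square:
  assumes f: "square_integrable M f" and h: "square_integrable M h"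
  shows "(LINT t|M. (cmod (f t - h t))\<^sup>2) =
     (LINT t|M. (cmod (f t))\<^sup>2) - 2 * Re (LINT t|M. f t * cnj (h t)) + (LINT t|M. (cmod (h t))\<^sup>2)"
proof -
  have i: "integrable M (\<lambda>t. (cmod (f t))\<^sup>2)" "integrable M (\<lambda>t. (cmod (h t))\<^sup>2)"
    "integrable M (\<lambda>t. f t * cnj (h t))"
    using f h square_integrable_mult[OF f h] by (auto simp: square_integrable_def)
  have eq: "(cmod (x - y))\<^sup>2 = (cmod x)\<^sup>2 - 2 * Re (x * cnj y) + (cmod y)\<^sup>2" for x y
    by (simp only: cmod_power2) (simp add: power2_eq_square algebra_simps)
  have "(LINT t|M. (cmod (f t - h t))\<^sup>2) = (LINT t|M. (cmod (f t))\<^sup>2 - 2 * Re (f t * cnj (h t)) + (cmod (h t))\<^sup>2)"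
    unfolding eq ..
  also have "\<dots> = (LINT t|M. (cmod (f t))\<^sup>2) - (LINT t|M. 2 * Re (f t * cnj (h t))) + (LINT t|M. (cmod (h t))\<^sup>2)"
  proof -
    have "integrable M (\<lambda>t. 2 * Re (f t * cnj (h t)))" by (intro integrable_mult_right integrable_Re i)
    then show ?thesis using i(1,2) by (simp del: times_complex.sel)
  qed
  also have "(LINT t|M. 2 * Re (f t * cnj (h t))) = 2 * Re (LINT t|M. f t * cnj (h t))"
    unfolding integral_mult_right_zero by (simp only: integral_Re[OF i(3)])
  finally show ?thesis .
qed

locale interval_fourier =
  fixes T :: real
  assumes T: "T > 0"
begin

abbreviation M :: "real measure" where "M \<equiv> lebesgue_on {0<..<T}"

definition e :: "int \<Rightarrow> real \<Rightarrow> complex" where "e n t = cis (2 * pi * of_int n * t / T)"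

sublocale finite_measure M
  by (rule finite_measure_lebesgue_on) (simp add: lmeasurable_interval)

lemma measurable_continuous: "continuous_on UNIV f \<Longrightarrow> f \<in> borel_measurable M"
  for f :: "real \<Rightarrow> 'b::topological_space"
  by (intro measurable_restrict_space1 measurable_completion) (simp add: borel_measurable_continuous_onI)

lemma e_measurable [measurable]: "e n \<in> borel_measurable M"
  unfolding e_def using T by (intro measurable_continuous continuous_intros) auto

lemma cmod_e [simp]: "cmod (e n t) = 1"
  by (simp add: e_def)

lemma square_integrable_bounded:
  assumes "f \<in> borel_measurable M" "\<And>t. cmod (f t) \<le> B"
  shows "square_integrable M f"
  unfolding square_integrable_def
proof
  show "integrable M (\<lambda>t. (cmod (f t))\<^sup>2)"
  proof (rule integrable_const_bound)
    show "AE t in M. norm ((cmod (f t))\<^sup>2) \<le> B\<^sup>2" using assms(2) by (simp add: power_mono)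
  qed (use assms(1) in auto)
qed (use assms in auto)

lemma integral_e: "(LINT t|M. e n t * cnj (e m t)) = (if n = m then of_real T else 0)"
proof -
  define k where "k = n - m"
  have eq: "e n t * cnj (e m t) = e k t" for t
    by (simp add: e_def k_def cis_cnj cis_mult diff_divide_distrib left_diff_distrib right_diff_distrib)
  have int: "e k absolutely_integrable_on {0..T}"
    unfolding e_def using T by (intro absolutely_integrable_continuous_real continuous_intros) auto
  have "(LINT t|M. e k t) = (LINT t:{0<..<T}|lebesgue. e k t)"
    by (simp add: integral_restrict_space set_lebesgue_integral_def)
  also have "\<dots> = (LINT t:{0..T}|lebesgue. e k t)"
  proof -
    have em: "e k \<in> borel_measurable lebesgue"
      unfolding e_def using T
      by (intro measurable_completion) (auto intro!: borel_measurable_continuous_onI continuous_intros)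
    have "AE t in lebesgue. t \<in> {0<..<T} \<longleftrightarrow> t \<in> {0..T}"
      by (rule AE_I'[of "{0, T}"]) (auto intro: null_sets_completionI finite_imp_null_set_lborel)
    then show ?thesis
      by (intro set_integral_cong_set)
         (auto simp: set_borel_measurable_def intro!: borel_measurable_scaleR borel_measurable_indicator em)
  qed
  also have "\<dots> = integral {0..T} (e k)" by (rule set_lebesgue_integral_eq_integral(2)[OF int])
  also have "\<dots> = (if n = m then of_real T else 0)"
  proof (cases "k = 0")
    case True
    then have "e k = (\<lambda>_. 1)" by (intro ext) (simp add: e_def)
    then show ?thesis using T True by (simp add: k_def scaleR_conv_of_real)
  next
    case False
    define \<omega> where "\<omega> = 2 * pi * of_int k / T"
    have \<omega>: "\<omega> \<noteq> 0" using False T by (simp add: \<omega>_def)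
    have ek: "e k = (\<lambda>t. cis (\<omega> * t))" by (intro ext) (simp add: e_def \<omega>_def)
    have "(e k has_integral (cis (\<omega> * T) / (\<i> * of_real \<omega>) - cis (\<omega> * 0) / (\<i> * of_real \<omega>))) {0..T}"
      unfolding ek
    proof (rule fundamental_theorem_of_calculus)
      fix t
      have "((\<lambda>t. exp (\<i> * of_real \<omega> * of_real t) / (\<i> * of_real \<omega>)) has_vector_derivative exp (\<i> * of_real \<omega> * of_real t)) (at t within {0..T})"
        using \<omega> by (auto intro!: has_vector_derivative_real_field derivative_eq_intros)
      then show "((\<lambda>t. cis (\<omega> * t) / (\<i> * of_real \<omega>)) has_vector_derivative cis (\<omega> * t)) (at t within {0..T})"
        by (simp add: cis_conv_exp mult_ac)
    qed (use T in simp)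
    moreover have "cis (\<omega> * T) = 1"
    proof -
      have "\<omega> * T = 2 * pi * of_int k" using T by (simp add: \<omega>_def)
      then show ?thesis by (simp add: cis_multiple_2pi)
    qed
    ultimately have "(e k has_integral 0) {0..T}" by simp
    then show ?thesis using False by (simp add: integral_unique k_def)
  qed
  finally show ?thesis by (simp add: eq)
qed

text \<open>Not normalized: \<open>e n\<close> has squared norm \<open>T\<close>, which is the
  origin of the factor \<open>T\<close> in \<open>parseval\<close>.\<close>

definition coeff :: "(real \<Rightarrow> complex) \<Rightarrow> int \<Rightarrow> complex" where
  "coeff f n = (LINT t|M. f t * cnj (e n t))"

lemma square_integrable_e_sum:
  "finite S \<Longrightarrow> square_integrable M (\<lambda>t. \<Sum>n\<in>S. a n * e n t)"
proof (rule square_integrable_bounded)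
  show "cmod (\<Sum>n\<in>S. a n * e n t) \<le> (\<Sum>n\<in>S. cmod (a n))" for t
    by (rule sum_norm_le) (simp add: norm_mult)
qed simp

lemma square_integrable_e: "square_integrable M (e n)"
  by (rule square_integrable_bounded[of _ 1]) auto

text \<open>Completing the square in the \<open>a n\<close>. The optimal choice gives Bessel's
  inequality, and any good approximation gives the reverse one.\<close>

lemma integral_minus_e_sum:
  assumes f: "square_integrable M f" and S: "finite S"
  shows "(LINT t|M. (cmod (f t - (\<Sum>n\<in>S. a n * e n t)))\<^sup>2) =
     (LINT t|M. (cmod (f t))\<^sup>2) - (\<Sum>n\<in>S. (cmod (coeff f n))\<^sup>2) / T + (\<Sum>n\<in>S. (cmod (of_real T * a n - coeff f n))\<^sup>2) / T"
proof -
  define u where "u t = (\<Sum>n\<in>S. a n * e n t)" for t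
  have u: "square_integrable M u" unfolding u_def by (rule square_integrable_e_sum[OF S])
  have fe: "integrable M (\<lambda>t. f t * cnj (e n t))" for n
    by (rule square_integrable_mult[OF f square_integrable_e])
  have "(LINT t|M. f t * cnj (u t)) = (LINT t|M. (\<Sum>n\<in>S. cnj (a n) * (f t * cnj (e n t))))"
    by (simp add: u_def sum_distrib_left mult_ac)
  also have "\<dots> = (\<Sum>n\<in>S. cnj (a n) * coeff f n)"
    using fe by (subst Bochner_Integration.integral_sum) (auto simp: coeff_def)
  finally have fu: "(LINT t|M. f t * cnj (u t)) = (\<Sum>n\<in>S. cnj (a n) * coeff f n)" .
  have "of_real (LINT t|M. (cmod (u t))\<^sup>2) = (LINT t|M. u t * cnj (u t))"
    unfolding complex_norm_square[symmetric] integral_complex_of_real ..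
  also have "\<dots> = (LINT t|M. (\<Sum>n\<in>S. \<Sum>m\<in>S. (a n * cnj (a m)) * (e n t * cnj (e m t))))"
    by (simp add: u_def sum_product mult_ac)
  also have "\<dots> = (\<Sum>n\<in>S. \<Sum>m\<in>S. (a n * cnj (a m)) * (LINT t|M. e n t * cnj (e m t)))"
    using square_integrable_mult[OF square_integrable_e square_integrable_e]
    by (subst Bochner_Integration.integral_sum) (auto intro!: sum.cong Bochner_Integration.integrable_sum)
  also have "\<dots> = (\<Sum>n\<in>S. (a n * cnj (a n)) * of_real T)"
    unfolding integral_e using S by (simp add: if_distrib cong: if_cong)
  also have "\<dots> = of_real (\<Sum>n\<in>S. T * (cmod (a n))\<^sup>2)"
    by (simp add: complex_norm_square[symmetric] mult.commute)
  finally have uu: "(LINT t|M. (cmod (u t))\<^sup>2) = (\<Sum>n\<in>S. T * (cmod (a n))\<^sup>2)" by (simp only: of_real_eq_iff)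
  have sq: "(cmod (of_real T * x - y))\<^sup>2 / T = T * (cmod x)\<^sup>2 - 2 * Re (cnj x * y) + (cmod y)\<^sup>2 / T" for x y
  proof -
    have "(cmod (of_real T * x - y))\<^sup>2 = T\<^sup>2 * (cmod x)\<^sup>2 - 2 * T * Re (cnj x * y) + (cmod y)\<^sup>2"
      by (simp only: cmod_power2) (simp add: power2_eq_square algebra_simps)
    then show ?thesis using T by (simp add: power2_eq_square add_divide_distrib diff_divide_distrib)
  qed
  have "(\<Sum>n\<in>S. (cmod (of_real T * a n - coeff f n))\<^sup>2) / T =
      (\<Sum>n\<in>S. T * (cmod (a n))\<^sup>2) - 2 * Re (\<Sum>n\<in>S. cnj (a n) * coeff f n) + (\<Sum>n\<in>S. (cmod (coeff f n))\<^sup>2) / T"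
    unfolding sum_divide_distrib sq by (simp add: sum.distrib sum_subtractf sum_distrib_left Re_sum)
  then show ?thesis
    using integral_norm_minus_square[OF f u] unfolding fu uu by (simp add: u_def)
qed

text \<open>Membership in the closed linear span of the exponentials in L2.\<close>

definition approximable :: "(real \<Rightarrow> complex) \<Rightarrow> bool" where
  "approximable f \<longleftrightarrow> square_integrable M f \<and>
    (\<forall>\<epsilon>>0. \<exists>S a. finite S \<and> (LINT t|M. (cmod (f t - (\<Sum>n\<in>S. a n * e n t)))\<^sup>2) < \<epsilon>)"

lemma approximable_closed:
  assumes f: "square_integrable M f" and h: "\<And>k. approximable (h k)"
    and lim: "(\<lambda>k. LINT t|M. (cmod (f t - h k t))\<^sup>2) \<longlonglongrightarrow> 0"
  shows "approximable f"
  unfolding approximable_def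
proof (intro conjI f allI impI)
  fix \<epsilon> :: real assume \<epsilon>: "\<epsilon> > 0"
  then have "\<forall>\<^sub>F k in sequentially. (LINT t|M. (cmod (f t - h k t))\<^sup>2) < \<epsilon> / 4"
    by (intro order_tendstoD(2)[OF lim]) simp
  then obtain k where k: "(LINT t|M. (cmod (f t - h k t))\<^sup>2) < \<epsilon> / 4"
    by (metis (no_types, lifting) eventually_happens trivial_limit_sequentially)
  have hk: "square_integrable M (h k)" using h by (simp add: approximable_def)
  have "\<epsilon> / 4 > 0" using \<epsilon> by simp
  then obtain S a where Sa: "finite S" "(LINT t|M. (cmod (h k t - (\<Sum>n\<in>S. a n * e n t)))\<^sup>2) < \<epsilon> / 4"
    using h[of k] unfolding approximable_def by blast
  define u where "u t = (\<Sum>n\<in>S. a n * e n t)" for t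
  have u: "square_integrable M u" unfolding u_def by (rule square_integrable_e_sum[OF Sa(1)])
  have i: "integrable M (\<lambda>t. (cmod (f t - u t))\<^sup>2)" "integrable M (\<lambda>t. (cmod (f t - h k t))\<^sup>2)"
    "integrable M (\<lambda>t. (cmod (h k t - u t))\<^sup>2)"
    using square_integrable_diff[OF f u] square_integrable_diff[OF f hk] square_integrable_diff[OF hk u]
    by (auto simp: square_integrable_def)
  have "(LINT t|M. (cmod (f t - u t))\<^sup>2) \<le> (LINT t|M. 2 * (cmod (f t - h k t))\<^sup>2 + 2 * (cmod (h k t - u t))\<^sup>2)"
  proof (rule integral_mono)
    show "(cmod (f t - u t))\<^sup>2 \<le> 2 * (cmod (f t - h k t))\<^sup>2 + 2 * (cmod (h k t - u t))\<^sup>2" for t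
      using cmod_add_square_le[of "f t - h k t" "h k t - u t"] by simp
  qed (use i in auto)
  also have "\<dots> = 2 * (LINT t|M. (cmod (f t - h k t))\<^sup>2) + 2 * (LINT t|M. (cmod (h k t - u t))\<^sup>2)"
    using i by simp
  also have "\<dots> < \<epsilon>" using k Sa(2) by (simp add: u_def)
  finally show "\<exists>S a. finite S \<and> (LINT t|M. (cmod (f t - (\<Sum>n\<in>S. a n * e n t)))\<^sup>2) < \<epsilon>"
    using Sa(1) by (auto simp: u_def)
qed

lemma bounded_convergence_L2:
  assumes f: "f \<in> borel_measurable M" and h: "\<And>k. h k \<in> borel_measurable M"
    and B: "\<And>k t. cmod (h k t) \<le> B" "\<And>t. cmod (f t) \<le> B"
    and lim: "AE t in M. (\<lambda>k. h k t) \<longlonglongrightarrow> f t"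
  shows "(\<lambda>k. LINT t|M. (cmod (f t - h k t))\<^sup>2) \<longlonglongrightarrow> 0"
proof -
  have "(\<lambda>k. LINT t|M. (cmod (f t - h k t))\<^sup>2) \<longlonglongrightarrow> (LINT t|M. 0)"
  proof (rule integral_dominated_convergence)
    show "integrable M (\<lambda>_. (B + B)\<^sup>2)" by simp
    show "AE t in M. (\<lambda>k. (cmod (f t - h k t))\<^sup>2) \<longlonglongrightarrow> 0"
      using lim
    proof eventually_elim
      case (elim t)
      have "(\<lambda>k. (cmod (f t - h k t))\<^sup>2) \<longlonglongrightarrow> (cmod (f t - f t))\<^sup>2" by (intro tendsto_intros elim)
      then show ?case by simp
    qed
    fix k
    have "cmod (f t - h k t) \<le> B + B" for t
      using norm_triangle_ineq4[of "f t" "h k t"] B(1)[of k t] B(2)[of t] by linarith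
    then have "(cmod (f t - h k t))\<^sup>2 \<le> (B + B)\<^sup>2" for t by (intro power_mono) auto
    moreover have "norm ((cmod z)\<^sup>2) = (cmod z)\<^sup>2" for z :: complex by simp
    ultimately show "AE t in M. norm ((cmod (f t - h k t))\<^sup>2) \<le> (B + B)\<^sup>2" by (intro AE_I2) (simp only:)
  qed (use f h in measurable)
  then show ?thesis by simp
qed

lemma approximable_continuous:
  assumes w: "continuous_on UNIV w" "w 0 = w T" "\<And>t. cmod (w t) \<le> B"
  shows "approximable w"
  unfolding approximable_def
proof (intro conjI allI impI)
  show sw: "square_integrable M w" using w by (intro square_integrable_bounded measurable_continuous)
  fix \<epsilon> :: real assume \<epsilon>: "\<epsilon> > 0"
  define \<eta> where "\<eta> = sqrt (\<epsilon> / (2 * T))"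
  have \<eta>: "\<eta> > 0" "\<eta>\<^sup>2 * T < \<epsilon>" using \<epsilon> T by (auto simp: \<eta>_def)
  obtain u where u: "trig_poly u" "\<And>t. t \<in> {0..T} \<Longrightarrow> cmod (w t - u (2 * pi * t / T)) < \<eta>"
    using trig_poly_uniform_approximation[OF T _ w(2) \<eta>(1)] w(1) continuous_on_subset by blast
  obtain S a where Sa: "finite S" "u = (\<lambda>t. \<Sum>n\<in>S. a n * cis (of_int n * t))"
    using trig_poly_finite_sum[OF u(1)] by blast
  have ue: "u (2 * pi * t / T) = (\<Sum>n\<in>S. a n * e n t)" for t
    by (simp add: Sa(2) e_def mult_ac)
  have "(LINT t|M. (cmod (w t - (\<Sum>n\<in>S. a n * e n t)))\<^sup>2) \<le> (LINT t|M. \<eta>\<^sup>2)"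
  proof (rule integral_mono)
    show "integrable M (\<lambda>t. (cmod (w t - (\<Sum>n\<in>S. a n * e n t)))\<^sup>2)"
      using square_integrable_diff[OF sw square_integrable_e_sum[OF Sa(1)]] by (simp add: square_integrable_def)
    fix t assume "t \<in> space M"
    then have "t \<in> {0..T}" by auto
    then show "(cmod (w t - (\<Sum>n\<in>S. a n * e n t)))\<^sup>2 \<le> \<eta>\<^sup>2"
      using u(2)[of t] by (intro power_mono) (auto simp: ue)
  qed simp
  also have "\<dots> = \<eta>\<^sup>2 * T" using T by (simp add: measure_restrict_space)
  finally show "\<exists>S a. finite S \<and> (LINT t|M. (cmod (w t - (\<Sum>n\<in>S. a n * e n t)))\<^sup>2) < \<epsilon>"
    using Sa(1) \<eta>(2) by (meson order_le_less_trans)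
qed

text \<open>A measurable function is an almost everywhere limit of continuous ones. Clipping these
  to the ball of radius \<open>B\<close> gives a common bound, and a cutoff makes their end values
  agree, as the approximation on the circle requires.\<close>

lemma approximable_bounded:
  assumes f: "f \<in> borel_measurable lebesgue" and B: "\<And>t. cmod (f t) \<le> B" "B > 0"
  shows "approximable f"
proof -
  have "f measurable_on UNIV" using f by (rule lebesgue_measurable_imp_measurable_on) simp
  then obtain N g where N: "negligible N" and g: "\<And>n. continuous_on UNIV (g n)"
    and lim: "\<And>x. x \<notin> N \<Longrightarrow> (\<lambda>n. g n x) \<longlonglongrightarrow> f x"
    unfolding measurable_on_def by auto
  define cl where "cl z = z / of_real (max 1 (cmod z / B))" for z :: complex
  \<comment> \<open>A trapezoid that vanishes at 0 and \<open>T\<close> and equals 1 at each inner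
    point for large \<open>k\<close>.\<close>
  define ch where "ch k t = max 0 (min 1 (min (of_nat k * t) (of_nat k * (T - t))))" for k :: nat and t
  define h where "h k t = cl (g k t) * of_real (ch k t)" for k t
  have max0: "max 1 (cmod z / B) > 0" for z :: complex
    by (simp add: less_max_iff_disj)
  have cl_cont: "continuous_on UNIV cl" unfolding cl_def
    using less_imp_neq[OF max0] B(2) by (intro continuous_intros) (auto dest: sym)
  have cl_bound: "cmod (cl z) \<le> B" for z
  proof -
    have "cmod z / B \<le> max 1 (cmod z / B)" by simp
    then have "cmod z \<le> B * max 1 (cmod z / B)" using B(2) by (simp only: pos_divide_le_eq mult.commute)
    then show ?thesis using max0[of z] by (simp add: cl_def norm_divide pos_divide_le_eq)
  qed
  have ch01: "0 \<le> ch k t" "ch k t \<le> 1" for k t by (auto simp: ch_def)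
  have hb: "cmod (h k t) \<le> B" for k t
  proof -
    have "cmod (h k t) = cmod (cl (g k t)) * ch k t" using ch01 by (simp add: h_def norm_mult)
    also have "\<dots> \<le> B * 1" using cl_bound ch01 B(2) by (intro mult_mono) auto
    finally show ?thesis by simp
  qed
  have hc: "continuous_on UNIV (h k)" for k
    unfolding h_def ch_def
    by (intro continuous_intros continuous_on_compose2[OF cl_cont g]) auto
  show ?thesis
  proof (rule approximable_closed)
    have fM: "f \<in> borel_measurable M" using f by (rule measurable_restrict_space1)
    show "square_integrable M f" using fM B(1) by (rule square_integrable_bounded)
    show "approximable (h k)" for k
      by (rule approximable_continuous[OF hc _ hb]) (simp add: h_def ch_def)
    show "(\<lambda>k. LINT t|M. (cmod (f t - h k t))\<^sup>2) \<longlonglongrightarrow> 0"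
    proof (rule bounded_convergence_L2[OF fM _ hb B(1)])
      show "h k \<in> borel_measurable M" for k by (rule measurable_continuous[OF hc])
      have "AE t in lebesgue. t \<notin> N" using N by (simp add: negligible_iff_null_sets AE_not_in)
      then have "AE t in lebesgue. t \<in> {0<..<T} \<longrightarrow> (\<lambda>k. h k t) \<longlonglongrightarrow> f t"
      proof eventually_elim
        case (elim t)
        show ?case
        proof
          assume t: "t \<in> {0<..<T}"
          have "(\<lambda>k. cl (g k t)) \<longlonglongrightarrow> cl (f t)"
            using cl_cont lim[OF elim] by (metis UNIV_I continuous_on_eq_continuous_at isCont_tendsto_compose open_UNIV)
          moreover have "cl (f t) = f t"
          proof -
            have "cmod (f t) / B \<le> 1" using B by simp
            then have "max 1 (cmod (f t) / B) = 1" by (rule max_absorb1)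
            then show ?thesis by (simp add: cl_def)
          qed
          moreover have "(\<lambda>k. ch k t) \<longlonglongrightarrow> 1"
          proof (rule tendsto_eventually)
            obtain k0 :: nat where k0: "max (1 / t) (1 / (T - t)) < of_nat k0" using reals_Archimedean2 by blast
            show "\<forall>\<^sub>F k in sequentially. ch k t = 1"
              using eventually_ge_at_top[of k0]
            proof eventually_elim
              case (elim k)
              then have "real k0 \<le> real k" by simp
              then have "1 / t < real k" "1 / (T - t) < real k" using k0 by auto
              then have "1 \<le> real k * t" "1 \<le> real k * (T - t)" using t by (simp_all add: field_simps)
              then show ?case by (simp add: ch_def)
            qed
          qed
          then have "(\<lambda>k. complex_of_real (ch k t)) \<longlonglongrightarrow> of_real 1" by (rule tendsto_of_real)
          ultimately show "(\<lambda>k. h k t) \<longlonglongrightarrow> f t" unfolding h_def using tendsto_mult by fastforce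
        qed
      qed
      then show "AE t in M. (\<lambda>k. h k t) \<longlonglongrightarrow> f t" by (simp add: AE_restrict_space_iff)
    qed
  qed
qed

lemma approximable_square_integrable:
  assumes f: "f \<in> borel_measurable lebesgue" "square_integrable M f"
  shows "approximable f"
proof (rule approximable_closed[OF f(2)])
  define h where "h k t = (if cmod (f t) \<le> of_nat k then f t else 0)" for k :: nat and t
  have hm: "h k \<in> borel_measurable lebesgue" for k unfolding h_def using f(1) by measurable
  show "approximable (h k)" for k
    by (rule approximable_bounded[OF hm, of _ "of_nat k + 1"]) (auto simp: h_def)
  have "(\<lambda>k. LINT t|M. (cmod (f t - h k t))\<^sup>2) \<longlonglongrightarrow> (LINT t|M. 0)"
  proof (rule integral_dominated_convergence)
    show "integrable M (\<lambda>t. (cmod (f t))\<^sup>2)" using f(2) by (simp add: square_integrable_def)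
    show "AE t in M. norm ((cmod (f t - h k t))\<^sup>2) \<le> (cmod (f t))\<^sup>2" for k by (simp add: h_def)
    show "AE t in M. (\<lambda>k. (cmod (f t - h k t))\<^sup>2) \<longlonglongrightarrow> 0"
    proof (rule AE_I2, rule tendsto_eventually)
      fix t
      obtain k0 :: nat where "cmod (f t) \<le> of_nat k0" using real_arch_simple by blast
      then have "(cmod (f t - h k t))\<^sup>2 = 0" if "k \<ge> k0" for k
        using that of_nat_mono[OF that, where 'a = real] by (simp add: h_def)
      then show "\<forall>\<^sub>F k in sequentially. (cmod (f t - h k t))\<^sup>2 = 0"
        by (rule eventually_sequentiallyI)
    qed
    show "(\<lambda>t. (cmod (f t - h k t))\<^sup>2) \<in> borel_measurable M" for k
      using measurable_restrict_space1[OF f(1)] measurable_restrict_space1[OF hm] by measurable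
  qed simp
  then show "(\<lambda>k. LINT t|M. (cmod (f t - h k t))\<^sup>2) \<longlonglongrightarrow> 0" by simp
qed

theorem parseval:
  assumes f: "f \<in> borel_measurable lebesgue" "square_integrable M f"
  shows "((\<lambda>n. (cmod (coeff f n))\<^sup>2) has_sum (T * (LINT t|M. (cmod (f t))\<^sup>2))) UNIV"
proof -
  define I where "I = (LINT t|M. (cmod (f t))\<^sup>2)"
  have nn: "0 \<le> (LINT t|M. (cmod (f t - (\<Sum>n\<in>S. a n * e n t)))\<^sup>2)" for S a by simp
  have bessel: "(\<Sum>n\<in>S. (cmod (coeff f n))\<^sup>2) \<le> T * I" if "finite S" for S
  proof -
    have "(\<Sum>n\<in>S. (cmod (of_real T * (coeff f n / of_real T) - coeff f n))\<^sup>2) = 0"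
      using T by (intro sum.neutral) simp
    then have "0 \<le> I - (\<Sum>n\<in>S. (cmod (coeff f n))\<^sup>2) / T"
      using integral_minus_e_sum[OF f(2) that, of "\<lambda>n. coeff f n / of_real T"] nn[where S = S and a = "\<lambda>n. coeff f n / of_real T"]
      by (simp add: I_def)
    then show ?thesis using T by (simp add: field_simps)
  qed
  have sm: "(\<lambda>n. (cmod (coeff f n))\<^sup>2) summable_on UNIV"
    by (rule nonneg_bdd_above_summable_on) (auto intro!: bdd_aboveI[of _ "T * I"] bessel)
  have "infsum (\<lambda>n. (cmod (coeff f n))\<^sup>2) UNIV = T * I"
  proof (rule antisym)
    show "infsum (\<lambda>n. (cmod (coeff f n))\<^sup>2) UNIV \<le> T * I"
      by (rule infsum_le_finite_sums[OF sm]) (rule bessel)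
    show "T * I \<le> infsum (\<lambda>n. (cmod (coeff f n))\<^sup>2) UNIV"
    proof (rule field_le_epsilon)
      fix \<epsilon> :: real assume "\<epsilon> > 0"
      then have "\<epsilon> / T > 0" using T by simp
      then obtain S a where Sa: "finite S" "(LINT t|M. (cmod (f t - (\<Sum>n\<in>S. a n * e n t)))\<^sup>2) < \<epsilon> / T"
        using approximable_square_integrable[OF f] unfolding approximable_def by blast
      have "0 \<le> (\<Sum>n\<in>S. (cmod (of_real T * a n - coeff f n))\<^sup>2) / T" using T by (intro divide_nonneg_pos sum_nonneg) auto
      then have "I - (\<Sum>n\<in>S. (cmod (coeff f n))\<^sup>2) / T < \<epsilon> / T"
        using Sa(2) integral_minus_e_sum[OF f(2) Sa(1), of a] by (simp add: I_def)
      then have "T * (I - (\<Sum>n\<in>S. (cmod (coeff f n))\<^sup>2) / T) < T * (\<epsilon> / T)" using T by (intro mult_strict_left_mono)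
      then have "T * I < (\<Sum>n\<in>S. (cmod (coeff f n))\<^sup>2) + \<epsilon>" using T by (simp add: right_diff_distrib)
      moreover have "(\<Sum>n\<in>S. (cmod (coeff f n))\<^sup>2) \<le> infsum (\<lambda>n. (cmod (coeff f n))\<^sup>2) UNIV"
        by (rule finite_sum_le_infsum[OF sm Sa(1)]) auto
      ultimately show "T * I \<le> infsum (\<lambda>n. (cmod (coeff f n))\<^sup>2) UNIV + \<epsilon>" by simp
    qed
  qed
  with has_sum_infsum[OF sm] show ?thesis by (simp add: I_def)
qed

end

section \<open>The frame inequality\<close>

lemma lebesgue_translate_measurable [measurable]: "(\<lambda>x::real. t + x) \<in> lebesgue \<rightarrow>\<^sub>M lebesgue"
  using lebesgue_affine_measurable[of "\<lambda>_. 1" t] by simp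

lemma distr_lebesgue_translate: "distr lebesgue lebesgue (\<lambda>x::real. t + x) = lebesgue"
  using lebesgue_real_affine[of 1 t] by (simp add: density_1)

lemma borel_measurable_lebesgue_translate:
  "f \<in> borel_measurable lebesgue \<Longrightarrow> (\<lambda>x::real. f (x + t)) \<in> borel_measurable lebesgue"
  using measurable_compose[OF lebesgue_translate_measurable, of f borel t] by (simp add: add.commute)

lemma set_integral_translate:
  fixes f :: "real \<Rightarrow> 'b::{banach, second_countable_topology}"
  assumes f: "f \<in> borel_measurable lebesgue" and A: "A \<in> sets lebesgue"
  shows "set_integrable lebesgue {x. x + t \<in> A} (\<lambda>x. f (x + t)) \<longleftrightarrow> set_integrable lebesgue A f"
    and "(LINT x:{x. x + t \<in> A}|lebesgue. f (x + t)) = (LINT x:A|lebesgue. f x)"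
proof -
  define \<phi> where "\<phi> x = indicator A x *\<^sub>R f x" for x
  have \<phi>: "\<phi> \<in> borel_measurable lebesgue" unfolding \<phi>_def using f A by measurable
  have eq: "indicator {x. x + t \<in> A} x *\<^sub>R f (x + t) = \<phi> (t + x)" for x
    by (simp add: \<phi>_def indicator_def add.commute)
  show "set_integrable lebesgue {x. x + t \<in> A} (\<lambda>x. f (x + t)) \<longleftrightarrow> set_integrable lebesgue A f"
    using integrable_distr_eq[OF lebesgue_translate_measurable \<phi>, of t]
    unfolding distr_lebesgue_translate set_integrable_def eq \<phi>_def[symmetric] by simp
  show "(LINT x:{x. x + t \<in> A}|lebesgue. f (x + t)) = (LINT x:A|lebesgue. f x)"
    using integral_distr[OF lebesgue_translate_measurable \<phi>, of t]
    unfolding distr_lebesgue_translate set_lebesgue_integral_def eq \<phi>_def[symmetric] by simp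
qed

lemma set_integral_Ico_translate:
  fixes f :: "real \<Rightarrow> 'b::{banach, second_countable_topology}"
  assumes "f \<in> borel_measurable lebesgue"
  shows "set_integrable lebesgue {u..<w} (\<lambda>x. f (x + t)) \<longleftrightarrow> set_integrable lebesgue {u + t..<w + t} f"
    and "(LINT x:{u..<w}|lebesgue. f (x + t)) = (LINT x:{u + t..<w + t}|lebesgue. f x)"
proof -
  have "{x. x + t \<in> {u + t..<w + t}} = {u..<w}" by auto
  with set_integral_translate[OF assms, of "{u + t..<w + t}" t]
  show "set_integrable lebesgue {u..<w} (\<lambda>x. f (x + t)) \<longleftrightarrow> set_integrable lebesgue {u + t..<w + t} f"
    "(LINT x:{u..<w}|lebesgue. f (x + t)) = (LINT x:{u + t..<w + t}|lebesgue. f x)" by simp_all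
qed

lemma set_integral_Ioo_Ico:
  fixes f :: "real \<Rightarrow> 'b::{banach, second_countable_topology}"
  assumes f: "f \<in> borel_measurable lebesgue"
  shows "set_integrable lebesgue {u<..<w} f \<longleftrightarrow> set_integrable lebesgue {u..<w} f"
    and "(LINT x:{u<..<w}|lebesgue. f x) = (LINT x:{u..<w}|lebesgue. f x)"
proof -
  have "AE x in lebesgue. x \<noteq> u"
    by (rule AE_I'[of "{u}"]) (auto intro: null_sets_completionI finite_imp_null_set_lborel)
  then have AE: "AE x in lebesgue. indicator {u<..<w} x *\<^sub>R f x = indicator {u..<w} x *\<^sub>R f x"
    by eventually_elim (auto simp: indicator_def)
  have m: "(\<lambda>x. indicator A x *\<^sub>R f x) \<in> borel_measurable lebesgue" if "A \<in> sets lebesgue" for A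
    using f that by measurable
  show "set_integrable lebesgue {u<..<w} f \<longleftrightarrow> set_integrable lebesgue {u..<w} f"
    unfolding set_integrable_def by (rule integrable_cong_AE[OF m m AE]) simp_all
  show "(LINT x:{u<..<w}|lebesgue. f x) = (LINT x:{u..<w}|lebesgue. f x)"
    unfolding set_lebesgue_integral_def by (rule integral_cong_AE[OF m m AE]) simp_all
qed

text \<open>Half-open cells tile exactly, so the induction runs over those; the open intervals in
  the statement differ from them by null sets.\<close>

lemma set_integral_cells:
  fixes f :: "real \<Rightarrow> 'b::{banach, second_countable_topology}"
  assumes f: "f \<in> borel_measurable lebesgue" and h: "h > 0"
    and int: "set_integrable lebesgue {0<..<of_nat L * h} f"
  shows "(LINT t:{0<..<of_nat L * h}|lebesgue. f t) = (LINT s:{0<..<h}|lebesgue. (\<Sum>l<L. f (s + of_nat l * h)))"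
proof -
  have cell: "set_integrable lebesgue {0..<h} (\<lambda>s. f (s + of_nat l * h))" if "l < L" for l
  proof -
    have "(of_nat l + 1) * h \<le> of_nat L * h" using that h by (intro mult_right_mono) auto
    moreover have "0 \<le> of_nat l * h" using h by simp
    ultimately have sub: "{of_nat l * h..<h + of_nat l * h} \<subseteq> {0..<of_nat L * h}"
      by (intro ivl_subset[THEN iffD2] disjI2 conjI) (simp_all add: distrib_right)
    have "set_integrable lebesgue {0..<of_nat L * h} f"
      using int set_integral_Ioo_Ico(1)[OF f] by blast
    then have "set_integrable lebesgue {of_nat l * h..<h + of_nat l * h} f"
      by (rule set_integrable_subset) (use sub in auto)
    then show ?thesis using set_integral_Ico_translate(1)[OF f, of 0 h "of_nat l * h"] by simp
  qed
  have "(LINT t:{0..<of_nat L * h}|lebesgue. f t) = (\<Sum>l<L. LINT s:{0..<h}|lebesgue. f (s + of_nat l * h))"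
    using int[unfolded set_integral_Ioo_Ico(1)[OF f]]
  proof (induction L)
    case (Suc L)
    have nn: "0 \<le> of_nat L * h" using h by simp
    have eq: "{0..<of_nat (Suc L) * h} = {0..<of_nat L * h} \<union> {of_nat L * h..<h + of_nat L * h}"
      using nn h by (auto simp: distrib_right intro: order_trans[OF nn])
    have i: "set_integrable lebesgue {0..<of_nat L * h} f" "set_integrable lebesgue {of_nat L * h..<h + of_nat L * h} f"
      by (rule set_integrable_subset[OF Suc.prems[unfolded eq]], simp, blast)+
    have "(LINT t:{0..<of_nat (Suc L) * h}|lebesgue. f t) =
        (LINT t:{0..<of_nat L * h}|lebesgue. f t) + (LINT t:{of_nat L * h..<h + of_nat L * h}|lebesgue. f t)"
      unfolding eq by (rule set_integral_Un[OF _ i]) auto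
    also have "(LINT t:{of_nat L * h..<h + of_nat L * h}|lebesgue. f t) = (LINT s:{0..<h}|lebesgue. f (s + of_nat L * h))"
      using set_integral_Ico_translate(2)[OF f, of 0 h "of_nat L * h"] by simp
    finally show ?case using Suc.IH[OF i(1)] by simp
  qed (simp add: set_lebesgue_integral_def)
  also have "\<dots> = (LINT s:{0..<h}|lebesgue. (\<Sum>l<L. f (s + of_nat l * h)))"
    unfolding set_lebesgue_integral_def scaleR_sum_right
    using cell by (subst Bochner_Integration.integral_sum) (auto simp: set_integrable_def)
  also have "\<dots> = (LINT s:{0<..<h}|lebesgue. (\<Sum>l<L. f (s + of_nat l * h)))"
    using f by (intro set_integral_Ioo_Ico(2)[symmetric] borel_measurable_sum borel_measurable_lebesgue_translate)
  finally show ?thesis using set_integral_Ioo_Ico(2)[OF f, of 0] by simp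
qed

lemma infsum_residue_classes:
  fixes F :: "int \<Rightarrow> complex"
  assumes F: "F summable_on UNIV" and N: "N > 0"
  shows "infsum F UNIV = (\<Sum>l<N. \<Sum>\<^sub>\<infinity>k\<in>(UNIV::int set). F (int l + k * int N))"
proof -
  have bij: "bij_betw (\<lambda>(l, k). int l + k * int N) ({..<N} \<times> UNIV) UNIV"
    by (rule bij_betw_byWitness[where f' = "\<lambda>m. (nat (m mod int N), m div int N)"])
       (use N in \<open>auto simp: nat_less_iff\<close>)
  have s: "(\<lambda>(l, k). F (int l + k * int N)) summable_on ({..<N} \<times> UNIV)"
    using F summable_on_reindex_bij_betw[OF bij, of F] by (simp add: case_prod_unfold)
  have "infsum F UNIV = infsum (\<lambda>(l, k). F (int l + k * int N)) ({..<N} \<times> UNIV)"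
    using infsum_reindex_bij_betw[OF bij, of F] by (simp add: case_prod_unfold)
  also have "\<dots> = (\<Sum>\<^sub>\<infinity>l\<in>{..<N}. \<Sum>\<^sub>\<infinity>k\<in>(UNIV::int set). F (int l + k * int N))"
    using infsum_Sigma'_banach[OF s] by simp
  finally show ?thesis by simp
qed

lemma borel_measurable_infsum_int:
  fixes \<phi> :: "int \<Rightarrow> real \<Rightarrow> complex"
  assumes "\<And>k. \<phi> k \<in> borel_measurable lebesgue" "\<And>t. (\<lambda>k. norm (\<phi> k t)) summable_on UNIV"
  shows "(\<lambda>t. \<Sum>\<^sub>\<infinity>k\<in>(UNIV::int set). \<phi> k t) \<in> borel_measurable lebesgue"
  unfolding infsum_int_eq_suminf[OF assms(2)] using assms(1) by (intro borel_measurable_suminf)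

text \<open>The comb of the constant sequence is \<open>h\<close>-periodic, and on one period the
  decay bound is uniform.\<close>

lemma (in tp_decay) comb_one_bounded:
  assumes h: "h > 0"
  shows "\<exists>G>0. \<forall>t. comb g h (\<lambda>_. 1) t \<le> G"
proof -
  define b where "b k = C * exp (a * h) * exp (- (a * h) * \<bar>of_int k\<bar>)" for k :: int
  have b: "b summable_on UNIV" unfolding b_def
    by (intro summable_on_cmult_right summable_on_int_exp) (use a_pos h in auto)
  have "comb g h (\<lambda>_. 1) t \<le> infsum b UNIV" for t
  proof -
    define m where "m = \<lfloor>t / h\<rfloor>"
    define t' where "t' = t - of_int m * h"
    have "of_int m \<le> t / h" "t / h < of_int m + 1" unfolding m_def by linarith+
    then have t': "0 \<le> t'" "t' \<le> h" using h by (simp_all add: t'_def field_simps)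
    have "comb g h (\<lambda>_. 1) t = comb g h (\<lambda>_. 1) t'"
      using comb_one_add[of h t' m] by (simp add: t'_def)
    also have "\<dots> \<le> infsum b UNIV"
      unfolding comb_def
    proof (rule infsum_mono)
      show "(\<lambda>k. 1 * g (t' - of_int k * h)) summable_on UNIV" using summable_shift[of h t'] h by simp
      fix k
      have "g (t' - of_int k * h) \<le> C * exp (a * \<bar>t'\<bar>) * exp (- (a * \<bar>h\<bar>) * \<bar>of_int k\<bar>)" by (rule g_le_shift)
      also have "a * \<bar>t'\<bar> \<le> a * h" using t' a_pos by simp
      then have "C * exp (a * \<bar>t'\<bar>) * exp (- (a * \<bar>h\<bar>) * \<bar>of_int k\<bar>) \<le> b k"
        unfolding b_def using C_pos h by (simp add: mult_right_mono)
      finally show "1 * g (t' - of_int k * h) \<le> b k" by simp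
    qed (rule b)
    finally show ?thesis .
  qed
  moreover have "infsum b UNIV \<ge> 0" using C_pos by (intro infsum_nonneg) (simp add: b_def)
  ultimately show ?thesis by (intro exI[of _ "infsum b UNIV + 1"]) (auto intro: order_trans add_increasing2)
qed

text \<open>Each \<open>c n\<close> is at most the root of the sum of squares over one period; what
  remains is a comb of the constant sequence, bounded uniformly in \<open>s\<close> and
  \<open>i\<close>.\<close>

lemma (in tp_decay) row_sum_upper_bound:
  assumes pq: "0 < p" "0 < q"
  shows "\<exists>B>0. \<forall>s c i. (\<forall>n. c (n + int p) = cis (2 * pi * \<nu>) * c n) \<longrightarrow>
     (cmod (row_sum g p q s c i))\<^sup>2 \<le> B * (\<Sum>l<p. (cmod (c (int l)))\<^sup>2)"
proof -
  define \<gamma> where "\<gamma> = real q / of_nat p"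
  have \<gamma>: "\<gamma> > 0" using pq by (simp add: \<gamma>_def)
  obtain G where G: "G > 0" "\<And>t. comb g \<gamma> (\<lambda>_. 1) t \<le> G" using comb_one_bounded[OF \<gamma>] by blast
  have "(cmod (row_sum g p q s c i))\<^sup>2 \<le> G\<^sup>2 * (\<Sum>l<p. (cmod (c (int l)))\<^sup>2)"
    if c: "\<forall>n. c (n + int p) = cis (2 * pi * \<nu>) * c n" for s c i
  proof -
    define S where "S = (\<Sum>l<p. (cmod (c (int l)))\<^sup>2)"
    have S: "S \<ge> 0" by (simp add: S_def sum_nonneg)
    have cS: "cmod (c n) \<le> sqrt S" for n
      using quasi_periodic_bound[of c p \<nu> n] c pq(1) by (simp add: S_def real_le_rsqrt)
    define t where "t = s + of_int i / of_nat p"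
    have arg: "s + of_int (i + k * int q) / of_nat p = t - of_int (- k) * \<gamma>" for k
      by (simp add: t_def \<gamma>_def add_divide_distrib)
    have sg: "(\<lambda>k::int. g (t - of_int (- k) * \<gamma>)) summable_on UNIV"
      using summable_shift[of "- \<gamma>" t] \<gamma> by simp
    have sr: "(\<lambda>k::int. sqrt S * g (t - of_int (- k) * \<gamma>)) summable_on UNIV"
      by (intro summable_on_cmult_right sg)
    have "cmod (row_sum g p q s c i) \<le> (\<Sum>\<^sub>\<infinity>k\<in>(UNIV::int set). sqrt S * g (t - of_int (- k) * \<gamma>))"
      unfolding row_sum_def arg
    proof (rule norm_infsum_le[OF has_sum_infsum has_sum_infsum[OF sr]])
      show le: "norm (c (i + k * int q) * of_real (g (t - of_int (- k) * \<gamma>))) \<le> sqrt S * g (t - of_int (- k) * \<gamma>)" for k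
        using cS nonneg by (simp add: norm_mult mult_right_mono del: of_int_minus)
      show "(\<lambda>k. c (i + k * int q) * of_real (g (t - of_int (- k) * \<gamma>))) summable_on UNIV"
        by (rule abs_summable_summable, rule summable_on_comparison_test[OF sr]) (use le in auto)
    qed
    also have "\<dots> = sqrt S * (\<Sum>\<^sub>\<infinity>k\<in>(UNIV::int set). g (t - of_int (- k) * \<gamma>))" by (rule infsum_cmult_right')
    also have "(\<Sum>\<^sub>\<infinity>k\<in>(UNIV::int set). g (t - of_int (- k) * \<gamma>)) = comb g \<gamma> (\<lambda>_. 1) t"
      unfolding comb_def by (rule infsum_reindex_bij_witness[of _ uminus uminus]) auto
    also have "sqrt S * comb g \<gamma> (\<lambda>_. 1) t \<le> sqrt S * G" using G S by (intro mult_left_mono) auto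
    finally have "(cmod (row_sum g p q s c i))\<^sup>2 \<le> (sqrt S * G)\<^sup>2" by (intro power_mono) auto
    then show ?thesis using S by (simp add: power_mult_distrib S_def[symmetric] mult.commute)
  qed
  then show ?thesis using G(1) by (intro exI[of _ "G\<^sup>2"]) auto
qed

lemma periodic_set_integrable:
  fixes F :: "real \<Rightarrow> real"
  assumes F: "F \<in> borel_measurable lebesgue" "\<And>t. F (t + 1) = F t" and int: "set_integrable lebesgue {0<..<1} F"
    and uw: "0 \<le> u" "h \<ge> 0"
  shows "set_integrable lebesgue {0<..<h} (\<lambda>t. F (t + u))"
proof -
  have Fn: "F (t + of_nat n) = F t" for t and n :: nat
  proof (induction n)
    case (Suc n)
    then show ?case using F(2)[of "t + of_nat n"] by (simp add: add_ac)
  qed simp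
  have all: "set_integrable lebesgue {0..<of_nat n} F" for n :: nat
  proof (induction n)
    case (Suc n)
    have "set_integrable lebesgue {0..<1} (\<lambda>x. F (x + of_nat n))"
      unfolding Fn using int set_integral_Ioo_Ico(1)[OF F(1)] by blast
    then have "set_integrable lebesgue {of_nat n..<1 + of_nat n} F"
      using set_integral_Ico_translate(1)[OF F(1), of 0 1 "of_nat n"] by simp
    then have "set_integrable lebesgue ({0..<of_nat n} \<union> {of_nat n..<1 + of_nat n}) F"
      using Suc by (intro set_integrable_Un) auto
    moreover have "{0..<of_nat n} \<union> {of_nat n..<1 + of_nat n} = {0..<real (Suc n)}" by auto
    ultimately show ?case by simp
  qed simp
  obtain n :: nat where n: "h + u \<le> of_nat n" using real_arch_simple by blast
  have "set_integrable lebesgue {0 + u..<h + u} F"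
    by (rule set_integrable_subset[OF all[of n]]) (use uw n in auto)
  then have "set_integrable lebesgue {0..<h} (\<lambda>t. F (t + u))"
    using set_integral_Ico_translate(1)[OF F(1), of 0 h u] by simp
  then show ?thesis
    using set_integral_Ioo_Ico(1)[OF borel_measurable_lebesgue_translate[OF F(1)]] by blast
qed

lemma set_integrable_lebesgue_on:
  fixes f :: "real \<Rightarrow> 'b::{banach, second_countable_topology}"
  shows "integrable (lebesgue_on {0<..<T}) f \<longleftrightarrow> set_integrable lebesgue {0<..<T} f"
    and "integral\<^sup>L (lebesgue_on {0<..<T}) f = (LINT t:{0<..<T}|lebesgue. f t)"
  by (simp_all add: integrable_restrict_space integral_restrict_space set_integrable_def set_lebesgue_integral_def)

section \<open>From frame coefficients to row sums\<close>

locale gabor_tp = tp_decay +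
  fixes p q :: nat and \<nu> :: real
  assumes pq: "0 < p" "p < q" "coprime p q"
    and g_measurable: "g \<in> borel_measurable lebesgue"
begin

text \<open>The common period of the modulations by multiples of \<open>p / q\<close>, which thereby
  become the exponentials on \<open>(0, \<gamma>)\<close>.\<close>

abbreviation "\<gamma> \<equiv> real q / real p"

abbreviation "G \<equiv> (\<lambda>t. complex_of_real (g t))"

abbreviation "\<psi> \<equiv> gabor_system \<nu> G (real p / real q)"

lemma q_pos: "0 < q" using pq by simp

lemma \<gamma>_pos: "\<gamma> > 0"
  using pq by simp

sublocale fourier: interval_fourier \<gamma>
  by unfold_locales (rule \<gamma>_pos)

lemma G_measurable: "G \<in> borel_measurable lebesgue"
  using g_measurable by measurable

lemma modulation_eq: "modulation (real p / real q * of_int n) G t = fourier.e n t * G t"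
  using pq by (simp add: modulation_def fourier.e_def mult_ac)

lemma \<psi>_eq: "\<psi> n t = (\<Sum>\<^sub>\<infinity>k\<in>(UNIV::int set). cis (2 * pi * of_int k * \<nu>) * (fourier.e n (t - of_int k) * G (t - of_int k)))"
  unfolding gabor_system_def quasi_periodize_def modulation_eq ..

lemma \<psi>_abs_summable:
  "(\<lambda>k::int. norm (cis (2 * pi * of_int k * \<nu>) * (fourier.e n (t - of_int k) * G (t - of_int k)))) summable_on UNIV"
  using summable_shift[of 1 t] nonneg by (simp add: norm_mult)

lemma \<psi>_bounded: "\<exists>B. \<forall>n t. cmod (\<psi> n t) \<le> B"
proof -
  obtain B where B: "\<And>t. comb g 1 (\<lambda>_. 1) t \<le> B" using comb_one_bounded[of 1] by auto
  have "cmod (\<psi> n t) \<le> B" for n t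
  proof -
    have "cmod (\<psi> n t) \<le> (\<Sum>\<^sub>\<infinity>k\<in>(UNIV::int set). norm (cis (2 * pi * of_int k * \<nu>) * (fourier.e n (t - of_int k) * G (t - of_int k))))"
      unfolding \<psi>_eq by (rule norm_infsum_bound[OF \<psi>_abs_summable])
    also have "\<dots> = comb g 1 (\<lambda>_. 1) t" using nonneg by (simp add: comb_def norm_mult)
    finally show ?thesis using B[of t] by simp
  qed
  then show ?thesis by blast
qed

lemma e_borel: "fourier.e n \<in> borel_measurable lebesgue"
proof -
  have "continuous_on UNIV (fourier.e n)"
    unfolding fourier.e_def using pq by (intro continuous_intros) auto
  then show ?thesis by (intro measurable_completion) (simp add: borel_measurable_continuous_onI)
qed

lemma \<psi>_measurable: "\<psi> n \<in> borel_measurable lebesgue"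
proof -
  have "(\<lambda>t. fourier.e n (t - of_int k) * G (t - of_int k)) \<in> borel_measurable lebesgue" for k
    using borel_measurable_lebesgue_translate[OF borel_measurable_times[OF e_borel G_measurable], of n "- of_int k"] by simp
  then have "(\<lambda>t. cis (2 * pi * of_int k * \<nu>) * (fourier.e n (t - of_int k) * G (t - of_int k))) \<in> borel_measurable lebesgue" for k
    by (intro borel_measurable_times[OF borel_measurable_const])
  from borel_measurable_infsum_int[OF this \<psi>_abs_summable] show ?thesis
    unfolding \<psi>_eq[abs_def] .
qed

lemma \<psi>_quasi_periodic: "\<psi> n (t + of_int k) = cis (2 * pi * of_int k * \<nu>) * \<psi> n t"
proof -
  define \<phi> where "\<phi> j = cis (2 * pi * of_int j * \<nu>) * (fourier.e n (t - of_int j) * G (t - of_int j))" for j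
  have "\<psi> n (t + of_int k) = (\<Sum>\<^sub>\<infinity>j\<in>(UNIV::int set). cis (2 * pi * of_int (j + k) * \<nu>) * (fourier.e n (t + of_int k - of_int (j + k)) * G (t + of_int k - of_int (j + k))))"
    unfolding \<psi>_eq by (rule infsum_int_shift[symmetric])
  also have "\<dots> = (\<Sum>\<^sub>\<infinity>j\<in>(UNIV::int set). cis (2 * pi * of_int k * \<nu>) * \<phi> j)"
    by (intro infsum_cong) (simp add: \<phi>_def cis_mult[symmetric] algebra_simps)
  also have "\<dots> = cis (2 * pi * of_int k * \<nu>) * \<psi> n t"
    unfolding infsum_cmult_right' by (simp add: \<psi>_eq \<phi>_def)
  finally show ?thesis .
qed

lemma \<psi>_in_L2_quasi: "\<psi> n \<in> L2_quasi \<nu>"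
proof -
  obtain B where B: "\<And>n t. cmod (\<psi> n t) \<le> B" using \<psi>_bounded by blast
  interpret unit: interval_fourier 1 by unfold_locales simp
  have "square_integrable (lebesgue_on {0<..<1}) (\<psi> n)"
    by (rule unit.square_integrable_bounded[OF measurable_restrict_space1[OF \<psi>_measurable] B])
  then have "set_integrable lebesgue {0<..<1} (\<lambda>t. (cmod (\<psi> n t))\<^sup>2)"
    by (simp add: square_integrable_def set_integrable_lebesgue_on)
  then show ?thesis using \<psi>_measurable \<psi>_quasi_periodic by (simp add: L2_quasi_def)
qed

definition H :: "(real \<Rightarrow> complex) \<Rightarrow> real \<Rightarrow> complex" where
  "H f t = (\<Sum>\<^sub>\<infinity>k\<in>(UNIV::int set). f (t + of_int k * \<gamma>) * G (t + of_int k * \<gamma>))"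

context
  fixes f assumes f: "f \<in> L2_quasi \<nu>"
begin

lemma f_measurable: "f \<in> borel_measurable lebesgue"
  and f_quasi: "f (t + of_int k) = cis (2 * pi * of_int k * \<nu>) * f t"
  and f_square: "set_integrable lebesgue {0<..<1} (\<lambda>t. (cmod (f t))\<^sup>2)"
  using f by (auto simp: L2_quasi_def)

definition c :: "real \<Rightarrow> int \<Rightarrow> complex" where "c s n = f (s + of_int n / real p)"

lemma c_quasi: "c s (n + int p) = cis (2 * pi * \<nu>) * c s n"
  using f_quasi[of "s + of_int n / real p" 1] pq by (simp add: c_def add_divide_distrib add.assoc)

lemma H_eq_row_sum: "H f (s + of_int i / real p) = row_sum g p q s (c s) i"
proof -
  have "s + of_int i / real p + of_int k * \<gamma> = s + of_int (i + k * int q) / real p" for k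
    by (simp add: add_divide_distrib)
  then show ?thesis by (simp only: H_def row_sum_def c_def)
qed

lemma c_bounded: "\<exists>V. \<forall>n. cmod (c s n) \<le> V"
proof -
  have "cmod (c s n) \<le> sqrt (\<Sum>l<p. (cmod (c s (int l)))\<^sup>2)" for n
    using quasi_periodic_bound[of "c s" p \<nu> n] c_quasi pq(1) by (simp add: real_le_rsqrt)
  then show ?thesis by blast
qed

text \<open>Both systems of sums below run over the grid \<open>s + \<int>/p\<close>, once along residue classes modulo \<open>p\<close>
  and once modulo \<open>q\<close>.\<close>

lemma grid_summable:
  "(\<lambda>m::int. f (s + of_int m / real p) * G (s + of_int m / real p) * cnj (fourier.e n (s + of_int m / real p))) summable_on UNIV"
proof -
  obtain V where V: "\<And>m. cmod (c s m) \<le> V" using c_bounded by blast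
  have V_summable: "(\<lambda>m::int. V * g (s - of_int m * (- (1 / real p)))) summable_on UNIV"
    using pq by (intro summable_on_cmult_right summable_shift) auto
  have "norm (f (s + of_int m / real p) * G (s + of_int m / real p) * cnj (fourier.e n (s + of_int m / real p))) \<le> V * g (s - of_int m * (- (1 / real p)))" for m
    using V[of m] nonneg by (simp add: norm_mult c_def mult_right_mono)
  then show ?thesis
    by (intro abs_summable_summable[OF summable_on_comparison_test[OF V_summable]]) auto
qed

text \<open>Quasi-periodicity of \<open>f\<close> absorbs the phases in \<open>\<psi>\<close>,
  leaving the plain periodization, with period 1, of a single function.\<close>

lemma f_\<psi>_eq: "f t * cnj (\<psi> n t) = (\<Sum>\<^sub>\<infinity>k\<in>(UNIV::int set). f (t + of_int k) * G (t + of_int k) * cnj (fourier.e n (t + of_int k)))"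
proof -
  have "f t * cnj (\<psi> n t) = (\<Sum>\<^sub>\<infinity>k\<in>(UNIV::int set). f t * cnj (cis (2 * pi * of_int k * \<nu>) * (fourier.e n (t - of_int k) * G (t - of_int k))))"
    unfolding \<psi>_eq infsum_cnj[symmetric] by (rule infsum_cmult_right'[symmetric])
  also have "\<dots> = (\<Sum>\<^sub>\<infinity>k\<in>(UNIV::int set). f (t - of_int k) * G (t - of_int k) * cnj (fourier.e n (t - of_int k)))"
  proof (rule infsum_cong)
    fix k :: int
    have "f (t - of_int k) = cnj (cis (2 * pi * of_int k * \<nu>)) * f t"
      using f_quasi[of t "- k"] by (simp add: cis_cnj)
    then show "f t * cnj (cis (2 * pi * of_int k * \<nu>) * (fourier.e n (t - of_int k) * G (t - of_int k))) =
        f (t - of_int k) * G (t - of_int k) * cnj (fourier.e n (t - of_int k))" by simp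
  qed
  also have "\<dots> = (\<Sum>\<^sub>\<infinity>k\<in>(UNIV::int set). f (t + of_int k) * G (t + of_int k) * cnj (fourier.e n (t + of_int k)))"
    by (rule infsum_reindex_bij_witness[of _ uminus uminus]) auto
  finally show ?thesis .
qed

lemma e_periodic: "fourier.e n (t + of_int k * \<gamma>) = fourier.e n t"
proof -
  have "2 * pi * of_int n * (t + of_int k * x) / x = 2 * pi * of_int n * t / x + 2 * pi * of_int (n * k)" if "x > 0" for x :: real
    using that by (simp add: field_simps)
  from this[OF \<gamma>_pos] show ?thesis by (simp add: fourier.e_def cis_mult[symmetric] cis_multiple_2pi del: of_int_mult)
qed

lemma H_e_eq: "H f t * cnj (fourier.e n t) =
   (\<Sum>\<^sub>\<infinity>k\<in>(UNIV::int set). f (t + of_int k * \<gamma>) * G (t + of_int k * \<gamma>) * cnj (fourier.e n (t + of_int k * \<gamma>)))"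
  unfolding e_periodic H_def by (rule infsum_cmult_left'[symmetric])

lemma cell_sums_eq:
  "(\<Sum>l<p. f (s + of_nat l * (1 / real p)) * cnj (\<psi> n (s + of_nat l * (1 / real p)))) =
   (\<Sum>i<q. H f (s + of_nat i * (1 / real p)) * cnj (fourier.e n (s + of_nat i * (1 / real p))))"
proof -
  define F where "F m = f (s + of_int m / real p) * G (s + of_int m / real p) * cnj (fourier.e n (s + of_int m / real p))" for m
  have F: "F summable_on UNIV" unfolding F_def by (rule grid_summable)
  have "s + of_nat l * (1 / real p) + of_int k = s + of_int (int l + k * int p) / real p" for l k
    using pq by (simp add: add_divide_distrib)
  then have "(\<Sum>l<p. f (s + of_nat l * (1 / real p)) * cnj (\<psi> n (s + of_nat l * (1 / real p)))) =
      (\<Sum>l<p. \<Sum>\<^sub>\<infinity>k\<in>(UNIV::int set). F (int l + k * int p))"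
    unfolding f_\<psi>_eq F_def by (simp only:)
  also have "\<dots> = infsum F UNIV" using infsum_residue_classes[OF F, of p] pq by simp
  also have "\<dots> = (\<Sum>i<q. \<Sum>\<^sub>\<infinity>k\<in>(UNIV::int set). F (int i + k * int q))"
    using pq by (intro infsum_residue_classes[OF F]) auto
  also have "\<dots> = (\<Sum>i<q. H f (s + of_nat i * (1 / real p)) * cnj (fourier.e n (s + of_nat i * (1 / real p))))"
  proof -
    have "s + of_nat i * (1 / real p) + of_int k * \<gamma> = s + of_int (int i + k * int q) / real p" for i k
      by (simp add: add_divide_distrib)
    then show ?thesis unfolding H_e_eq F_def by (simp only:)
  qed
  finally show ?thesis .
qed

lemma H_measurable: "H f \<in> borel_measurable lebesgue"
proof -
  have abs: "(\<lambda>k::int. norm (f (t + of_int k * \<gamma>) * G (t + of_int k * \<gamma>))) summable_on UNIV" for t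
  proof -
    obtain V where V: "\<And>m. cmod (c t m) \<le> V" using c_bounded by blast
    have V_summable: "(\<lambda>k::int. V * g (t - of_int k * (- \<gamma>))) summable_on UNIV"
      using pq by (intro summable_on_cmult_right summable_shift) auto
    have "norm (f (t + of_int k * \<gamma>) * G (t + of_int k * \<gamma>)) \<le> V * g (t - of_int k * (- \<gamma>))" for k
      using V[of "k * int q"] nonneg by (simp add: norm_mult c_def mult_right_mono)
    then show ?thesis by (intro summable_on_comparison_test[OF V_summable]) auto
  qed
  have "(\<lambda>t. f (t + of_int k * \<gamma>) * G (t + of_int k * \<gamma>)) \<in> borel_measurable lebesgue" for k
    by (intro borel_measurable_times borel_measurable_lebesgue_translate f_measurable G_measurable)
  from borel_measurable_infsum_int[OF this abs] show ?thesis unfolding H_def[abs_def] .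
qed

lemma f_square_shift: "h \<ge> 0 \<Longrightarrow> 0 \<le> u \<Longrightarrow> set_integrable lebesgue {0<..<h} (\<lambda>t. (cmod (f (t + u)))\<^sup>2)"
proof (rule periodic_set_integrable[where F = "\<lambda>t. (cmod (f t))\<^sup>2"])
  show "(\<lambda>t. (cmod (f t))\<^sup>2) \<in> borel_measurable lebesgue" using f_measurable by measurable
  show "(cmod (f (t + 1)))\<^sup>2 = (cmod (f t))\<^sup>2" for t using f_quasi[of t 1] by (simp add: norm_mult)
qed (use f_square in simp_all)

lemma H_square_integrable: "square_integrable fourier.M (H f)"
proof -
  obtain B where B: "\<forall>s c i. (\<forall>n. c (n + int p) = cis (2 * pi * \<nu>) * c n) \<longrightarrow>
     (cmod (row_sum g p q s c i))\<^sup>2 \<le> B * (\<Sum>l<p. (cmod (c (int l)))\<^sup>2)"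
    using row_sum_upper_bound[OF pq(1) q_pos, of \<nu>] by blast
  have "integrable fourier.M (\<lambda>t. (cmod (H f t))\<^sup>2)"
  proof (rule Bochner_Integration.integrable_bound)
    have "integrable fourier.M (\<lambda>t. (cmod (c t (int l)))\<^sup>2)" for l
      unfolding set_integrable_lebesgue_on c_def using f_square_shift[of \<gamma> "of_int (int l) / real p"] by simp
    then show "integrable fourier.M (\<lambda>t. B * (\<Sum>l<p. (cmod (c t (int l)))\<^sup>2))" by simp
    show "(\<lambda>t. (cmod (H f t))\<^sup>2) \<in> borel_measurable fourier.M"
      using measurable_restrict_space1[OF H_measurable] by measurable
    have "(cmod (H f t))\<^sup>2 \<le> B * (\<Sum>l<p. (cmod (c t (int l)))\<^sup>2)" for t
      using B[rule_format, of "c t" t 0] H_eq_row_sum[of t 0] c_quasi by simp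
    then show "AE t in fourier.M. norm ((cmod (H f t))\<^sup>2) \<le> norm (B * (\<Sum>l<p. (cmod (c t (int l)))\<^sup>2))"
      by (auto intro: order_trans[OF _ abs_ge_self] simp del: abs_mult)
  qed
  then show ?thesis using measurable_restrict_space1[OF H_measurable] by (simp add: square_integrable_def)
qed

text \<open>Formally both sides fold the integral of \<open>f * G * cnj e\<close> over the line, one
  modulo 1 and the other modulo \<open>\<gamma>\<close>. The length \<open>1 / p\<close> divides
  both periods, so on a common cell only sums over the same grid are compared.\<close>

lemma inner01_eq_coeff: "inner01 f (\<psi> n) = fourier.coeff (H f) n"
proof -
  have p1: "1 / real p > 0" using pq by simp
  have c1: "real p * (1 / real p) = 1" "real q * (1 / real p) = \<gamma>" using pq by auto
  have cnj_borel: "cnj \<in> borel_measurable borel" by (intro borel_measurable_continuous_onI continuous_intros)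
  have m1: "(\<lambda>t. f t * cnj (\<psi> n t)) \<in> borel_measurable lebesgue"
    by (intro borel_measurable_times f_measurable measurable_compose[OF \<psi>_measurable cnj_borel])
  have m2: "(\<lambda>t. H f t * cnj (fourier.e n t)) \<in> borel_measurable lebesgue"
    by (intro borel_measurable_times H_measurable measurable_compose[OF e_borel cnj_borel])
  have "square_integrable (lebesgue_on {0<..<1}) f" "square_integrable (lebesgue_on {0<..<1}) (\<psi> n)"
    using f_square \<psi>_in_L2_quasi[of n] measurable_restrict_space1[OF f_measurable] measurable_restrict_space1[OF \<psi>_measurable]
    by (auto simp: square_integrable_def set_integrable_lebesgue_on L2_quasi_def)
  then have i1: "set_integrable lebesgue {0<..<real p * (1 / real p)} (\<lambda>t. f t * cnj (\<psi> n t))"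
    unfolding c1 set_integrable_lebesgue_on(1)[symmetric] by (rule square_integrable_mult)
  have i2: "set_integrable lebesgue {0<..<real q * (1 / real p)} (\<lambda>t. H f t * cnj (fourier.e n t))"
    unfolding c1 set_integrable_lebesgue_on(1)[symmetric]
    by (rule square_integrable_mult[OF H_square_integrable fourier.square_integrable_e])
  have "inner01 f (\<psi> n) = (LINT t:{0<..<real p * (1 / real p)}|lebesgue. f t * cnj (\<psi> n t))"
    unfolding c1 inner01_def ..
  also have "\<dots> = (LINT t:{0<..<real q * (1 / real p)}|lebesgue. H f t * cnj (fourier.e n t))"
    unfolding set_integral_cells[OF m1 p1 i1] set_integral_cells[OF m2 p1 i2] cell_sums_eq ..
  finally show ?thesis unfolding c1 by (simp add: fourier.coeff_def set_integrable_lebesgue_on)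
qed

lemma norm01_square: "(norm01 f)\<^sup>2 = (LINT s:{0<..<1/real p}|lebesgue. (\<Sum>l<p. (cmod (c s (int l)))\<^sup>2))"
proof -
  have "0 \<le> (LINT t:{0<..<1}|lebesgue. (cmod (f t))\<^sup>2)"
    unfolding set_lebesgue_integral_def by (intro integral_nonneg_AE) auto
  then have "(norm01 f)\<^sup>2 = (LINT t:{0<..<real p * (1 / real p)}|lebesgue. (cmod (f t))\<^sup>2)"
    using pq by (simp add: norm01_def)
  also have "\<dots> = (LINT s:{0<..<1/real p}|lebesgue. (\<Sum>l<p. (cmod (f (s + of_nat l * (1 / real p))))\<^sup>2))"
  proof (rule set_integral_cells)
    show "(\<lambda>t. (cmod (f t))\<^sup>2) \<in> borel_measurable lebesgue" using f_measurable by measurable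
    show "set_integrable lebesgue {0<..<real p * (1 / real p)} (\<lambda>t. (cmod (f t))\<^sup>2)" using f_square pq by simp
  qed (use pq in simp)
  finally show ?thesis by (simp add: c_def)
qed

lemma H_square: "(LINT t|fourier.M. (cmod (H f t))\<^sup>2) =
   (LINT s:{0<..<1/real p}|lebesgue. (\<Sum>i<q. (cmod (row_sum g p q s (c s) (int i)))\<^sup>2))"
proof -
  have "(LINT t|fourier.M. (cmod (H f t))\<^sup>2) = (LINT t:{0<..<real q * (1 / real p)}|lebesgue. (cmod (H f t))\<^sup>2)"
    using pq by (simp add: set_integrable_lebesgue_on)
  also have "\<dots> = (LINT s:{0<..<1/real p}|lebesgue. (\<Sum>i<q. (cmod (H f (s + of_nat i * (1 / real p))))\<^sup>2))"
  proof (rule set_integral_cells)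
    show "(\<lambda>t. (cmod (H f t))\<^sup>2) \<in> borel_measurable lebesgue" using H_measurable by measurable
    show "set_integrable lebesgue {0<..<real q * (1 / real p)} (\<lambda>t. (cmod (H f t))\<^sup>2)"
      using H_square_integrable by (simp add: square_integrable_def set_integrable_lebesgue_on)
  qed (use pq in simp)
  also have "\<dots> = (LINT s:{0<..<1/real p}|lebesgue. (\<Sum>i<q. (cmod (row_sum g p q s (c s) (int i)))\<^sup>2))"
    using H_eq_row_sum[of _ "int _"] by simp
  finally show ?thesis .
qed

lemma cell_integrable:
  "set_integrable lebesgue {0<..<1/real p} (\<lambda>s. \<Sum>l<p. (cmod (c s (int l)))\<^sup>2)"
  "set_integrable lebesgue {0<..<1/real p} (\<lambda>s. \<Sum>i<q. (cmod (row_sum g p q s (c s) (int i)))\<^sup>2)"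
proof -
  have "set_integrable lebesgue {0<..<1/real p} (\<lambda>s. (cmod (c s (int l)))\<^sup>2)" for l
    unfolding c_def using f_square_shift[of "1 / real p" "of_int (int l) / real p"] by simp
  then show i1: "set_integrable lebesgue {0<..<1/real p} (\<lambda>s. \<Sum>l<p. (cmod (c s (int l)))\<^sup>2)"
    unfolding set_integrable_def scaleR_sum_right by (intro Bochner_Integration.integrable_sum)
  obtain B where B: "\<forall>s c i. (\<forall>n. c (n + int p) = cis (2 * pi * \<nu>) * c n) \<longrightarrow>
     (cmod (row_sum g p q s c i))\<^sup>2 \<le> B * (\<Sum>l<p. (cmod (c (int l)))\<^sup>2)"
    using row_sum_upper_bound[OF pq(1) q_pos, of \<nu>] by blast
  have "set_integrable lebesgue {0<..<1/real p} (\<lambda>s. (cmod (row_sum g p q s (c s) (int i)))\<^sup>2)" for i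
    unfolding set_integrable_def
  proof (rule Bochner_Integration.integrable_bound)
    show "integrable lebesgue (\<lambda>s. B * (indicator {0<..<1/real p} s *\<^sub>R (\<Sum>l<p. (cmod (c s (int l)))\<^sup>2)))"
      using i1 unfolding set_integrable_def by (rule integrable_mult_right)
    have "(\<lambda>s. (cmod (H f (s + of_nat i / real p)))\<^sup>2) \<in> borel_measurable lebesgue"
      using borel_measurable_lebesgue_translate[OF H_measurable, of "of_nat i / real p"] by measurable
    then show "(\<lambda>s. indicator {0<..<1/real p} s *\<^sub>R (cmod (row_sum g p q s (c s) (int i)))\<^sup>2) \<in> borel_measurable lebesgue"
      using H_eq_row_sum[of _ "int i"] by (intro borel_measurable_scaleR borel_measurable_indicator) auto
    have "norm ((cmod (row_sum g p q s (c s) (int i)))\<^sup>2) \<le> norm (B * (\<Sum>l<p. (cmod (c s (int l)))\<^sup>2))" for s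
      using order_trans[OF B[rule_format, of "c s" s "int i"] abs_ge_self] c_quasi by (simp del: abs_mult)
    then show "AE s in lebesgue. norm (indicator {0<..<1/real p} s *\<^sub>R (cmod (row_sum g p q s (c s) (int i)))\<^sup>2) \<le>
        norm (B * (indicator {0<..<1/real p} s *\<^sub>R (\<Sum>l<p. (cmod (c s (int l)))\<^sup>2)))"
      by (intro AE_I2) (simp add: indicator_def)
  qed
  then show "set_integrable lebesgue {0<..<1/real p} (\<lambda>s. \<Sum>i<q. (cmod (row_sum g p q s (c s) (int i)))\<^sup>2)"
    unfolding set_integrable_def scaleR_sum_right by (intro Bochner_Integration.integrable_sum)
qed

lemma H_square_bounds:
  assumes lower: "\<forall>s\<in>{0..1}. \<forall>c. (\<forall>n. c (n + int p) = cis (2 * pi * \<nu>) * c n) \<longrightarrow>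
       A * (\<Sum>l<p. (cmod (c (int l)))\<^sup>2) \<le> (\<Sum>i<q. (cmod (row_sum g p q s c (int i)))\<^sup>2)"
    and upper: "\<forall>s c i. (\<forall>n. c (n + int p) = cis (2 * pi * \<nu>) * c n) \<longrightarrow>
       (cmod (row_sum g p q s c i))\<^sup>2 \<le> B * (\<Sum>l<p. (cmod (c (int l)))\<^sup>2)"
  shows "A * (norm01 f)\<^sup>2 \<le> (LINT t|fourier.M. (cmod (H f t))\<^sup>2)"
    and "(LINT t|fourier.M. (cmod (H f t))\<^sup>2) \<le> (of_nat q * B) * (norm01 f)\<^sup>2"
proof -
  \<comment> \<open>Base points of cells lie in the compact interval on which the lower bound is
    uniform.\<close>
  have s01: "s \<in> {0..1}" if "s \<in> {0<..<1/real p}" for s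
  proof -
    have "1 / real p \<le> 1" using pq by simp
    then show ?thesis using that by auto
  qed
  have "A * (norm01 f)\<^sup>2 = (LINT s:{0<..<1/real p}|lebesgue. A * (\<Sum>l<p. (cmod (c s (int l)))\<^sup>2))"
    unfolding norm01_square by simp
  also have "\<dots> \<le> (LINT t|fourier.M. (cmod (H f t))\<^sup>2)"
    unfolding H_square
  proof (rule set_integral_mono)
    show "set_integrable lebesgue {0<..<1/real p} (\<lambda>s. A * (\<Sum>l<p. (cmod (c s (int l)))\<^sup>2))"
      using cell_integrable(1) by (rule set_integrable_mult_right)
    show "A * (\<Sum>l<p. (cmod (c s (int l)))\<^sup>2) \<le> (\<Sum>i<q. (cmod (row_sum g p q s (c s) (int i)))\<^sup>2)"
      if "s \<in> {0<..<1/real p}" for s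
      using lower[rule_format, OF s01[OF that], of "c s"] c_quasi by blast
  qed (rule cell_integrable(2))
  finally show "A * (norm01 f)\<^sup>2 \<le> (LINT t|fourier.M. (cmod (H f t))\<^sup>2)" .
  have "(\<Sum>i<q. (cmod (row_sum g p q s (c s) (int i)))\<^sup>2) \<le> (of_nat q * B) * (\<Sum>l<p. (cmod (c s (int l)))\<^sup>2)" for s
  proof -
    have "(\<Sum>i<q. (cmod (row_sum g p q s (c s) (int i)))\<^sup>2) \<le> (\<Sum>i<q. B * (\<Sum>l<p. (cmod (c s (int l)))\<^sup>2))"
      using upper c_quasi by (intro sum_mono) blast
    then show ?thesis by (simp add: mult.assoc)
  qed
  then have "(LINT t|fourier.M. (cmod (H f t))\<^sup>2) \<le> (LINT s:{0<..<1/real p}|lebesgue. (of_nat q * B) * (\<Sum>l<p. (cmod (c s (int l)))\<^sup>2))"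
    unfolding H_square
    by (intro set_integral_mono set_integrable_mult_right cell_integrable)
  also have "\<dots> = (of_nat q * B) * (norm01 f)\<^sup>2" unfolding norm01_square by simp
  finally show "(LINT t|fourier.M. (cmod (H f t))\<^sup>2) \<le> (of_nat q * B) * (norm01 f)\<^sup>2" .
qed

lemma frame_sum: "((\<lambda>n. (cmod (inner01 f (\<psi> n)))\<^sup>2) has_sum (\<gamma> * (LINT t|fourier.M. (cmod (H f t))\<^sup>2))) UNIV"
  unfolding inner01_eq_coeff by (rule fourier.parseval[OF H_measurable H_square_integrable])

end

theorem is_gabor_frame_rational: "is_gabor_frame \<nu> G (real p / real q)"
proof -
  obtain A where A: "A > 0" "\<forall>s\<in>{0..1}. \<forall>c. (\<forall>n. c (n + int p) = cis (2 * pi * \<nu>) * c n) \<longrightarrow>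
       A * (\<Sum>l<p. (cmod (c (int l)))\<^sup>2) \<le> (\<Sum>i<q. (cmod (row_sum g p q s c (int i)))\<^sup>2)"
    using row_sum_lower_bound[OF pq, of \<nu>] by blast
  obtain B where B: "B > 0" "\<forall>s c i. (\<forall>n. c (n + int p) = cis (2 * pi * \<nu>) * c n) \<longrightarrow>
       (cmod (row_sum g p q s c i))\<^sup>2 \<le> B * (\<Sum>l<p. (cmod (c (int l)))\<^sup>2)"
    using row_sum_upper_bound[OF pq(1) q_pos, of \<nu>] by blast
  have "(\<lambda>n. (cmod (inner01 f (\<psi> n)))\<^sup>2) summable_on UNIV \<and>
      (\<gamma> * A) * (norm01 f)\<^sup>2 \<le> (\<Sum>\<^sub>\<infinity>n. (cmod (inner01 f (\<psi> n)))\<^sup>2) \<and>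
      (\<Sum>\<^sub>\<infinity>n. (cmod (inner01 f (\<psi> n)))\<^sup>2) \<le> (\<gamma> * (of_nat q * B)) * (norm01 f)\<^sup>2" if f: "f \<in> L2_quasi \<nu>" for f
  proof -
    have "(\<lambda>n. (cmod (inner01 f (\<psi> n)))\<^sup>2) summable_on UNIV"
      "(\<Sum>\<^sub>\<infinity>n. (cmod (inner01 f (\<psi> n)))\<^sup>2) = \<gamma> * (LINT t|fourier.M. (cmod (H f t))\<^sup>2)"
      using frame_sum[OF f] by (simp_all only: has_sum_iff)
    then show ?thesis
      using H_square_bounds[OF f A(2) B(2)] \<gamma>_pos
      by (simp only: mult.assoc[of \<gamma>] mult_left_mono[OF _ less_imp_le[OF \<gamma>_pos]] simp_thms)
  qed
  \<comment> \<open>The frame bounds are the row sum bounds times Parseval's factor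
    \<open>\<gamma>\<close>; the upper one also counts the \<open>q\<close> rows.\<close>
  moreover have "\<gamma> * A > 0" "\<gamma> * (of_nat q * B) > 0" using A(1) B(1) pq by auto
  ultimately show ?thesis unfolding is_gabor_frame_def using \<psi>_in_L2_quasi by blast
qed

end

theorem corollary4:
  fixes \<nu> \<beta> :: real and g :: "real \<Rightarrow> real"
  assumes "totally_positive g"
    and "L2_norm (\<lambda>t. complex_of_real (g t)) = 1"
    and "integrable lebesgue g"
    and "(\<lambda>t. complex_of_real (g t)) \<in> S0"
    and "\<not> (AE t in lebesgue. g t = exp (- t) * indicator {0..} t)"
    and "\<beta> > 0" and "\<beta> \<in> \<rat>" and "\<beta> < 1"
  shows "is_gabor_frame \<nu> (\<lambda>t. complex_of_real (g t)) \<beta>"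
proof -
  have "tp_function g" using assms(1) by unfold_locales (auto simp: totally_positive_def)
  moreover have "integrable lebesgue (\<lambda>t. (g t)\<^sup>2)" using assms(4) by (simp add: S0_def L2_def)
  \<comment> \<open>The normalization rules out a window that vanishes almost everywhere, which
    total positivity alone permits.\<close>
  moreover have "(LINT t|lebesgue. (g t)\<^sup>2) = 1" using assms(2) by (simp add: L2_norm_def)
  ultimately obtain C a where tpd: "tp_decay g C a" using tp_decay_exists[of g 1] by auto
  \<comment> \<open>Lowest terms: coprimality lets multiples of \<open>p\<close> and
    \<open>q\<close> reach the whole grid.\<close>
  obtain p q :: nat where pq: "q \<noteq> 0" "\<bar>\<beta>\<bar> = real p / real q" "coprime p q"
    using Rats_abs_nat_div_natE[OF assms(7)] by blast
  have \<beta>: "\<beta> = real p / real q" using pq(2) assms(6) by simp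
  have "0 < p" using assms(6) unfolding \<beta> by (simp add: zero_less_divide_iff)
  moreover have "p < q" using assms(8) pq(1) unfolding \<beta> by simp
  ultimately interpret gabor_tp g C a p q \<nu>
    using tpd pq(3) assms(1) by (auto simp: gabor_tp_def gabor_tp_axioms_def totally_positive_def)
  show ?thesis unfolding \<beta> by (rule is_gabor_frame_rational)
qed

end
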